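(* There exist $\epsilon>0$ and $C>0$ such that if $d\in C^\infty_{\mathbf e}(B_1^3,\mathbb{S}^2)$ satisfies $$E(d):=\frac12\int_{B_1^3}|\nabla d|^2\le\epsilon^2\qquad\text{and}\qquad\int_{B_1^3}\big|\Delta d+|\nabla d|^2 d\big|^2\le\epsilon^2,$$ then $$[d]_{C^{1/2}(B_1^3)}\le C\sqrt{\epsilon}.$$
   Context: $B_1^3$ is the open unit ball in $\mathbb{R}^3$, $\mathbb{S}^2$ the unit sphere in $\mathbb{R}^3$, $\mathbf e=(0,0,1)$, and $C^\infty_{\mathbf e}(B_1^3,\mathbb{S}^2)=\{d\in C^\infty(B_1^3,\mathbb{S}^2): d=\mathbf e\text{ on }\partial B_1^3\}$. $[d]_{C^{1/2}(U)}=\sup_{x\ne y\in U}\frac{|d(x)-d(y)|}{|x-y|^{1/2}}$ is the Hölder seminorm. *)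

theory Defs
  imports "HOL-Analysis.Analysis"
begin

definition pd :: "3 \<Rightarrow> (real^3 \<Rightarrow> real^3) \<Rightarrow> (real^3 \<Rightarrow> real^3)" where
  "pd i f = (\<lambda>x. frechet_derivative f (at x) (axis i 1))"

text \<open>C-infinity on an open set U: every iterated partial derivative is differentiable on U
  (hence all of them exist and are continuous).\<close>
definition smooth_on :: "(real^3) set \<Rightarrow> (real^3 \<Rightarrow> real^3) \<Rightarrow> bool" where
  "smooth_on U f \<longleftrightarrow> (\<forall>is. (foldr pd is f) differentiable_on U)"

definition e3 :: "real^3" where "e3 = vector [0, 0, 1]"

definition C_inf_e :: "(real^3 \<Rightarrow> real^3) set" where
  "C_inf_e = {d. smooth_on (ball 0 1) d \<and> (\<forall>x\<in>ball 0 1. norm (d x) = 1)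
               \<and> continuous_on (cball 0 1) d \<and> (\<forall>x\<in>sphere 0 1. d x = e3)}"

definition grad_sq :: "(real^3 \<Rightarrow> real^3) \<Rightarrow> real^3 \<Rightarrow> real" where
  "grad_sq d x = (\<Sum>i\<in>UNIV. (norm (pd i d x))\<^sup>2)"

definition laplacian :: "(real^3 \<Rightarrow> real^3) \<Rightarrow> real^3 \<Rightarrow> real^3" where
  "laplacian d x = (\<Sum>i\<in>UNIV. pd i (pd i d) x)"

definition energy :: "(real^3 \<Rightarrow> real^3) \<Rightarrow> ennreal" where
  "energy d = (\<integral>\<^sup>+ x\<in>ball 0 1. ennreal (grad_sq d x / 2) \<partial>lborel)"

definition tension_sq :: "(real^3 \<Rightarrow> real^3) \<Rightarrow> ennreal" where
  "tension_sq d = (\<integral>\<^sup>+ x\<in>ball 0 1. ennreal ((norm (laplacian d x + grad_sq d x *\<^sub>R d x))\<^sup>2) \<partial>lborel)"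

end

theory Submission
  imports Defs
begin

text \<open>
  Write \<open>\<tau> = \<Delta>d + |\<nabla>d|\<^sup>2 d\<close> and extend \<open>d\<close> by \<open>e\<close> outside the ball. Four facts drive the proof.

  (1) The Green function of the ball represents \<open>d - e\<close> as the potential of
  \<open>|\<nabla>d|\<^sup>2 d - \<tau>\<close>; the kernel difference at \<open>x, x'\<close> is at most
  \<open>2 |x - x'| / (|x - y| |x' - y|)\<close>, so oscillations of \<open>d\<close> are controlled by potentials
  of \<open>|\<nabla>d|\<^sup>2\<close> and \<open>|\<tau>|\<close>.

  (2) Testing the equation with \<open>d - c\<close> times a truncated Newton kernel (\<open>c = d x\<close>, or \<open>c = e\<close> near
  the boundary) bounds the local potential of \<open>|\<nabla>d|\<^sup>2\<close> by the square of the oscillation of \<open>d\<close>.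
  Since this is quadratic, a small oscillation at some scale makes (1) and (2) a contraction in the
  seminorm \<open>sup |d x - d y| / (|x - y| + \<delta>)\<^bsup>1/2\<^esup>\<close>, uniformly in \<open>\<delta>\<close>. This gives a Holder bound that
  depends only on the scale of small oscillation.

  (3) Comparing \<open>d\<close> with its dilations about \<open>p\<close>, weighted by \<open>1 / (|y - p| + R)\<close>, gives the monotonicity
  bound \<open>\<integral> R |\<nabla>d|\<^sup>2 / (|y - p| + R)\<^sup>2 \<le> 5 \<epsilon>\<^sup>2\<close> for every centre in the ball and every \<open>R\<close>. The error term
  \<open>|\<nabla>d|\<^sup>2 |d\<^sub>t - d|\<^sup>2 / t\<close> is dominated precisely because \<open>d\<close> is already known to be Holder-1/2.

  (4) By (1)-(3), if the oscillation at scale \<open>R\<close> is below a threshold, then it is below half the threshold,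
  hence below the threshold at scale \<open>2 R\<close>; doubling reaches the unit scale, where (2) gives the theorem.
\<close>

section \<open>Gradients, Laplacians and integration by parts\<close>

text \<open>The map is only continuous up to the sphere, so no boundary derivative or surface
  integral is available. Each integration by parts is therefore carried out on integrands supported
  in a compact subset of the open domain: a component of \<open>d - e3\<close>, or a kernel
  vanishing on the sphere, is composed with a function that is zero near zero, and the truncation is
  removed by dominated convergence. Kernels are softened by \<open>\<kappa>\<close> so that they are
  smooth on the whole space; the final bounds are uniform in \<open>\<kappa>\<close>.

  There is no circularity in using a Holder bound to reach monotonicity. Its constant depends on the
  scale of small oscillation and may be huge, but it only serves to dominate an error that tends to
  zero, so it is absent from the bound \<open>5 * \<epsilon>\<^sup>2\<close>. The initial scale
  comes from uniform continuity and is not quantified either.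

  Since the statement fixes \<open>\<epsilon>\<close> before \<open>C\<close>, a universal Holder
  constant is enough: the factor \<open>sqrt \<epsilon>\<close> is compensated by the choice of
  \<open>C\<close>.\<close>

definition C1_on :: "'a::euclidean_space set \<Rightarrow> ('a \<Rightarrow> real) \<Rightarrow> ('a \<Rightarrow> 'a) \<Rightarrow> bool" where
  "C1_on S f G \<longleftrightarrow> (\<forall>x\<in>S. (f has_derivative (\<lambda>h. G x \<bullet> h)) (at x)) \<and> continuous_on S G"

text \<open>Here \<open>G\<close> is the gradient and \<open>L\<close> the Laplacian of \<open>f\<close>.\<close>

definition C2_on :: "'a::euclidean_space set \<Rightarrow> ('a \<Rightarrow> real) \<Rightarrow> ('a \<Rightarrow> 'a) \<Rightarrow> ('a \<Rightarrow> real) \<Rightarrow> bool" where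
  "C2_on S f G L \<longleftrightarrow> C1_on S f G \<and>
     (\<exists>H. (\<forall>b\<in>Basis. C1_on S (\<lambda>x. G x \<bullet> b) (H b)) \<and> (\<forall>x\<in>S. L x = (\<Sum>b\<in>Basis. H b x \<bullet> b)))"

lemma C1_on_deriv: "C1_on S f G \<Longrightarrow> x \<in> S \<Longrightarrow> (f has_derivative (\<lambda>h. G x \<bullet> h)) (at x)"
  by (simp add: C1_on_def)

lemma C1_on_cont: "C1_on S f G \<Longrightarrow> continuous_on S f"
  unfolding C1_on_def
  by (meson continuous_at_imp_continuous_on has_derivative_continuous)

lemma C1_on_cont_grad: "C1_on S f G \<Longrightarrow> continuous_on S G"
  by (simp add: C1_on_def)

lemma C1_on_subset: "C1_on S f G \<Longrightarrow> T \<subseteq> S \<Longrightarrow> C1_on T f G"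
  unfolding C1_on_def using continuous_on_subset by blast

lemma C2_on_C1: "C2_on S f G L \<Longrightarrow> C1_on S f G"
  by (simp add: C2_on_def)

lemma C2_on_subset: "C2_on S f G L \<Longrightarrow> T \<subseteq> S \<Longrightarrow> C2_on T f G L"
  unfolding C2_on_def by (meson C1_on_subset subsetD)

lemma C2_on_cont_lap:
  assumes "C2_on S f G L" shows "continuous_on S L"
proof -
  obtain H where H: "\<forall>b\<in>Basis. C1_on S (\<lambda>x. G x \<bullet> b) (H b)" "\<forall>x\<in>S. L x = (\<Sum>b\<in>Basis. H b x \<bullet> b)"
    using assms unfolding C2_on_def by blast
  have "continuous_on S (\<lambda>x. \<Sum>b\<in>Basis. H b x \<bullet> b)"
    using H(1) by (auto intro!: continuous_intros C1_on_cont_grad)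
  then show ?thesis using H(2) by (simp cong: continuous_on_cong)
qed

lemma C1_on_const: "C1_on S (\<lambda>x. c) (\<lambda>x. 0)"
  unfolding C1_on_def by (auto intro!: has_derivative_eq_rhs[OF has_derivative_const])

lemma C1_on_diff: "C1_on S f F \<Longrightarrow> C1_on S g G \<Longrightarrow> C1_on S (\<lambda>x. f x - g x) (\<lambda>x. F x - G x)"
  unfolding C1_on_def
  by (auto intro!: continuous_intros derivative_eq_intros simp: inner_simps)

lemma C1_on_mult:
  assumes "C1_on S f F" "C1_on S g G"
  shows "C1_on S (\<lambda>x. f x * g x) (\<lambda>x. f x *\<^sub>R G x + g x *\<^sub>R F x)"
  using assms C1_on_cont[OF assms(1)] C1_on_cont[OF assms(2)] unfolding C1_on_def
  by (auto intro!: continuous_intros derivative_eq_intros simp: inner_simps)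

lemma C1_on_compose_real:
  assumes f: "C1_on S f F"
    and p: "\<And>x. x \<in> S \<Longrightarrow> (p has_real_derivative p' (f x)) (at (f x))"
    and c: "continuous_on (f ` S) p'"
  shows "C1_on S (\<lambda>x. p (f x)) (\<lambda>x. p' (f x) *\<^sub>R F x)"
  unfolding C1_on_def
proof safe
  fix x assume x: "x \<in> S"
  have "(p has_derivative (\<lambda>h. p' (f x) * h)) (at (f x))"
    using p[OF x] by (simp add: has_field_derivative_def)
  from has_derivative_compose[OF C1_on_deriv[OF f x] this]
  show "((\<lambda>x. p (f x)) has_derivative (\<bullet>) (p' (f x) *\<^sub>R F x)) (at x)"
    by (rule has_derivative_eq_rhs) (simp add: fun_eq_iff)
next
  show "continuous_on S (\<lambda>x. p' (f x) *\<^sub>R F x)"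
    by (intro continuous_intros continuous_on_compose2[OF c C1_on_cont[OF f]] C1_on_cont_grad[OF f]) auto
qed

lemma C2_on_compose_real:
  assumes f: "C2_on S f F L"
    and p: "\<And>x. x \<in> S \<Longrightarrow> (p has_real_derivative p' (f x)) (at (f x))"
    and p': "\<And>x. x \<in> S \<Longrightarrow> (p' has_real_derivative p'' (f x)) (at (f x))"
    and c: "continuous_on (f ` S) p''"
  shows "C2_on S (\<lambda>x. p (f x)) (\<lambda>x. p' (f x) *\<^sub>R F x) (\<lambda>x. p' (f x) * L x + p'' (f x) * (F x \<bullet> F x))"
proof -
  obtain H where H: "\<forall>b\<in>Basis. C1_on S (\<lambda>x. F x \<bullet> b) (H b)" "\<forall>x\<in>S. L x = (\<Sum>b\<in>Basis. H b x \<bullet> b)"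
    using f unfolding C2_on_def by blast
  have f1: "C1_on S f F" using f by (rule C2_on_C1)
  have c': "continuous_on (f ` S) p'"
    by (rule continuous_at_imp_continuous_on) (use p' DERIV_isCont in fastforce)
  have 1: "C1_on S (\<lambda>x. p (f x)) (\<lambda>x. p' (f x) *\<^sub>R F x)"
    by (rule C1_on_compose_real[OF f1 p c'])
  have 2: "C1_on S (\<lambda>x. p' (f x)) (\<lambda>x. p'' (f x) *\<^sub>R F x)"
    by (rule C1_on_compose_real[OF f1 p' c])
  have "C1_on S (\<lambda>x. (p' (f x) *\<^sub>R F x) \<bullet> b) (\<lambda>x. p' (f x) *\<^sub>R H b x + (F x \<bullet> b) *\<^sub>R (p'' (f x) *\<^sub>R F x))"
    if "b \<in> Basis" for b
    using C1_on_mult[OF 2 H(1)[rule_format, OF that]] by simp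
  moreover have "p' (f x) * L x + p'' (f x) * (F x \<bullet> F x)
      = (\<Sum>b\<in>Basis. (p' (f x) *\<^sub>R H b x + (F x \<bullet> b) *\<^sub>R (p'' (f x) *\<^sub>R F x)) \<bullet> b)" if "x \<in> S" for x
    using H(2) that
    by (simp add: inner_simps sum.distrib sum_distrib_left euclidean_inner[of "F x" "F x"] algebra_simps)
  ultimately show ?thesis
    unfolding C2_on_def using 1
    by (intro conjI exI[of _ "\<lambda>b x. p' (f x) *\<^sub>R H b x + (F x \<bullet> b) *\<^sub>R (p'' (f x) *\<^sub>R F x)"]) auto
qed

lemma C2_on_diff:
  assumes "C2_on S f F K" "C2_on S g G L"
  shows "C2_on S (\<lambda>x. f x - g x) (\<lambda>x. F x - G x) (\<lambda>x. K x - L x)"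
proof -
  obtain H where H: "\<forall>b\<in>Basis. C1_on S (\<lambda>x. F x \<bullet> b) (H b)" "\<forall>x\<in>S. K x = (\<Sum>b\<in>Basis. H b x \<bullet> b)"
    using assms unfolding C2_on_def by blast
  obtain J where J: "\<forall>b\<in>Basis. C1_on S (\<lambda>x. G x \<bullet> b) (J b)" "\<forall>x\<in>S. L x = (\<Sum>b\<in>Basis. J b x \<bullet> b)"
    using assms unfolding C2_on_def by blast
  have "\<forall>b\<in>Basis. C1_on S (\<lambda>x. (F x - G x) \<bullet> b) (\<lambda>x. H b x - J b x)"
    using H(1) J(1) by (auto simp: inner_diff_left intro: C1_on_diff)
  moreover have "\<forall>x\<in>S. K x - L x = (\<Sum>b\<in>Basis. (H b x - J b x) \<bullet> b)"
    using H(2) J(2) by (simp add: inner_diff_left sum_subtractf)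
  moreover have "C1_on S (\<lambda>x. f x - g x) (\<lambda>x. F x - G x)"
    using assms by (intro C1_on_diff C2_on_C1)
  ultimately show ?thesis unfolding C2_on_def
    by (intro conjI exI[of _ "\<lambda>b x. H b x - J b x"]) auto
qed

text \<open>Common source of the smooth ingredients: squared distances, the reflected squared
  distance, the cutoff variable \<open>1 - x \<bullet> x\<close>, and constants
  (\<open>\<alpha> = 0\<close>, \<open>c = 0\<close>) are all of this form.\<close>

lemma C2_on_quadratic:
  "C2_on S (\<lambda>x::'a::euclidean_space. \<alpha> * (x \<bullet> x) + c \<bullet> x + k) (\<lambda>x. (2 * \<alpha>) *\<^sub>R x + c) (\<lambda>x. 2 * \<alpha> * DIM('a))"
proof -
  have "C1_on S (\<lambda>x. \<alpha> * (x \<bullet> x) + c \<bullet> x + k) (\<lambda>x. (2 * \<alpha>) *\<^sub>R x + c)"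
    unfolding C1_on_def
    by (auto intro!: continuous_intros derivative_eq_intros simp: algebra_simps inner_simps inner_commute)
  moreover have "C1_on S (\<lambda>x. ((2 * \<alpha>) *\<^sub>R x + c) \<bullet> b) (\<lambda>x. (2 * \<alpha>) *\<^sub>R b)" for b
    unfolding C1_on_def
    by (auto intro!: continuous_intros derivative_eq_intros simp: inner_simps inner_commute)
  ultimately show ?thesis
    unfolding C2_on_def
    by (intro conjI exI[of _ "\<lambda>b x. (2 * \<alpha>) *\<^sub>R b"]) (auto simp: inner_Basis)
qed

lemma C1_on_zero_grad:
  assumes "C1_on S f G" "open T" "T \<subseteq> S" "\<And>x. x \<in> T \<Longrightarrow> f x = 0" "x \<in> T"
  shows "G x = 0"
proof -
  have "(f has_derivative (\<lambda>h. G x \<bullet> h)) (at x)" using assms C1_on_deriv by blast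
  moreover have "(f has_derivative (\<lambda>h. 0)) (at x)"
    by (rule has_derivative_transform_within_open[OF _ assms(2,5), of "\<lambda>x. 0"]) (use assms in auto)
  ultimately have "(\<lambda>h. G x \<bullet> h) = (\<lambda>h. 0)" by (rule has_derivative_unique)
  then have "G x \<bullet> G x = 0" by metis
  then show ?thesis by simp
qed

text \<open>\<open>U\<close> and the complement of \<open>K\<close> are open and cover the space. On
  the first the extension is \<open>f\<close>, on the second it is zero, and on the overlap the
  gradient of \<open>f\<close> vanishes too.\<close>

lemma C1_on_extend_zero:
  assumes f: "C1_on U f G" and U: "open U" and K: "compact K" "K \<subseteq> U"
    and z: "\<And>x. x \<in> U - K \<Longrightarrow> f x = 0"
  shows "C1_on UNIV (\<lambda>x. if x \<in> U then f x else 0) (\<lambda>x. if x \<in> U then G x else 0)"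
proof -
  have op: "open (- K)" using K compact_imp_closed by blast
  have Gz: "G x = 0" if "x \<in> U - K" for x
    by (rule C1_on_zero_grad[OF f, of "U - K"]) (use that z op U in \<open>auto simp: Diff_eq\<close>)
  have UK: "U \<union> (- K) = UNIV" using K by auto
  have d1: "((\<lambda>x. if x \<in> U then f x else 0) has_derivative (\<lambda>h. (if x \<in> U then G x else 0) \<bullet> h)) (at x)" for x
  proof (cases "x \<in> U")
    case True
    show ?thesis
      by (rule has_derivative_transform_within_open[OF _ U True, of f])
        (use True f in \<open>auto simp: C1_on_def\<close>)
  next
    case False
    then have xk: "x \<in> - K" using K by auto
    show ?thesis
      by (rule has_derivative_transform_within_open[OF _ op xk, of "\<lambda>x. 0"])
        (use False z in auto)
  qed
  have "continuous_on (U \<union> - K) (\<lambda>x. if x \<in> U then G x else 0)"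
  proof (rule continuous_on_open_Un[OF U op])
    show "continuous_on U (\<lambda>x. if x \<in> U then G x else 0)"
      using C1_on_cont_grad[OF f] by (simp cong: continuous_on_cong)
    have "continuous_on (- K) (\<lambda>x. 0)" by simp
    then show "continuous_on (- K) (\<lambda>x. if x \<in> U then G x else 0)"
      by (rule continuous_on_eq) (use Gz in auto)
  qed
  with d1 UK show ?thesis unfolding C1_on_def by auto
qed

lemma C1_on_lipschitz:
  assumes "C1_on S f G" "convex S" "\<And>x. x \<in> S \<Longrightarrow> norm (G x) \<le> B" "x \<in> S" "y \<in> S"
  shows "\<bar>f y - f x\<bar> \<le> B * norm (y - x)"
proof -
  have "norm (f y - f x) \<le> B * norm (y - x)"
  proof (rule differentiable_bound[OF assms(2)])
    fix z assume z: "z \<in> S"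
    show "(f has_derivative (\<lambda>h. G z \<bullet> h)) (at z within S)"
      using C1_on_deriv[OF assms(1) z] has_derivative_at_withinI by blast
    show "onorm (\<lambda>h. G z \<bullet> h) \<le> B"
    proof (rule onorm_bound)
      show "0 \<le> B" using assms(3)[OF z] norm_ge_zero order_trans by blast
      fix h show "norm (G z \<bullet> h) \<le> B * norm h"
        using Cauchy_Schwarz_ineq2[of "G z" h] mult_right_mono[OF assms(3)[OF z], of "norm h"]
        by auto
    qed
  qed (use assms in auto)
  then show ?thesis by simp
qed

lemma C1_compact_support_bounded:
  assumes "C1_on UNIV f G" "\<And>x. norm x > r \<Longrightarrow> f x = 0"
  obtains B where "B \<ge> 0" "\<And>x. norm (G x) \<le> B" "\<And>x. norm x > r \<Longrightarrow> G x = 0"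
proof -
  have op: "open {x::'a. norm x > r}" by (simp add: open_Collect_less continuous_intros)
  have Gz: "G x = 0" if "norm x > r" for x
    by (rule C1_on_zero_grad[OF assms(1) op]) (use that assms in auto)
  have "compact (G ` cball 0 r)"
    by (rule compact_continuous_image)
      (use C1_on_cont_grad[OF assms(1)] continuous_on_subset in \<open>auto\<close>)
  then obtain B where B: "\<And>x. x \<in> cball 0 r \<Longrightarrow> norm (G x) \<le> B"
    by (meson bounded_iff compact_imp_bounded image_eqI)
  have "norm (G x) \<le> max B 0" for x
    using B[of x] Gz[of x] by (cases "norm x > r") auto
  then show ?thesis using Gz that[of "max B 0"] by auto
qed

text \<open>Translation invariance makes the difference quotients integrate to zero.\<close>

lemma integral_gradient_zero:
  fixes f :: "'a::euclidean_space \<Rightarrow> real"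
  assumes f: "C1_on UNIV f G" and z: "\<And>x. norm x > r \<Longrightarrow> f x = 0"
  shows "integrable lborel (\<lambda>x. G x \<bullet> v)" "integral\<^sup>L lborel (\<lambda>x. G x \<bullet> v) = 0"
proof -
  obtain B where B: "B \<ge> 0" "\<And>x. norm (G x) \<le> B" "\<And>x. norm x > r \<Longrightarrow> G x = 0"
    using C1_compact_support_bounded[OF f z] by blast
  define q where "q n x = real (Suc n) * (f (x + (1 / real (Suc n)) *\<^sub>R v) - f x)" for n x
  have cf: "continuous_on UNIV f" using C1_on_cont[OF f] .
  have [measurable]: "f \<in> borel_measurable borel" using cf borel_measurable_continuous_onI by blast
  have [measurable]: "G \<in> borel_measurable borel"
    using C1_on_cont_grad[OF f] borel_measurable_continuous_onI by blast
  have intf: "integrable lborel f"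
  proof -
    have "f = (\<lambda>x. indicator (cball 0 r) x *\<^sub>R f x)"
      using z by (auto simp: indicator_def fun_eq_iff not_le)
    moreover have "integrable lborel (\<lambda>x. indicator (cball 0 r) x *\<^sub>R f x)"
      using borel_integrable_compact[of "cball 0 r" f] cf continuous_on_subset
      by (auto simp: set_integrable_def)
    ultimately show ?thesis by metis
  qed
  have intt: "has_bochner_integral lborel (\<lambda>x. f (x + a)) (integral\<^sup>L lborel f)" for a
  proof -
    have "integral\<^sup>L lborel f = integral\<^sup>L (distr lborel borel ((+) a)) f"
      by (simp add: lborel_distr_plus)
    also have "\<dots> = integral\<^sup>L lborel (\<lambda>x. f (a + x))"
      by (rule integral_distr) auto
    finally have 1: "integral\<^sup>L lborel (\<lambda>x. f (a + x)) = integral\<^sup>L lborel f" by simp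
    have "integrable (distr lborel borel ((+) a)) f"
      by (simp add: lborel_distr_plus intf)
    then have "integrable lborel (\<lambda>x. f (a + x))"
      by (subst (asm) integrable_distr_eq) auto
    with 1 show ?thesis by (simp add: has_bochner_integral_iff add.commute)
  qed
  have iq: "integrable lborel (q n)" "integral\<^sup>L lborel (q n) = 0" for n
    using intt intf unfolding q_def by (auto simp: has_bochner_integral_iff)
  have lim: "(\<lambda>n. q n x) \<longlonglongrightarrow> G x \<bullet> v" for x
  proof -
    have "((\<lambda>t. f (x + t *\<^sub>R v)) has_derivative (\<lambda>t. G (x + 0 *\<^sub>R v) \<bullet> (t *\<^sub>R v))) (at 0)"
      by (rule has_derivative_compose[of "\<lambda>t. x + t *\<^sub>R v" "\<lambda>t. t *\<^sub>R v" 0 UNIV f])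
        (auto intro!: derivative_eq_intros C1_on_deriv[OF f])
    then have "((\<lambda>t. f (x + t *\<^sub>R v)) has_real_derivative (G x \<bullet> v)) (at 0)"
      by (simp add: has_field_derivative_def mult_commute_abs)
    then have D: "((\<lambda>h. (f (x + h *\<^sub>R v) - f x) / h) \<longlongrightarrow> G x \<bullet> v) (at 0)"
      unfolding DERIV_def by simp
    have "filterlim (\<lambda>n. 1 / real (Suc n)) (at 0) sequentially"
      unfolding filterlim_at using LIMSEQ_Suc[OF lim_1_over_n]  by auto
    from filterlim_compose[OF D this] show ?thesis
      unfolding q_def by (simp add: divide_simps mult.commute)
  qed
  \<comment> \<open>Every shift has length at most \<open>norm v\<close>, so one enlarged ball
    contains the supports of all difference quotients; inside it the Lipschitz bound
    applies.\<close>
  have bd: "norm (q n x) \<le> (B * norm v) * indicator (cball 0 (r + norm v)) x" for n x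
  proof (cases "norm x > r + norm v")
    case True
    have "norm ((1 / real (Suc n)) *\<^sub>R v) \<le> norm v"
      by (simp add: divide_le_eq mult_le_cancel_left1)
    then have "norm (x + (1 / real (Suc n)) *\<^sub>R v) > r" 
      using True norm_diff_ineq[of x "(1 / real (Suc n)) *\<^sub>R v"] by linarith
    moreover have "norm x > r" using True by (smt (verit) norm_ge_zero)
    ultimately show ?thesis using z True by (simp add: q_def)
  next
    case False
    have "\<bar>f (x + (1 / real (Suc n)) *\<^sub>R v) - f x\<bar> \<le> B * norm ((x + (1 / real (Suc n)) *\<^sub>R v) - x)"
      by (rule C1_on_lipschitz[OF f]) (use B in auto)
    then have "\<bar>q n x\<bar> \<le> real (Suc n) * (B * (norm v / real (Suc n)))"
      unfolding q_def abs_mult by (intro mult_mono) auto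
    also have "\<dots> = B * norm v" by (simp del: of_nat_Suc)
    finally show ?thesis using False by simp
  qed
  have iw: "integrable lborel (\<lambda>x. (B * norm v) * indicator (cball 0 (r + norm v)) (x::'a))"
    by (intro integrable_mult_right integrable_real_indicator) (auto simp: emeasure_bounded_finite[OF bounded_cball, unfolded infinity_ennreal_def])
  have mG: "(\<lambda>x. G x \<bullet> v) \<in> borel_measurable lborel" by measurable
  have mq: "q n \<in> borel_measurable lborel" for n unfolding q_def by measurable
  note dc = mG mq iw AE_I2[of lborel, OF lim] AE_I2[of lborel, OF bd]
  show "integrable lborel (\<lambda>x. G x \<bullet> v)"
    by (rule integrable_dominated_convergence[OF dc])
  have "(\<lambda>n. integral\<^sup>L lborel (q n)) \<longlonglongrightarrow> integral\<^sup>L lborel (\<lambda>x. G x \<bullet> v)"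
    by (rule integral_dominated_convergence[OF dc])
  then show "integral\<^sup>L lborel (\<lambda>x. G x \<bullet> v) = 0"
    by (simp add: iq(2) LIMSEQ_const_iff)
qed

lemma integral_gradient_zero_on:
  fixes f :: "'a::euclidean_space \<Rightarrow> real"
  assumes f: "C1_on U f G" and U: "open U" and K: "compact K" "K \<subseteq> U"
    and z: "\<And>x. x \<in> U - K \<Longrightarrow> f x = 0"
  shows "integrable (restrict_space lborel U) (\<lambda>x. G x \<bullet> v)"
    "integral\<^sup>L (restrict_space lborel U) (\<lambda>x. G x \<bullet> v) = 0"
proof -
  obtain r where r: "\<And>x. x \<in> K \<Longrightarrow> norm x \<le> r" using compact_imp_bounded[OF K(1)] bounded_iff by metis
  have zz: "(if x \<in> U then f x else 0) = 0" if "norm x > r" for x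
    using that r[of x] z[of x] by auto
  have eq: "(\<lambda>x. (if x \<in> U then G x else 0) \<bullet> v) = (\<lambda>x. indicator U x *\<^sub>R (G x \<bullet> v))"
    by (auto simp: fun_eq_iff)
  note E = C1_on_extend_zero[OF f U K z]
  have Ub: "U \<inter> space lborel \<in> sets lborel" using U by auto
  show "integrable (restrict_space lborel U) (\<lambda>x. G x \<bullet> v)"
    unfolding integrable_restrict_space[OF Ub] 
    using integral_gradient_zero(1)[OF E zz, where v=v] by (simp add: eq)
  show "integral\<^sup>L (restrict_space lborel U) (\<lambda>x. G x \<bullet> v) = 0"
    unfolding integral_restrict_space[OF Ub]
    using integral_gradient_zero(2)[OF E zz, where v=v] by (simp add: eq)
qed

text \<open>The divergence theorem for the field \<open>\<phi> x *\<^sub>R G x\<close>, obtained one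
  coordinate at a time. Either factor may be the one that vanishes off \<open>K\<close>, so the
  constant test function is allowed when the gradient is compactly supported.\<close>

lemma green_first:
  fixes f \<phi> :: "'a::euclidean_space \<Rightarrow> real"
  assumes p: "C1_on U \<phi> P" and f: "C2_on U f G L" and U: "open U" and K: "compact K" "K \<subseteq> U"
    and z: "\<And>x. x \<in> U - K \<Longrightarrow> \<phi> x = 0 \<or> G x = 0"
  shows "integrable (restrict_space lborel U) (\<lambda>x. \<phi> x * L x + P x \<bullet> G x)"
    "integral\<^sup>L (restrict_space lborel U) (\<lambda>x. \<phi> x * L x + P x \<bullet> G x) = 0"
proof -
  let ?M = "restrict_space lborel U"
  obtain H where H: "\<forall>b\<in>Basis. C1_on U (\<lambda>x. G x \<bullet> b) (H b)" "\<forall>x\<in>U. L x = (\<Sum>b\<in>Basis. H b x \<bullet> b)"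
    using f unfolding C2_on_def by blast
  define V where "V b x = \<phi> x *\<^sub>R H b x + (G x \<bullet> b) *\<^sub>R P x" for b x
  have V: "C1_on U (\<lambda>x. \<phi> x * (G x \<bullet> b)) (V b)" if "b \<in> Basis" for b
    using C1_on_mult[OF p H(1)[rule_format, OF that]] unfolding V_def .
  have i: "integrable ?M (\<lambda>x. V b x \<bullet> b)" "integral\<^sup>L ?M (\<lambda>x. V b x \<bullet> b) = 0" if "b \<in> Basis" for b
  proof -
    have zz: "\<phi> x * (G x \<bullet> b) = 0" if "x \<in> U - K" for x
      using z[OF that] by auto
    note I = integral_gradient_zero_on[OF V[OF that] U K zz]
    show "integrable ?M (\<lambda>x. V b x \<bullet> b)" by (rule I(1))
    show "integral\<^sup>L ?M (\<lambda>x. V b x \<bullet> b) = 0" by (rule I(2))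
  qed
  have eq: "(\<Sum>b\<in>Basis. V b x \<bullet> b) = \<phi> x * L x + P x \<bullet> G x" if "x \<in> space ?M" for x
    using that H(2) euclidean_inner[of "P x" "G x"]
    by (simp add: V_def inner_simps sum.distrib sum_distrib_left space_restrict_space algebra_simps)
  show "integrable ?M (\<lambda>x. \<phi> x * L x + P x \<bullet> G x)"
    by (subst Bochner_Integration.integrable_cong[OF refl eq[symmetric]]) (auto intro: i)
  show "integral\<^sup>L ?M (\<lambda>x. \<phi> x * L x + P x \<bullet> G x) = 0"
    by (subst Bochner_Integration.integral_cong[OF refl eq[symmetric]])
      (auto simp: i Bochner_Integration.integral_sum)
qed

section \<open>Smooth truncations\<close>

text \<open>A cubic spline. Its second derivative \<open>spl2\<close> is the tent on the unit
  interval with height 2, hence area 1; therefore the slope \<open>spl1\<close> rises monotonically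
  from 0 to 1.\<close>

definition spl0 :: "real \<Rightarrow> real" where
  "spl0 t = 2 / 3 * (max 0 t ^ 3 - 2 * max 0 (t - 1/2) ^ 3 + max 0 (t - 1) ^ 3)"

definition spl1 :: "real \<Rightarrow> real" where
  "spl1 t = 2 * (max 0 t ^ 2 - 2 * max 0 (t - 1/2) ^ 2 + max 0 (t - 1) ^ 2)"

definition spl2 :: "real \<Rightarrow> real" where
  "spl2 t = 4 * (max 0 t - 2 * max 0 (t - 1/2) + max 0 (t - 1))"

lemma DERIV_max_sq: "((\<lambda>t. max 0 (t - c) ^ 2) has_real_derivative 2 * max 0 (t - c)) (at t)"
proof -
  have 0: "((\<lambda>t::real. max 0 t ^ 2) has_real_derivative 2 * max 0 t) (at t)" for t
  proof (cases "t = 0")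
    case True
    have "((\<lambda>h::real. max 0 h) \<longlongrightarrow> max 0 0) (at 0)" by (intro tendsto_intros)
    moreover have "\<forall>\<^sub>F h::real in at 0. max 0 h = (max 0 (0 + h) ^ 2 - max 0 0 ^ 2) / h"
      by (auto simp: eventually_at_filter max_def power2_eq_square)
    ultimately have "((\<lambda>h. (max 0 (0 + h) ^ 2 - max 0 0 ^ 2) / h) \<longlongrightarrow> (0::real)) (at 0)"
      using Lim_transform_eventually by fastforce
    then show ?thesis using True by (simp add: DERIV_def)
  next
    case False
    show ?thesis
    proof (cases "t > 0")
      case True
      have "((\<lambda>t. t ^ 2) has_real_derivative 2 * t) (at t)"
        by (auto intro!: derivative_eq_intros)
      then have "((\<lambda>t. max 0 t ^ 2) has_real_derivative 2 * t) (at t)"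
        by (rule has_field_derivative_transform_within_open[of _ _ _ "{0<..}"]) (use True in auto)
      then show ?thesis using True by simp
    next
      case False
      with \<open>t \<noteq> 0\<close> have "t < 0" by auto
      have "((\<lambda>t::real. 0) has_real_derivative 0) (at t)" by simp
      then have "((\<lambda>t. max 0 t ^ 2) has_real_derivative 0) (at t)"
        by (rule has_field_derivative_transform_within_open[of _ _ _ "{..<0}"]) (use \<open>t < 0\<close> in auto)
      then show ?thesis using \<open>t < 0\<close> by simp
    qed
  qed
  have "((\<lambda>t. t - c) has_real_derivative 1) (at t)" by (auto intro!: derivative_eq_intros)
  from DERIV_chain2[OF 0 this] show ?thesis by simp
qed

lemma DERIV_max_cube: "((\<lambda>t. max 0 (t - c) ^ 3) has_real_derivative 3 * max 0 (t - c) ^ 2) (at t)"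
proof -
  have "((\<lambda>t. (t - c) * max 0 (t - c) ^ 2) has_real_derivative
      (1 - 0) * max 0 (t - c) ^ 2 + 2 * max 0 (t - c) * (t - c)) (at t)"
    by (intro DERIV_mult DERIV_diff DERIV_ident DERIV_const DERIV_max_sq)
  moreover have "(\<lambda>t. (t - c) * max 0 (t - c) ^ 2) = (\<lambda>t. max 0 (t - c) ^ 3)"
    by (auto simp: max_def power3_eq_cube power2_eq_square fun_eq_iff)
  moreover have "(1 - 0) * max 0 (t - c) ^ 2 + 2 * max 0 (t - c) * (t - c) = 3 * max 0 (t - c) ^ 2"
    by (auto simp: max_def power2_eq_square)
  ultimately show ?thesis by metis
qed

lemma DERIV_spl0: "(spl0 has_real_derivative spl1 t) (at t)"
  unfolding spl0_def[abs_def] spl1_def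
  by (rule DERIV_cong[OF DERIV_cmult[OF DERIV_add[OF DERIV_diff[OF DERIV_max_cube[of 0 t, simplified]
    DERIV_cmult[OF DERIV_max_cube[of "1/2" t], of 2]] DERIV_max_cube[of 1 t]], of "2/3"]]) simp

lemma DERIV_spl1: "(spl1 has_real_derivative spl2 t) (at t)"
  unfolding spl1_def[abs_def] spl2_def
  by (rule DERIV_cong[OF DERIV_cmult[OF DERIV_add[OF DERIV_diff[OF DERIV_max_sq[of 0 t, simplified]
    DERIV_cmult[OF DERIV_max_sq[of "1/2" t], of 2]] DERIV_max_sq[of 1 t]], of 2]]) simp

lemma spl2_bounds: "0 \<le> spl2 t" "spl2 t \<le> 2"
  by (auto simp: spl2_def max_def)

lemma spl2_cont: "continuous_on S spl2"
  unfolding spl2_def[abs_def] by (intro continuous_intros)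

lemma spl1_bounds: "0 \<le> spl1 t" "spl1 t \<le> 1"
proof -
  consider "t \<le> 0" | "0 \<le> t" "t \<le> 1/2" | "1/2 \<le> t" "t \<le> 1" | "1 \<le> t" by linarith
  then have "0 \<le> spl1 t \<and> spl1 t \<le> 1"
  proof cases
    case 1 then show ?thesis by (simp add: spl1_def)
  next
    case 2
    then have "t\<^sup>2 \<le> (1/2)\<^sup>2" by (intro power_mono) auto
    then show ?thesis using 2 by (simp add: spl1_def power2_eq_square)
  next
    case 3
    have e: "spl1 t = 1 - 2 * (1 - t)\<^sup>2" using 3 by (simp add: spl1_def power2_eq_square algebra_simps)
    have "(1 - t)\<^sup>2 \<le> (1/2)\<^sup>2" using 3 by (intro power_mono) auto
    then show ?thesis unfolding e by (simp add: power2_eq_square)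
  next
    case 4 then show ?thesis by (simp add: spl1_def power2_eq_square algebra_simps)
  qed
  then show "0 \<le> spl1 t" "spl1 t \<le> 1" by auto
qed

lemma spl0_bounds: "0 \<le> spl0 t" "spl0 t \<le> max 0 t" "t - 1 \<le> spl0 t"
proof -
  consider "t \<le> 0" | "0 \<le> t" "t \<le> 1/2" | "1/2 \<le> t" "t \<le> 1" | "1 \<le> t" by linarith
  then have "0 \<le> spl0 t \<and> spl0 t \<le> max 0 t \<and> t - 1 \<le> spl0 t"
  proof cases
    case 1 then show ?thesis by (simp add: spl0_def)
  next
    case 2
    then have "t ^ 3 \<le> t ^ 1" by (intro power_decreasing) auto
    then have "t ^ 3 \<le> t" by simp
    moreover have "t ^ 3 \<ge> 0" using 2 by simp
    ultimately have "2 / 3 * t ^ 3 \<ge> 0" "2 / 3 * t ^ 3 \<le> t" "t - 1 \<le> 2 / 3 * t ^ 3" using 2 by linarith+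
    then show ?thesis using 2 by (simp add: spl0_def)
  next
    case 3
    define s where "s = t - 1/2"
    have s: "0 \<le> s" "s \<le> 1/2" using 3 by (auto simp: s_def)
    have e: "spl0 t = - 2/3 * s ^ 3 + s\<^sup>2 + 1/2 * s + 1/12"
      using 3 unfolding spl0_def s_def
      by (simp add: power2_eq_square power3_eq_cube field_simps)
    have "s ^ 3 \<le> s ^ 2" using s by (intro power_decreasing) auto
    moreover have "s\<^sup>2 \<le> 1/2 * s" using mult_right_mono[OF s(2) s(1)] by (simp add: power2_eq_square)
    moreover have "s ^ 3 \<ge> 0" "s\<^sup>2 \<ge> 0" using s by auto
    moreover have "t = s + 1/2" by (simp add: s_def)
    moreover note s
    ultimately have "0 \<le> spl0 t" and "spl0 t \<le> t" and "t - 1 \<le> spl0 t"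
      using e by - linarith+
    then show ?thesis using 3 by simp
  next
    case 4 then show ?thesis by (simp add: spl0_def power2_eq_square power3_eq_cube algebra_simps)
  qed
  then show "0 \<le> spl0 t" "spl0 t \<le> max 0 t" "t - 1 \<le> spl0 t" by auto
qed

lemma spl_vanish: "t \<le> 0 \<Longrightarrow> spl0 t = 0" "t \<le> 0 \<Longrightarrow> spl1 t = 0" "t \<le> 0 \<Longrightarrow> spl2 t = 0"
  by (simp_all add: spl0_def spl1_def spl2_def)

lemma spl_large: "1 \<le> t \<Longrightarrow> spl1 t = 1" "1 \<le> t \<Longrightarrow> spl2 t = 0"
  by (simp_all add: spl1_def spl2_def power2_eq_square algebra_simps)

text \<open>A convex \<open>C\<^sup>2\<close> version of \<open>max 0 (t - 3 a / 2)\<close> that vanishes for \<open>t \<le> a\<close> and has slope one for \<open>t \<ge> 2 a\<close>.\<close>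

definition trunc :: "real \<Rightarrow> real \<Rightarrow> real" where "trunc a t = a * spl0 ((t - a) / a)"
definition trunc1 :: "real \<Rightarrow> real \<Rightarrow> real" where "trunc1 a t = spl1 ((t - a) / a)"
definition trunc2 :: "real \<Rightarrow> real \<Rightarrow> real" where "trunc2 a t = spl2 ((t - a) / a) / a"

context fixes a :: real assumes a: "a > 0"
begin

lemma DERIV_trunc: "(trunc a has_real_derivative trunc1 a t) (at t)"
proof -
  have "((\<lambda>t. (t - a) / a) has_real_derivative 1 / a) (at t)"
    using a by (auto intro!: derivative_eq_intros)
  from DERIV_cmult[OF DERIV_chain2[OF DERIV_spl0 this], of a] show ?thesis
    using a unfolding trunc_def[abs_def] trunc1_def by simp
qed

lemma DERIV_trunc1: "(trunc1 a has_real_derivative trunc2 a t) (at t)"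
proof -
  have "((\<lambda>t. (t - a) / a) has_real_derivative 1 / a) (at t)"
    using a by (auto intro!: derivative_eq_intros)
  from DERIV_chain2[OF DERIV_spl1 this] show ?thesis
    using a unfolding trunc1_def[abs_def] trunc2_def by simp
qed

lemma trunc_cont: "continuous_on S (trunc a)" "continuous_on S (trunc1 a)" "continuous_on S (trunc2 a)"
proof -
  show "continuous_on S (trunc a)" "continuous_on S (trunc1 a)"
    by (auto intro!: continuous_at_imp_continuous_on DERIV_isCont[OF DERIV_trunc] DERIV_isCont[OF DERIV_trunc1])
  show "continuous_on S (trunc2 a)" unfolding trunc2_def[abs_def]
    by (intro continuous_intros continuous_on_compose2[OF spl2_cont[of UNIV]]) (use a in auto)
qed

lemma trunc_small: "t \<le> a \<Longrightarrow> trunc a t = 0" "t \<le> a \<Longrightarrow> trunc1 a t = 0" "t \<le> a \<Longrightarrow> trunc2 a t = 0"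
  using a by (auto simp: trunc_def trunc1_def trunc2_def divide_le_0_iff intro!: spl_vanish)

lemma trunc_large: "2 * a \<le> t \<Longrightarrow> trunc1 a t = 1" "2 * a \<le> t \<Longrightarrow> trunc2 a t = 0"
  using a by (auto simp: trunc1_def trunc2_def le_divide_eq intro!: spl_large)

lemma trunc1_bounds: "0 \<le> trunc1 a t" "trunc1 a t \<le> 1"
  by (auto simp: trunc1_def spl1_bounds)

lemma trunc2_bounds: "0 \<le> trunc2 a t" "trunc2 a t \<le> 2 / a"
  using a by (auto simp: trunc2_def spl2_bounds divide_right_mono)

lemma trunc_bounds: "0 \<le> trunc a t" "0 \<le> t \<Longrightarrow> trunc a t \<le> t" "t - 2 * a \<le> trunc a t"
proof -
  show "0 \<le> trunc a t" using a by (simp add: trunc_def spl0_bounds)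
  show "trunc a t \<le> t" if "0 \<le> t"
  proof (cases "t \<le> a")
    case False
    have "a * spl0 ((t - a) / a) \<le> a * max 0 ((t - a) / a)"
      using a spl0_bounds(2) by (intro mult_left_mono) auto
    also have "\<dots> = t - a" using a False by simp
    finally show ?thesis using a by (simp add: trunc_def)
  qed (use that trunc_small in simp)
  have "a * ((t - a) / a - 1) \<le> a * spl0 ((t - a) / a)"
    using a spl0_bounds(3) by (intro mult_left_mono) auto
  moreover have "a * ((t - a) / a - 1) = t - 2 * a" using a by (simp add: field_simps)
  ultimately show "t - 2 * a \<le> trunc a t" by (simp add: trunc_def)
qed

end

text \<open>Components of \<open>d - e3\<close> have no sign, so both tails are kept and a
  neighbourhood of zero is removed. This one is used in test functions, for which the first
  derivative matters, whereas \<open>trunc\<close> is also applied to kernels whose Laplacian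
  appears.\<close>

definition odd_trunc :: "real \<Rightarrow> real \<Rightarrow> real" where "odd_trunc a t = trunc a t - trunc a (- t)"
definition odd_trunc1 :: "real \<Rightarrow> real \<Rightarrow> real" where "odd_trunc1 a t = trunc1 a t + trunc1 a (- t)"

context fixes a :: real assumes a: "a > 0"
begin

lemma DERIV_odd_trunc: "(odd_trunc a has_real_derivative odd_trunc1 a t) (at t)"
proof -
  have "((\<lambda>t. trunc a (- t)) has_real_derivative trunc1 a (- t) * (- 1)) (at t)"
    by (rule DERIV_chain2[OF DERIV_trunc[OF a]]) (auto intro!: derivative_eq_intros)
  from DERIV_diff[OF DERIV_trunc[OF a] this] show ?thesis
    by (simp add: odd_trunc_def[abs_def] odd_trunc1_def)
qed

lemma odd_trunc_cont: "continuous_on S (odd_trunc a)" "continuous_on S (odd_trunc1 a)"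
  unfolding odd_trunc_def[abs_def] odd_trunc1_def[abs_def]
  by (intro continuous_intros trunc_cont(1,2)[OF a] continuous_on_compose2[OF trunc_cont(1)[OF a, of UNIV]]
        continuous_on_compose2[OF trunc_cont(2)[OF a, of UNIV]]; simp)+

lemma odd_trunc_small: "\<bar>t\<bar> \<le> a \<Longrightarrow> odd_trunc a t = 0" "\<bar>t\<bar> \<le> a \<Longrightarrow> odd_trunc1 a t = 0"
  by (simp_all add: odd_trunc_def odd_trunc1_def trunc_small[OF a])

lemma odd_trunc1_large: "2 * a \<le> \<bar>t\<bar> \<Longrightarrow> odd_trunc1 a t = 1"
  using a by (cases "t \<ge> 0") (simp_all add: odd_trunc1_def trunc_large[OF a] trunc_small[OF a])

lemma odd_trunc1_bounds: "0 \<le> odd_trunc1 a t" "odd_trunc1 a t \<le> 1"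
  using a trunc1_bounds[OF a, of t] trunc1_bounds[OF a, of "-t"]
  by (cases "t \<ge> 0"; simp add: odd_trunc1_def trunc_small[OF a])+

lemma odd_trunc_bounds: "\<bar>odd_trunc a t\<bar> \<le> \<bar>t\<bar>" "\<bar>odd_trunc a t - t\<bar> \<le> 2 * a"
proof -
  note b = trunc_bounds[OF a, of t] trunc_bounds[OF a, of "-t"] trunc_small(1)[OF a, of t] trunc_small(1)[OF a, of "-t"]
  show "\<bar>odd_trunc a t\<bar> \<le> \<bar>t\<bar>" using b a by (cases "t \<ge> 0") (auto simp: odd_trunc_def)
  show "\<bar>odd_trunc a t - t\<bar> \<le> 2 * a" using b a by (cases "t \<ge> 0") (auto simp: odd_trunc_def)
qed

end

lemma inv_Suc_tendsto: "(\<lambda>n. 1 / real (Suc n)) \<longlonglongrightarrow> 0"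
  using LIMSEQ_Suc[OF lim_1_over_n] by simp

lemma ev_inv_Suc_less: "e > 0 \<Longrightarrow> \<forall>\<^sub>F n in sequentially. 2 * (1 / real (Suc n)) < e"
proof -
  assume "e > 0"
  have "(\<lambda>n. 2 * (1 / real (Suc n))) \<longlonglongrightarrow> 2 * 0" by (intro tendsto_intros inv_Suc_tendsto)
  then show ?thesis using \<open>e > 0\<close> order_tendstoD(2) by fastforce
qed

lemma trunc_tendsto: "0 \<le> t \<Longrightarrow> (\<lambda>n. trunc (1 / real (Suc n)) t) \<longlonglongrightarrow> t"
proof -
  assume t: "0 \<le> t"
  have 1: "(\<lambda>n. t - 2 * (1 / real (Suc n))) \<longlonglongrightarrow> t"
    using tendsto_diff[OF tendsto_const[of t] tendsto_mult[OF tendsto_const inv_Suc_tendsto, of 2]] by simp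
  show ?thesis
    by (rule tendsto_sandwich[OF always_eventually always_eventually 1 tendsto_const])
      (use trunc_bounds[of "1 / real (Suc _)" t] t in \<open>simp_all del: of_nat_Suc\<close>)
qed

lemma trunc1_tendsto: "0 < t \<Longrightarrow> (\<lambda>n. trunc1 (1 / real (Suc n)) t) \<longlonglongrightarrow> 1"
  by (rule tendsto_eventually, rule eventually_mono[OF ev_inv_Suc_less[of t]])
     (auto simp del: of_nat_Suc intro!: trunc_large)

lemma odd_trunc_tendsto: "(\<lambda>n. odd_trunc (1 / real (Suc n)) t) \<longlonglongrightarrow> t"
proof -
  have 1: "(\<lambda>n. 2 * (1 / real (Suc n))) \<longlonglongrightarrow> 0"
    using tendsto_mult[OF tendsto_const inv_Suc_tendsto, of 2] by simp
  have "(\<lambda>n. odd_trunc (1 / real (Suc n)) t - t) \<longlonglongrightarrow> 0"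
    by (rule Lim_null_comparison[OF always_eventually 1])
       (use odd_trunc_bounds(2)[of "1 / real (Suc _)" t] in \<open>simp del: of_nat_Suc\<close>)
  then show ?thesis by (simp add: LIM_zero_iff)
qed

text \<open>The slope at zero is zero for every \<open>n\<close>, so the limit is 0 there rather
  than 1. Passing to the limit in a truncated gradient thus loses the zero set, and
  \<open>null_gradient\<close> repairs this.\<close>

lemma odd_trunc1_tendsto: "(\<lambda>n. odd_trunc1 (1 / real (Suc n)) t) \<longlonglongrightarrow> (if t = 0 then 0 else 1)"
proof (cases "t = 0")
  case True then show ?thesis by (simp add: odd_trunc_small del: of_nat_Suc)
next
  case False
  have "\<forall>\<^sub>F n in sequentially. odd_trunc1 (1 / real (Suc n)) t = 1"
    using ev_inv_Suc_less[of "\<bar>t\<bar>"] False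
    by (auto elim!: eventually_mono intro!: odd_trunc1_large simp del: of_nat_Suc)
  with False show ?thesis by (auto intro: tendsto_eventually)
qed

section \<open>Affine changes of variables\<close>

lemma lborel_nn_integral_affine:
  fixes t :: "'a::euclidean_space"
  assumes [measurable]: "f \<in> borel_measurable borel" and c: "c \<noteq> 0"
  shows "(\<integral>\<^sup>+x. f x \<partial>lborel) = \<bar>c\<bar> ^ DIM('a) * (\<integral>\<^sup>+x. f (t + c *\<^sub>R x) \<partial>lborel)"
  by (subst lborel_affine[OF c, of t])
     (simp add: nn_integral_density nn_integral_distr nn_integral_cmult ennreal_power)

lemma lborel_integrable_affine:
  fixes f :: "'a::euclidean_space \<Rightarrow> real"
  assumes f: "integrable lborel f" and c: "c \<noteq> 0"
  shows "integrable lborel (\<lambda>x. f (t + c *\<^sub>R x))"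
proof -
  have [measurable]: "f \<in> borel_measurable borel" using f by auto
  have "(\<integral>\<^sup>+x. ennreal (norm (f x)) \<partial>lborel) < \<infinity>"
    using f unfolding integrable_iff_bounded by simp
  then show ?thesis
    using c unfolding integrable_iff_bounded
    by (subst (asm) lborel_nn_integral_affine[where c=c and t=t]) (auto simp: ennreal_mult_less_top)
qed

lemma lborel_integral_affine:
  fixes f :: "'a::euclidean_space \<Rightarrow> real"
  assumes [measurable]: "f \<in> borel_measurable borel" and c: "c \<noteq> 0"
  shows "(\<integral>x. f x \<partial>lborel) = \<bar>c\<bar> ^ DIM('a) * (\<integral>x. f (t + c *\<^sub>R x) \<partial>lborel)"
  by (subst lborel_affine[OF c, of t])
     (simp add: integral_density integral_distr)

section \<open>Regularised Newton and Green kernels\<close>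

text \<open>Plummer softening of the distance: \<open>1 / sdist \<kappa> x\<close> is the Newton
  kernel made smooth at its pole.\<close>

definition sdist :: "real \<Rightarrow> real^3 \<Rightarrow> real^3 \<Rightarrow> real" where
  "sdist \<kappa> x y = sqrt ((norm (y - x))\<^sup>2 + \<kappa>\<^sup>2)"

text \<open>For \<open>\<kappa> = 0\<close> this is \<open>norm x\<close> times the distance from \<open>y\<close> to the inversion of \<open>x\<close> in the unit sphere,
  in a form that makes sense at \<open>x = 0\<close>.\<close>

definition reflected_dist :: "real \<Rightarrow> real^3 \<Rightarrow> real^3 \<Rightarrow> real" where
  "reflected_dist \<kappa> x y = sqrt ((norm x)\<^sup>2 * (norm y)\<^sup>2 - 2 * (x \<bullet> y) + 1 + \<kappa>\<^sup>2)"

lemma sdist_pos: "\<kappa> > 0 \<Longrightarrow> sdist \<kappa> x y > 0"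
  by (simp add: sdist_def add_nonneg_pos)

lemma sdist_ge: "\<kappa> \<ge> 0 \<Longrightarrow> norm (y - x) \<le> sdist \<kappa> x y" "\<kappa> \<ge> 0 \<Longrightarrow> \<kappa> \<le> sdist \<kappa> x y"
  by (auto simp: sdist_def real_le_rsqrt)

lemma sdist_le: "\<kappa> \<ge> 0 \<Longrightarrow> sdist \<kappa> x y \<le> norm (y - x) + \<kappa>"
  unfolding sdist_def by (rule order_trans[OF sqrt_add_le_add_sqrt]) auto

lemma sdist_cont [continuous_intros]:
  "continuous_on S f \<Longrightarrow> continuous_on S (\<lambda>y. sdist \<kappa> x (f y))"
  unfolding sdist_def by (intro continuous_intros)

text \<open>The two sides differ by twice the defect in the Cauchy-Schwarz inequality. Besides
  positivity this gives the lower bound \<open>1 - norm x\<close> on the reflected distance for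
  \<open>y\<close> in the ball, which keeps the image pole away.\<close>

lemma reflected_dist_quad_nonneg:
  fixes x y :: "'a::real_inner"
  shows "(1 - norm x * norm y)\<^sup>2 \<le> (norm x)\<^sup>2 * (norm y)\<^sup>2 - 2 * (x \<bullet> y) + 1"
  using norm_cauchy_schwarz[of x y] by (simp add: power2_eq_square algebra_simps)

lemma reflected_dist_pos: "\<kappa> > 0 \<Longrightarrow> reflected_dist \<kappa> x y > 0"
  using reflected_dist_quad_nonneg[of x y] zero_le_power2[of "1 - norm x * norm y"] zero_less_power2[of \<kappa>]
  unfolding reflected_dist_def by (smt (verit) real_sqrt_gt_zero)

lemma reflected_dist_cont [continuous_intros]: "continuous_on S (reflected_dist \<kappa> x)"
  unfolding reflected_dist_def[abs_def] by (intro continuous_intros)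

lemma reflected_dist_arg_nonneg: "0 \<le> (norm x)\<^sup>2 * (norm y)\<^sup>2 - 2 * (x \<bullet> y) + 1 + \<kappa>\<^sup>2"
  for x y :: "'a::real_inner"
  using reflected_dist_quad_nonneg[of x y] zero_le_power2[of "1 - norm x * norm y"] zero_le_power2[of \<kappa>] by linarith

lemma sdist_sq: "(sdist \<kappa> x y)\<^sup>2 = (norm (y - x))\<^sup>2 + \<kappa>\<^sup>2"
  by (simp add: sdist_def)

text \<open>Both squares are softened by the same \<open>\<kappa>\<^sup>2\<close>, so their
  difference does not see \<open>\<kappa>\<close>. Its two factors are positive inside the ball,
  which orders the two distances there.\<close>

lemma reflected_dist_sdist: "(reflected_dist \<kappa> x y)\<^sup>2 = (sdist \<kappa> x y)\<^sup>2 + (1 - (norm x)\<^sup>2) * (1 - (norm y)\<^sup>2)"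
proof -
  have "(reflected_dist \<kappa> x y)\<^sup>2 = (norm x)\<^sup>2 * (norm y)\<^sup>2 - 2 * (x \<bullet> y) + 1 + \<kappa>\<^sup>2"
    unfolding reflected_dist_def using reflected_dist_arg_nonneg by simp
  then show ?thesis unfolding sdist_sq
    by (simp add: power2_norm_eq_inner inner_diff_left inner_diff_right inner_commute algebra_simps)
qed

lemma sdist_le_sq: "norm x \<le> 1 \<Longrightarrow> norm y \<le> 1 \<Longrightarrow> sdist \<kappa> x y \<le> reflected_dist \<kappa> x y"
proof -
  assume "norm x \<le> 1" "norm y \<le> 1"
  then have "(sdist \<kappa> x y)\<^sup>2 \<le> (reflected_dist \<kappa> x y)\<^sup>2"
    unfolding reflected_dist_sdist by (simp add: mult_nonneg_nonneg power_le_one)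
  then show ?thesis
    by (rule power2_le_imp_le) (simp add: reflected_dist_def reflected_dist_arg_nonneg)
qed

text \<open>The condition on \<open>c \<bullet> c\<close> makes the squared gradient of the
  quadratic equal to \<open>4 * \<alpha> * (s\<^sup>2 - \<kappa>\<^sup>2)\<close>. In dimension
  three the two terms of order \<open>1 / s ^ 3\<close> in the Laplacian then cancel and only the
  softening remains. The direct kernel is the case \<open>\<alpha> = 1\<close>, the image kernel the
  case \<open>\<alpha> = (norm x)\<^sup>2\<close>.\<close>

lemma C2_on_inv_sqrt_quadratic:
  fixes c :: "real^3"
  assumes pos: "\<And>y::real^3. \<alpha> * (y \<bullet> y) + c \<bullet> y + k > 0" and disc: "c \<bullet> c = 4 * \<alpha> * (k - \<kappa>\<^sup>2)"
  defines "s \<equiv> \<lambda>y. sqrt (\<alpha> * (y \<bullet> y) + c \<bullet> y + k)"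
  shows "C2_on UNIV (\<lambda>y. 1 / s y) (\<lambda>y. (- 1 / (2 * s y ^ 3)) *\<^sub>R ((2 * \<alpha>) *\<^sub>R y + c))
           (\<lambda>y. - 3 * \<alpha> * \<kappa>\<^sup>2 / s y ^ 5)"
proof -
  let ?f = "\<lambda>y. \<alpha> * (y \<bullet> y) + c \<bullet> y + k"
  have d1: "((\<lambda>z. 1 / sqrt z) has_real_derivative - 1 / (2 * sqrt z ^ 3)) (at z)" if "z > 0" for z
    using that by (auto intro!: derivative_eq_intros simp: field_simps power3_eq_cube)
  have d2: "((\<lambda>z. - 1 / (2 * sqrt z ^ 3)) has_real_derivative 3 / (4 * sqrt z ^ 5)) (at z)" if "z > 0" for z
  proof -
    have "((\<lambda>z. - 1 / (2 * sqrt z ^ 3)) has_real_derivative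
        (2 * (3 * sqrt z ^ 2 * (inverse (sqrt z) / 2))) / (2 * sqrt z ^ 3)\<^sup>2) (at z)"
      using that by (auto intro!: derivative_eq_intros simp: power2_eq_square)
    moreover have "(2 * (3 * r ^ 2 * (inverse r / 2))) / (2 * r ^ 3)\<^sup>2 = 3 / (4 * r ^ 5)" if "r > 0" for r :: real
      using that by (simp add: field_simps power2_eq_square power3_eq_cube eval_nat_numeral)
    moreover have "sqrt z > 0" using that by simp
    ultimately show ?thesis by metis
  qed
  have c: "continuous_on (?f ` UNIV) (\<lambda>z. 3 / (4 * sqrt z ^ 5))"
    using pos by (auto intro!: continuous_intros simp: less_imp_neq[THEN not_sym])
  have eq: "- 1 / (2 * s y ^ 3) * (2 * \<alpha> * DIM(real^3)) + 3 / (4 * s y ^ 5) * (((2 * \<alpha>) *\<^sub>R y + c) \<bullet> ((2 * \<alpha>) *\<^sub>R y + c))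
     = - 3 * \<alpha> * \<kappa>\<^sup>2 / s y ^ 5" for y
  proof -
    have sp: "s y > 0" using pos[of y] by (simp add: s_def)
    have s2: "(s y)\<^sup>2 = ?f y" using pos[of y] by (simp add: s_def)
    have "((2 * \<alpha>) *\<^sub>R y + c) \<bullet> ((2 * \<alpha>) *\<^sub>R y + c) = 4 * \<alpha>\<^sup>2 * (y \<bullet> y) + 4 * \<alpha> * (c \<bullet> y) + c \<bullet> c"
      by (simp add: inner_simps inner_commute power2_eq_square algebra_simps)
    also have "\<dots> = 4 * \<alpha> * ((s y)\<^sup>2 - \<kappa>\<^sup>2)"
      unfolding s2 disc by (simp add: power2_eq_square algebra_simps)
    finally have e: "((2 * \<alpha>) *\<^sub>R y + c) \<bullet> ((2 * \<alpha>) *\<^sub>R y + c) = 4 * \<alpha> * ((s y)\<^sup>2 - \<kappa>\<^sup>2)" .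
    show ?thesis unfolding e using sp
      by (simp add: field_simps)
  qed
  have "C2_on UNIV (\<lambda>y. 1 / sqrt (?f y)) (\<lambda>y. (- 1 / (2 * sqrt (?f y) ^ 3)) *\<^sub>R ((2 * \<alpha>) *\<^sub>R y + c))
     (\<lambda>y. - 1 / (2 * sqrt (?f y) ^ 3) * (2 * \<alpha> * DIM(real^3)) + 3 / (4 * sqrt (?f y) ^ 5) * (((2 * \<alpha>) *\<^sub>R y + c) \<bullet> ((2 * \<alpha>) *\<^sub>R y + c)))"
    by (rule C2_on_compose_real[OF C2_on_quadratic]) (use d1 d2 pos c in auto)
  then show ?thesis using eq unfolding s_def by simp
qed

lemma C2_on_newton:
  assumes "\<kappa> > 0"
  shows "C2_on UNIV (\<lambda>y. 1 / sdist \<kappa> x y) (\<lambda>y. (- 1 / sdist \<kappa> x y ^ 3) *\<^sub>R (y - x)) (\<lambda>y. - 3 * \<kappa>\<^sup>2 / sdist \<kappa> x y ^ 5)"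
proof -
  have e: "1 * (y \<bullet> y) + (- 2 *\<^sub>R x) \<bullet> y + (x \<bullet> x + \<kappa>\<^sup>2) = (norm (y - x))\<^sup>2 + \<kappa>\<^sup>2" for y
    by (simp add: power2_norm_eq_inner inner_simps inner_commute algebra_simps)
  have "C2_on UNIV (\<lambda>y. 1 / sdist \<kappa> x y) (\<lambda>y. (- 1 / (2 * sdist \<kappa> x y ^ 3)) *\<^sub>R ((2 * 1) *\<^sub>R y + (- 2 *\<^sub>R x)))
     (\<lambda>y. - 3 * 1 * \<kappa>\<^sup>2 / sdist \<kappa> x y ^ 5)"
    using C2_on_inv_sqrt_quadratic[of 1 "- 2 *\<^sub>R x" "x \<bullet> x + \<kappa>\<^sup>2" \<kappa>] assms
    unfolding e sdist_def[symmetric] by (simp add: add_nonneg_pos)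
  moreover have "(- 1 / (2 * s)) *\<^sub>R ((2 * 1) *\<^sub>R y + (- 2 *\<^sub>R x)) = (- 1 / s) *\<^sub>R (y - x)" for s :: real and y
    by (simp add: algebra_simps divide_simps)
  ultimately show ?thesis by simp
qed

text \<open>The Dirichlet Green function of the unit ball without its factor
  \<open>1 / (4 * pi)\<close>. Softening both terms by the same \<open>\<kappa>\<close> keeps the
  zero boundary values exact.\<close>

definition green :: "real \<Rightarrow> real^3 \<Rightarrow> real^3 \<Rightarrow> real" where
  "green \<kappa> x y = 1 / sdist \<kappa> x y - 1 / reflected_dist \<kappa> x y"

lemma C2_on_green:
  assumes "\<kappa> > 0"
  shows "\<exists>G. C2_on UNIV (green \<kappa> x) G (\<lambda>y. 3 * (norm x)\<^sup>2 * \<kappa>\<^sup>2 / reflected_dist \<kappa> x y ^ 5 - 3 * \<kappa>\<^sup>2 / sdist \<kappa> x y ^ 5)"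
proof -
  have e: "(norm x)\<^sup>2 * (y \<bullet> y) + (- 2 *\<^sub>R x) \<bullet> y + (1 + \<kappa>\<^sup>2) = (norm x)\<^sup>2 * (norm y)\<^sup>2 - 2 * (x \<bullet> y) + 1 + \<kappa>\<^sup>2" for y
    by (simp add: power2_norm_eq_inner)
  have "C2_on UNIV (\<lambda>y. 1 / reflected_dist \<kappa> x y) (\<lambda>y. (- 1 / (2 * reflected_dist \<kappa> x y ^ 3)) *\<^sub>R ((2 * (norm x)\<^sup>2) *\<^sub>R y + (- 2 *\<^sub>R x)))
     (\<lambda>y. - 3 * (norm x)\<^sup>2 * \<kappa>\<^sup>2 / reflected_dist \<kappa> x y ^ 5)"
    using C2_on_inv_sqrt_quadratic[of "(norm x)\<^sup>2" "- 2 *\<^sub>R x" "1 + \<kappa>\<^sup>2" \<kappa>] reflected_dist_pos[OF assms, of x]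
    unfolding e reflected_dist_def[symmetric] by (simp add: reflected_dist_def power2_norm_eq_inner)
  from C2_on_diff[OF C2_on_newton[OF assms, of x] this] show ?thesis
    unfolding green_def[abs_def] by (auto simp: algebra_simps)
qed

lemma green_sphere: "norm y = 1 \<Longrightarrow> green \<kappa> x y = 0"
proof -
  assume y: "norm y = 1"
  have "(norm x)\<^sup>2 * (norm y)\<^sup>2 - 2 * (x \<bullet> y) + 1 = (norm (y - x))\<^sup>2"
    using y by (simp add: power2_norm_eq_inner inner_simps inner_commute norm_eq_1)
  then show ?thesis by (simp add: green_def sdist_def reflected_dist_def)
qed

lemma green_pos: 
  assumes "\<kappa> > 0" "norm x < 1" "norm y < 1" shows "green \<kappa> x y > 0"
proof -
  have "(norm x)\<^sup>2 < 1" "(norm y)\<^sup>2 < 1" using assms by (auto simp: power_less_one_iff)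
  then have "(sdist \<kappa> x y)\<^sup>2 < (reflected_dist \<kappa> x y)\<^sup>2" unfolding reflected_dist_sdist by simp
  then have "sdist \<kappa> x y < reflected_dist \<kappa> x y" using reflected_dist_pos[OF assms(1), of x y] by (simp add: power2_less_imp_less)
  then show ?thesis using sdist_pos[OF assms(1), of x y] by (simp add: green_def divide_strict_left_mono)
qed

text \<open>The square roots are moduli of \<open>Complex a k\<close> and
  \<open>Complex b k\<close>, so this is the reverse triangle inequality.\<close>

lemma sqrt_sq_lipschitz: "\<bar>sqrt (a\<^sup>2 + k\<^sup>2) - sqrt (b\<^sup>2 + k\<^sup>2)\<bar> \<le> \<bar>a - b\<bar>"
  using norm_triangle_ineq3[of "Complex a k" "Complex b k"]
  by (simp add: complex_norm complex_diff)

lemma sdist_lipschitz: "\<bar>sdist \<kappa> x y - sdist \<kappa> x' y\<bar> \<le> norm (x - x')"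
  unfolding sdist_def
  using order_trans[OF sqrt_sq_lipschitz norm_triangle_ineq3[of "y - x" "y - x'"], of \<kappa>]
  by (simp add: norm_minus_commute)

text \<open>The reflected distance is symmetric in its two points, so \<open>y\<close> may be
  inverted instead of \<open>x\<close>. As a function of \<open>x\<close> it is then a softened
  distance from \<open>norm y *\<^sub>R x\<close> to a fixed point, with Lipschitz constant
  \<open>norm y\<close>. The centre \<open>y = 0\<close> has no inversion, but there the function is
  constant.\<close>

lemma reflected_dist_lipschitz:
  assumes "norm y \<le> 1" shows "\<bar>reflected_dist \<kappa> x y - reflected_dist \<kappa> x' y\<bar> \<le> norm (x - x')"
proof (cases "y = 0")
  case True then show ?thesis by (simp add: reflected_dist_def)
next
  case False
  have e: "(norm x)\<^sup>2 * (norm y)\<^sup>2 - 2 * (x \<bullet> y) + 1 = (norm (norm y *\<^sub>R x - (1 / norm y) *\<^sub>R y))\<^sup>2" for x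
  proof -
    have "(norm (norm y *\<^sub>R x - (1 / norm y) *\<^sub>R y))\<^sup>2
       = norm y * norm y * (x \<bullet> x) - 2 * (norm y * (1 / norm y)) * (x \<bullet> y) + (1 / norm y) * (1 / norm y) * (y \<bullet> y)"
      unfolding power2_norm_eq_inner by (simp add: inner_simps inner_commute algebra_simps)
    also have "\<dots> = (norm x)\<^sup>2 * (norm y)\<^sup>2 - 2 * (x \<bullet> y) + 1"
      using False unfolding power2_norm_eq_inner[symmetric] by (simp add: power2_eq_square)
    finally show ?thesis by simp
  qed
  have "\<bar>reflected_dist \<kappa> x y - reflected_dist \<kappa> x' y\<bar> \<le> \<bar>norm (norm y *\<^sub>R x - (1 / norm y) *\<^sub>R y) - norm (norm y *\<^sub>R x' - (1 / norm y) *\<^sub>R y)\<bar>"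
    unfolding reflected_dist_def e by (rule sqrt_sq_lipschitz)
  also have "\<dots> \<le> norm ((norm y *\<^sub>R x - (1 / norm y) *\<^sub>R y) - (norm y *\<^sub>R x' - (1 / norm y) *\<^sub>R y))"
    by (rule norm_triangle_ineq3)
  also have "\<dots> = norm y * norm (x - x')"
    using norm_scaleR[of "norm y" "x - x'"] by (simp add: algebra_simps)
  also have "\<dots> \<le> norm (x - x')" using assms by (simp add: mult_left_le_one_le)
  finally show ?thesis .
qed

lemma inverse_diff_bound:
  fixes s t r :: real assumes "s > 0" "t > 0" "\<bar>s - t\<bar> \<le> r" "s0 > 0" "t0 > 0" "s0 \<le> s" "t0 \<le> t"
  shows "\<bar>1 / s - 1 / t\<bar> \<le> r / (s0 * t0)"
proof -
  have "\<bar>1 / s - 1 / t\<bar> = \<bar>s - t\<bar> / (s * t)" using assms(1,2)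
    by (simp add: divide_simps abs_minus_commute)
  also have "\<dots> \<le> r / (s0 * t0)" using assms by (intro frac_le mult_mono) auto
  finally show ?thesis .
qed

text \<open>The image distances dominate the direct ones in the closed ball, so the image term obeys
  the same bound as the Newton term and only doubles the constant, uniformly up to the
  sphere.\<close>

lemma green_diff:
  assumes k: "\<kappa> > 0" and n: "norm x \<le> 1" "norm x' \<le> 1" "norm y \<le> 1"
  shows "\<bar>green \<kappa> x y - green \<kappa> x' y\<bar> \<le> 2 * norm (x - x') / (sdist \<kappa> x y * sdist \<kappa> x' y)"
proof -
  note p = sdist_pos[OF k, of x y] sdist_pos[OF k, of x' y] reflected_dist_pos[OF k, of x y] reflected_dist_pos[OF k, of x' y]
  have "\<bar>1 / sdist \<kappa> x y - 1 / sdist \<kappa> x' y\<bar> \<le> norm (x - x') / (sdist \<kappa> x y * sdist \<kappa> x' y)"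
    by (rule inverse_diff_bound) (use p sdist_lipschitz in auto)
  moreover have "\<bar>1 / reflected_dist \<kappa> x y - 1 / reflected_dist \<kappa> x' y\<bar> \<le> norm (x - x') / (sdist \<kappa> x y * sdist \<kappa> x' y)"
    by (rule inverse_diff_bound) (use p reflected_dist_lipschitz sdist_le_sq n in auto)
  ultimately show ?thesis unfolding green_def by (simp add: add_divide_distrib[symmetric])
qed

text \<open>If \<open>s \<le> t\<close> are the distances to the two poles, then
  \<open>\<rho> \<le> s + t \<le> 2 * t\<close>, hence \<open>s + \<rho> \<le> 3 * t\<close>. The
  farther pole can therefore be replaced by the nearer one at the cost of a factor 3, leaving
  kernels with a single pole.\<close>

lemma kernel_split:
  assumes k: "\<kappa> > 0" and r: "norm (x - x') = \<rho>" "\<rho> > 0"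
  shows "\<rho> / (sdist \<kappa> x y * sdist \<kappa> x' y) \<le>
     3 * (\<rho> / (sdist \<kappa> x y * (sdist \<kappa> x y + \<rho>)) + \<rho> / (sdist \<kappa> x' y * (sdist \<kappa> x' y + \<rho>)))"
proof -
  have *: "\<rho> / (s * t) \<le> 3 * (\<rho> / (s * (s + \<rho>)) + \<rho> / (t * (t + \<rho>)))"
    if "s \<le> t" "\<rho> \<le> s + t" "s > 0" "t > 0" for s t
  proof -
    have "\<rho> / (s * t) \<le> \<rho> / (s * ((s + \<rho>) / 3))"
      using that r by (intro divide_left_mono mult_left_mono mult_pos_pos) auto
    also have "\<dots> = 3 * (\<rho> / (s * (s + \<rho>)))" by simp
    also have "\<dots> \<le> 3 * (\<rho> / (s * (s + \<rho>)) + \<rho> / (t * (t + \<rho>)))" using that r by simp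
    finally show ?thesis .
  qed
  have "\<rho> \<le> norm (y - x) + norm (y - x')"
    using r norm_triangle_ineq4[of "y - x" "y - x'"] by (simp add: norm_minus_commute)
  then have "\<rho> \<le> sdist \<kappa> x y + sdist \<kappa> x' y" using sdist_ge(1)[of \<kappa> y x] sdist_ge(1)[of \<kappa> y x'] k by linarith
  then show ?thesis
    using *[of "sdist \<kappa> x y" "sdist \<kappa> x' y"] *[of "sdist \<kappa> x' y" "sdist \<kappa> x y"] sdist_pos[OF k, of x y] sdist_pos[OF k, of x' y]
    by (cases "sdist \<kappa> x y \<le> sdist \<kappa> x' y") (auto simp: mult.commute add.commute)
qed

section \<open>Integration over the unit ball and kernel masses\<close>

definition ballM :: "(real^3) measure" where
  "ballM = restrict_space lborel (ball 0 1)"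

lemma space_ballM [simp]: "space ballM = ball 0 1"
  by (simp add: ballM_def space_restrict_space)

lemma ballM_borel: "f \<in> borel_measurable borel \<Longrightarrow> f \<in> borel_measurable ballM"
  unfolding ballM_def by (rule measurable_restrict_space1) simp

lemma ballM_cont:
  fixes f :: "real^3 \<Rightarrow> 'b::topological_space"
  assumes "continuous_on (ball 0 1) f" shows "f \<in> borel_measurable ballM"
proof -
  have "f \<in> borel_measurable (restrict_space borel (ball 0 1))"
    by (rule borel_measurable_continuous_on_restrict[OF assms])
  moreover have "sets (restrict_space borel (ball 0 1)) = sets ballM"
    unfolding ballM_def by (intro sets_restrict_space_cong) simp
  ultimately show ?thesis using measurable_cong_sets by blast
qed

lemma ballM_finite: "finite_measure ballM"
proof
  have "emeasure ballM (ball 0 1) = emeasure lborel (ball (0::real^3) 1)"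
    unfolding ballM_def by (subst emeasure_restrict_space) auto
  also have "\<dots> < \<infinity>" by (rule emeasure_bounded_finite) simp
  finally show "emeasure ballM (space ballM) \<noteq> \<infinity>" by auto
qed

lemma ballM_integrable_bounded:
  fixes f :: "real^3 \<Rightarrow> real"
  assumes "f \<in> borel_measurable ballM" "\<And>x. norm x < 1 \<Longrightarrow> \<bar>f x\<bar> \<le> C"
  shows "integrable ballM f"
  by (rule finite_measure.integrable_const_bound[OF ballM_finite, of _ C])
     (use assms in \<open>auto intro!: AE_I2\<close>)

lemma ballM_integral_le:
  fixes f h :: "real^3 \<Rightarrow> real"
  assumes "integrable lborel h" "\<And>x. norm x < 1 \<Longrightarrow> f x \<le> h x" "\<And>x. 0 \<le> h x"
  shows "integral\<^sup>L ballM f \<le> integral\<^sup>L lborel h"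
proof (cases "integrable ballM f")
  case True
  have "integral\<^sup>L ballM f = (\<integral>x. indicator (ball 0 1) x *\<^sub>R f x \<partial>lborel)"
    unfolding ballM_def by (rule integral_restrict_space) simp
  also have "\<dots> \<le> integral\<^sup>L lborel h"
  proof (rule integral_mono)
    show "integrable lborel (\<lambda>x. indicator (ball 0 1) x *\<^sub>R f x)"
      using True unfolding ballM_def by (subst (asm) integrable_restrict_space) auto
  qed (use assms in \<open>auto simp: indicator_def\<close>)
  finally show ?thesis .
next
  \<comment> \<open>The integral of a function that is not integrable is zero by convention, so
    nonnegativity of \<open>h\<close> settles this case.\<close>
  case False
  then show ?thesis using assms(1,3) by (simp add: not_integrable_integral_eq)
qed

lemma ballM_integral_eq:
  fixes f :: "real^3 \<Rightarrow> real"
  shows "integral\<^sup>L ballM f = (\<integral>x. indicator (ball 0 1) x * f x \<partial>lborel)"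
  unfolding ballM_def by (subst integral_restrict_space) auto

lemma ballM_integrable_iff:
  fixes f :: "real^3 \<Rightarrow> real"
  shows "integrable ballM f \<longleftrightarrow> integrable lborel (\<lambda>x. indicator (ball 0 1) x * f x)"
  unfolding ballM_def by (subst integrable_restrict_space) auto

lemma measure_cball3_le: "r \<ge> 0 \<Longrightarrow> measure lborel (cball (x::real^3) r) \<le> 5 * r ^ 3"
proof -
  assume r: "r \<ge> 0"
  have "measure lborel (cball x r) = 4 / 3 * r ^ 3 * pi"
    using sphere_volume[OF r, of x] by (simp add: content_cball_conv_ball)
  also have "\<dots> \<le> 4 / 3 * r ^ 3 * (15 / 4)"
    using pi_approx r by (intro mult_left_mono) auto
  finally show ?thesis by simp
qed

lemma integrable_cball_indicator [simp]:
  "integrable lborel (indicat_real (cball (x::'a::euclidean_space) r))"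
  by (intro integrable_real_indicator)
     (auto simp: emeasure_bounded_finite[OF bounded_cball, unfolded infinity_ennreal_def])

lemma sdist_meas [measurable]: "(\<lambda>y. sdist \<kappa> x y) \<in> borel_measurable borel"
  by (intro borel_measurable_continuous_onI continuous_intros)

text \<open>Scaling by one half reproduces at most half of the integral, up to the contribution of a shell.\<close>

lemma integral_inv_sdist_sq_unit:
  assumes k: "\<kappa> > 0"
  shows "(\<integral>z. indicator (cball 0 1) z / (sdist \<kappa> 0 z)\<^sup>2 \<partial>lborel) \<le> 40"
proof -
  let ?h = "\<lambda>\<kappa> (z::real^3). indicator (cball 0 1) z / (sdist \<kappa> 0 z)\<^sup>2 :: real"
  have int: "integrable lborel (?h k)" if "k > 0" for k
  proof (rule Bochner_Integration.integrable_bound[of lborel "\<lambda>z. 1 / k\<^sup>2 * indicator (cball 0 1) z"])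
    show "AE z in lborel. norm (?h k z) \<le> norm (1 / k\<^sup>2 * indicator (cball 0 1) z)"
      using that sdist_ge(2)[of k] by (auto simp: indicator_def intro!: frac_le power_mono)
    show "?h k \<in> borel_measurable lborel"
      by (simp, intro borel_measurable_divide borel_measurable_indicator borel_measurable_power sdist_meas) auto
  qed auto
  let ?I = "integral\<^sup>L lborel (?h \<kappa>)"
  define g where "g z = indicator (cball 0 (1/2)) z / (sdist \<kappa> 0 z)\<^sup>2" for z :: "real^3"
  have [measurable]: "g \<in> borel_measurable borel" unfolding g_def[abs_def]
    by (intro borel_measurable_divide borel_measurable_indicator borel_measurable_power sdist_meas) auto
  have gint: "integrable lborel g"
    by (rule Bochner_Integration.integrable_bound[OF int[OF k]]) (auto simp: g_def indicator_def)
  have "integral\<^sup>L lborel g = 1 / 8 * (\<integral>z. g (0 + (1/2) *\<^sub>R z) \<partial>lborel)"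
    by (subst lborel_integral_affine[of _ "1/2" 0]) (auto simp: power3_eq_cube)
  also have "(\<lambda>z. g (0 + (1/2) *\<^sub>R z)) = (\<lambda>z. 4 * ?h (2 * \<kappa>) z)"
  proof
    fix z :: "real^3"
    have "(sdist \<kappa> 0 ((1/2) *\<^sub>R z))\<^sup>2 = (sdist (2 * \<kappa>) 0 z)\<^sup>2 / 4"
      unfolding sdist_sq by (simp add: power2_eq_square field_simps)
    then have "g ((1/2) *\<^sub>R z) = 4 * ?h (2 * \<kappa>) z"
      unfolding g_def by (simp only:) (simp add: indicator_def)
    then show "g (0 + (1/2) *\<^sub>R z) = 4 * ?h (2 * \<kappa>) z" by simp
  qed
  also have "1 / 8 * (\<integral>z. 4 * ?h (2 * \<kappa>) z \<partial>lborel) = 1 / 2 * integral\<^sup>L lborel (?h (2 * \<kappa>))"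
    by (subst integral_mult_right_zero) simp
  \<comment> \<open>Volume contributes \<open>1 / 8\<close> and the kernel 4, hence the factor
    \<open>1 / 2\<close>. Rescaling has doubled \<open>\<kappa>\<close>, which only decreases the
    integrand.\<close>
  also have "\<dots> \<le> 1 / 2 * ?I"
  proof -
    have "?h (2 * \<kappa>) z \<le> ?h \<kappa> z" for z
      using k sdist_pos[of \<kappa> 0 z] unfolding sdist_sq
      by (auto simp: indicator_def intro!: divide_left_mono mult_pos_pos add_nonneg_pos)
    then show ?thesis using int k by (auto intro!: integral_mono)
  qed
  finally have g1: "integral\<^sup>L lborel g \<le> 1 / 2 * ?I" .
  have "?I \<le> (\<integral>z. g z + 4 * indicator (cball 0 1) z \<partial>lborel)"
  proof (rule integral_mono)
    fix z :: "real^3"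
    show "?h \<kappa> z \<le> g z + 4 * indicator (cball 0 1) z"
    proof (cases "norm z \<le> 1/2")
      case False
      then have "(1/2)\<^sup>2 \<le> (sdist \<kappa> 0 z)\<^sup>2" using sdist_ge(1)[of \<kappa> z 0] k by (intro power_mono) auto
      then have "1 / (sdist \<kappa> 0 z)\<^sup>2 \<le> 1 / (1/2)\<^sup>2" by (intro divide_left_mono) (auto simp: sdist_pos[OF k, THEN less_imp_neq, THEN not_sym])
      then show ?thesis by (auto simp: g_def indicator_def power2_eq_square)
    qed (auto simp: g_def indicator_def)
  qed (use int k gint in auto)
  also have "\<dots> = integral\<^sup>L lborel g + 4 * measure lborel (cball (0::real^3) 1)"
    using gint by (subst Bochner_Integration.integral_add) auto
  \<comment> \<open>On the shell the integrand is at most 4 and the volume at most 5. Absorbing half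
    of \<open>?I\<close> on the left turns 20 into 40.\<close>
  also have "\<dots> \<le> 1 / 2 * ?I + 20"
    using g1 measure_cball3_le[of 1 0] by simp
  finally show ?thesis by simp
qed

lemma integral_inv_sdist_sq:
  assumes k: "\<kappa> > 0" and s: "s > 0"
  shows "integrable lborel (\<lambda>y. indicator (cball x s) y / (sdist \<kappa> x y)\<^sup>2)"
    "(\<integral>y. indicator (cball x s) y / (sdist \<kappa> x y)\<^sup>2 \<partial>lborel) \<le> 40 * s"
proof -
  have [measurable]: "(\<lambda>y. indicator (cball x s) y / (sdist \<kappa> x y)\<^sup>2 :: real) \<in> borel_measurable borel"
    by (intro borel_measurable_divide borel_measurable_indicator borel_measurable_power sdist_meas) auto
  show "integrable lborel (\<lambda>y. indicator (cball x s) y / (sdist \<kappa> x y)\<^sup>2)"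
  proof (rule Bochner_Integration.integrable_bound[of lborel "\<lambda>z. 1 / \<kappa>\<^sup>2 * indicator (cball x s) z"])
    show "AE z in lborel. norm (indicator (cball x s) z / (sdist \<kappa> x z)\<^sup>2) \<le> norm (1 / \<kappa>\<^sup>2 * indicator (cball x s) z)"
      using k sdist_ge(2)[of \<kappa>] by (auto simp: indicator_def intro!: frac_le power_mono)
  qed auto
  have e: "indicator (cball x s) (x + s *\<^sub>R z) / (sdist \<kappa> x (x + s *\<^sub>R z))\<^sup>2
      = 1 / s\<^sup>2 * (indicator (cball 0 1) z / (sdist (\<kappa> / s) 0 z)\<^sup>2 :: real)" for z
  proof -
    have "(sdist \<kappa> x (x + s *\<^sub>R z))\<^sup>2 = s\<^sup>2 * (sdist (\<kappa> / s) 0 z)\<^sup>2"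
      unfolding sdist_sq using s by (simp add: power_mult_distrib power_divide field_simps)
    moreover have "indicator (cball x s) (x + s *\<^sub>R z) = (indicator (cball 0 1) z :: real)"
      using s by (auto simp: indicator_def dist_norm)
    ultimately show ?thesis by simp
  qed
  have "(\<integral>y. indicator (cball x s) y / (sdist \<kappa> x y)\<^sup>2 \<partial>lborel)
     = s ^ 3 * (1 / s\<^sup>2 * (\<integral>z. indicator (cball 0 1) z / (sdist (\<kappa> / s) 0 z)\<^sup>2 \<partial>lborel))"
    using s by (subst lborel_integral_affine[of _ s x]) (simp_all only: e integral_mult_right_zero, auto)
  also have "\<dots> \<le> s ^ 3 * (1 / s\<^sup>2 * 40)"
    using s k by (intro mult_left_mono integral_inv_sdist_sq_unit) auto
  also have "\<dots> = 40 * s" using s by (simp add: power2_eq_square power3_eq_cube)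
  finally show "(\<integral>y. indicator (cball x s) y / (sdist \<kappa> x y)\<^sup>2 \<partial>lborel) \<le> 40 * s" .
qed

text \<open>The Newton kernel truncated at the distance \<open>1 / a\<close>. Its Laplacian is bounded above by the bounded
  function \<open>etaN\<close>, which lives near that distance.\<close>

definition eta :: "real \<Rightarrow> real \<Rightarrow> real^3 \<Rightarrow> real^3 \<Rightarrow> real" where
  "eta \<kappa> a x y = trunc a (1 / sdist \<kappa> x y)"

definition etaG :: "real \<Rightarrow> real \<Rightarrow> real^3 \<Rightarrow> real^3 \<Rightarrow> real^3" where
  "etaG \<kappa> a x y = trunc1 a (1 / sdist \<kappa> x y) *\<^sub>R ((- 1 / sdist \<kappa> x y ^ 3) *\<^sub>R (y - x))"

definition etaN :: "real \<Rightarrow> real \<Rightarrow> real^3 \<Rightarrow> real^3 \<Rightarrow> real" where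
  "etaN \<kappa> a x y = trunc2 a (1 / sdist \<kappa> x y) * ((norm (y - x))\<^sup>2 / sdist \<kappa> x y ^ 6)"

definition etaL :: "real \<Rightarrow> real \<Rightarrow> real^3 \<Rightarrow> real^3 \<Rightarrow> real" where
  "etaL \<kappa> a x y = etaN \<kappa> a x y - trunc1 a (1 / sdist \<kappa> x y) * (3 * \<kappa>\<^sup>2 / sdist \<kappa> x y ^ 5)"

context fixes \<kappa> a :: real and x :: "real^3" assumes k: "\<kappa> > 0" and a: "a > 0"
begin

lemma C2_on_eta: "C2_on UNIV (eta \<kappa> a x) (etaG \<kappa> a x) (etaL \<kappa> a x)"
proof -
  have "C2_on UNIV (\<lambda>y. trunc a (1 / sdist \<kappa> x y)) (\<lambda>y. trunc1 a (1 / sdist \<kappa> x y) *\<^sub>R ((- 1 / sdist \<kappa> x y ^ 3) *\<^sub>R (y - x)))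
    (\<lambda>y. trunc1 a (1 / sdist \<kappa> x y) * (- 3 * \<kappa>\<^sup>2 / sdist \<kappa> x y ^ 5) +
       trunc2 a (1 / sdist \<kappa> x y) * (((- 1 / sdist \<kappa> x y ^ 3) *\<^sub>R (y - x)) \<bullet> ((- 1 / sdist \<kappa> x y ^ 3) *\<^sub>R (y - x))))"
    by (rule C2_on_compose_real[OF C2_on_newton[OF k]])
       (auto intro: DERIV_trunc DERIV_trunc1 trunc_cont a)
  moreover have "(\<lambda>y. trunc1 a (1 / sdist \<kappa> x y) * (- 3 * \<kappa>\<^sup>2 / sdist \<kappa> x y ^ 5) +
       trunc2 a (1 / sdist \<kappa> x y) * (((- 1 / sdist \<kappa> x y ^ 3) *\<^sub>R (y - x)) \<bullet> ((- 1 / sdist \<kappa> x y ^ 3) *\<^sub>R (y - x)))) = etaL \<kappa> a x"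
  proof
    fix y
    have *: "((- 1 / s ^ 3) *\<^sub>R (y - x)) \<bullet> ((- 1 / s ^ 3) *\<^sub>R (y - x)) = (norm (y - x))\<^sup>2 / s ^ 6" for s :: real
      unfolding inner_scaleR_left inner_scaleR_right power2_norm_eq_inner by (simp add: divide_simps)
    show "trunc1 a (1 / sdist \<kappa> x y) * (- 3 * \<kappa>\<^sup>2 / sdist \<kappa> x y ^ 5) +
       trunc2 a (1 / sdist \<kappa> x y) * (((- 1 / sdist \<kappa> x y ^ 3) *\<^sub>R (y - x)) \<bullet> ((- 1 / sdist \<kappa> x y ^ 3) *\<^sub>R (y - x))) = etaL \<kappa> a x y"
      unfolding * etaL_def etaN_def by simp
  qed
  ultimately show ?thesis
    unfolding eta_def[abs_def] etaG_def[abs_def] by simp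
qed

lemma eta_far:
  assumes "1 / a \<le> norm (y - x)"
  shows "eta \<kappa> a x y = 0" "etaG \<kappa> a x y = 0" "etaL \<kappa> a x y = 0" "etaN \<kappa> a x y = 0"
proof -
  have "1 / a \<le> sdist \<kappa> x y" using assms sdist_ge(1)[of \<kappa> y x] k by linarith
  then have "1 / sdist \<kappa> x y \<le> a"
    using a sdist_pos[OF k, of x y] by (simp add: field_simps)
  note t = trunc_small[OF a this]
  show "eta \<kappa> a x y = 0" "etaG \<kappa> a x y = 0" "etaL \<kappa> a x y = 0" "etaN \<kappa> a x y = 0"
    using t by (simp_all add: eta_def etaG_def etaL_def etaN_def)
qed

lemma eta_bounds: "0 \<le> eta \<kappa> a x y" "eta \<kappa> a x y \<le> 1 / sdist \<kappa> x y"
  using trunc_bounds[OF a, of "1 / sdist \<kappa> x y"] sdist_pos[OF k, of x y] by (auto simp: eta_def)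

lemma eta_lower: "sdist \<kappa> x y \<le> 1 / (4 * a) \<Longrightarrow> 1 / (2 * sdist \<kappa> x y) \<le> eta \<kappa> a x y"
proof -
  assume s: "sdist \<kappa> x y \<le> 1 / (4 * a)"
  have "4 * a \<le> 1 / sdist \<kappa> x y" using s a sdist_pos[OF k, of x y] by (simp add: field_simps)
  then show ?thesis using trunc_bounds(3)[OF a, of "1 / sdist \<kappa> x y"] by (simp add: eta_def)
qed

text \<open>\<open>trunc2\<close> lives where \<open>1 / sdist\<close> lies between \<open>a\<close>
  and \<open>2 * a\<close> and is at most \<open>2 / a\<close>; the squared kernel gradient is at
  most \<open>(1 / sdist) ^ 4\<close>. The product is at most
  \<open>2 / a * (2 * a) ^ 4\<close>.\<close>

lemma etaN_bounds: "0 \<le> etaN \<kappa> a x y" "etaN \<kappa> a x y \<le> 32 * a ^ 3 * indicator (cball x (1 / a)) y"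
proof -
  let ?t = "1 / sdist \<kappa> x y"
  have sp: "sdist \<kappa> x y > 0" by (rule sdist_pos[OF k])
  show "0 \<le> etaN \<kappa> a x y" using trunc2_bounds(1)[OF a] sp by (simp add: etaN_def)
  show "etaN \<kappa> a x y \<le> 32 * a ^ 3 * indicator (cball x (1 / a)) y"
  proof (cases "1 / a \<le> norm (y - x)")
    case True then show ?thesis using eta_far(4) a by (simp add: indicator_def)
  next
    case False
    then have ind: "indicator (cball x (1 / a)) y = (1::real)" by (simp add: dist_norm norm_minus_commute)
    show ?thesis
    proof (cases "2 * a \<le> ?t")
      case True then show ?thesis using trunc_large(2)[OF a True] a by (simp add: etaN_def)
    next
      case False
      have "(norm (y - x))\<^sup>2 / sdist \<kappa> x y ^ 6 \<le> (sdist \<kappa> x y)\<^sup>2 / sdist \<kappa> x y ^ 6"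
        using sp sdist_ge(1)[of \<kappa> y x] k by (intro divide_right_mono power_mono) auto
      also have "\<dots> = ?t ^ 4" using sp by (simp add: power_divide) (simp add: eval_nat_numeral)
      also have "\<dots> \<le> (2 * a) ^ 4" using False sp by (intro power_mono) auto
      finally have "etaN \<kappa> a x y \<le> 2 / a * (2 * a) ^ 4"
        unfolding etaN_def using trunc2_bounds[OF a] sp a by (intro mult_mono) auto
      also have "\<dots> = 32 * a ^ 3" using a by (simp add: field_simps eval_nat_numeral)
      finally show ?thesis using ind by simp
    qed
  qed
qed

lemma etaL_le: "etaL \<kappa> a x y \<le> etaN \<kappa> a x y"
  using trunc1_bounds(1)[OF a, of "1 / sdist \<kappa> x y"] sdist_pos[OF k, of x y] by (simp add: etaL_def)

lemma etaN_meas [measurable]: "etaN \<kappa> a x \<in> borel_measurable borel"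
proof -
  have "trunc2 a \<in> borel_measurable borel" using trunc_cont(3)[OF a, of UNIV] by (rule borel_measurable_continuous_onI)
  note [measurable] = this
  show ?thesis unfolding etaN_def[abs_def] by measurable
qed

text \<open>Height \<open>32 * a ^ 3\<close> times volume \<open>5 / a ^ 3\<close>: the mass depends
  neither on the cut-off radius nor on \<open>\<kappa>\<close>. This scale invariance makes the
  local energy estimate uniform over all scales.\<close>

lemma etaN_integral:
  "integrable lborel (etaN \<kappa> a x)" "integral\<^sup>L lborel (etaN \<kappa> a x) \<le> 160"
proof -
  show i: "integrable lborel (etaN \<kappa> a x)"
    by (rule Bochner_Integration.integrable_bound[of lborel "\<lambda>y. 32 * a ^ 3 * indicator (cball x (1 / a)) y"])
       (use etaN_bounds a in \<open>auto intro!: AE_I2\<close>)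
  have "integral\<^sup>L lborel (etaN \<kappa> a x) \<le> (\<integral>y. 32 * a ^ 3 * indicator (cball x (1 / a)) y \<partial>lborel)"
    by (rule integral_mono[OF i]) (use etaN_bounds in auto)
  also have "\<dots> = 32 * a ^ 3 * measure lborel (cball x (1 / a))" by simp
  also have "\<dots> \<le> 32 * a ^ 3 * (5 * (1 / a) ^ 3)"
    using a by (intro mult_left_mono measure_cball3_le) auto
  also have "\<dots> = 160" using a by (simp add: power_divide)
  finally show "integral\<^sup>L lborel (etaN \<kappa> a x) \<le> 160" .
qed

end

section \<open>The Plummer density as an approximate identity\<close>

definition plummer :: "real \<Rightarrow> real^3 \<Rightarrow> real^3 \<Rightarrow> real" where
  "plummer \<kappa> x y = 3 * \<kappa>\<^sup>2 / sdist \<kappa> x y ^ 5"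

text \<open>\<open>plummer\<close> is minus the Laplacian of \<open>1 / sdist\<close>, so this
  number is \<open>4 * pi\<close>, the usual normalisation of the Newton kernel. It stays symbolic
  and enters through the lower bound 1.\<close>

definition plummer_mass :: real where "plummer_mass = integral\<^sup>L lborel (plummer 1 0)"

lemma plummer_meas [measurable]: "plummer \<kappa> x \<in> borel_measurable borel"
  unfolding plummer_def[abs_def] by measurable

lemma plummer_nonneg: "0 \<le> plummer \<kappa> x y"
  by (simp add: plummer_def sdist_def)

text \<open>A truncated kernel has compact support, so its Laplacian integrates to zero and the
  truncated density has exactly the mass of \<open>etaN\<close>, at most 160. Letting the truncation
  radius grow, Fatou's lemma transfers the bound.\<close>

lemma plummer_integrable: "integrable lborel (plummer 1 0)"
proof -
  define f where "f n y = trunc1 (1 / real (Suc n)) (1 / sdist 1 0 y) * plummer 1 0 y" for n and y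
  have ap: "1 / real (Suc n) > 0" for n by simp
  have [measurable]: "trunc1 (1 / real (Suc n)) \<in> borel_measurable borel" for n
    using trunc_cont(2)[OF ap, of UNIV] by (rule borel_measurable_continuous_onI)
  have [measurable]: "f n \<in> borel_measurable borel" for n unfolding f_def[abs_def] by measurable
  have fn: "f n y \<ge> 0" for n y
    using trunc1_bounds(1)[OF ap] plummer_nonneg by (simp add: f_def)
  have le: "(\<integral>\<^sup>+y. ennreal (f n y) \<partial>lborel) \<le> 160" for n
  proof -
    let ?a = "1 / real (Suc n)"
    have e: "f n y = etaN 1 ?a 0 y - etaL 1 ?a 0 y" for y by (simp add: f_def etaL_def plummer_def)
    have z: "\<And>y. y \<in> UNIV - cball 0 (1 / ?a) \<Longrightarrow> (1::real) = 0 \<or> etaG 1 ?a 0 y = 0"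
      using eta_far(2)[OF zero_less_one ap, where x=0] by (simp add: not_le)
    note g = green_first[OF C1_on_const[of UNIV "1::real"] C2_on_eta[OF zero_less_one ap, where x=0] open_UNIV
        compact_cball[of 0 "1 / ?a"] subset_UNIV z]
    have i1: "integrable lborel (etaL 1 ?a 0)" "integral\<^sup>L lborel (etaL 1 ?a 0) = 0"
      using g by (simp_all add: integrable_restrict_space integral_restrict_space)
    note i2 = etaN_integral[OF zero_less_one ap, where x=0]
    have i: "integrable lborel (f n)" "integral\<^sup>L lborel (f n) \<le> 160"
      unfolding e[abs_def] using i1 i2 by auto
    then show ?thesis using nn_integral_eq_integral[OF i(1)] fn
      by simp (metis ennreal_leI ennreal_numeral i(2) zero_le_numeral)
  qed
  have lim: "(\<lambda>n. ennreal (f n y)) \<longlonglongrightarrow> ennreal (plummer 1 0 y)" for y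
    using tendsto_mult[OF trunc1_tendsto[of "1 / sdist 1 0 y"] tendsto_const[of "plummer 1 0 y"]] sdist_pos[of 1 0 y]
    by (intro tendsto_ennrealI) (simp add: f_def del: of_nat_Suc)
  have "(\<integral>\<^sup>+y. ennreal (plummer 1 0 y) \<partial>lborel) = (\<integral>\<^sup>+y. liminf (\<lambda>n. ennreal (f n y)) \<partial>lborel)"
    by (intro nn_integral_cong lim_imp_Liminf[symmetric, OF _ lim]) simp
  also have "\<dots> \<le> liminf (\<lambda>n. \<integral>\<^sup>+y. ennreal (f n y) \<partial>lborel)"
    by (rule nn_integral_liminf) simp
  also have "\<dots> \<le> 160"
    by (rule Liminf_le) (use le in auto)
  finally have "(\<integral>\<^sup>+y. ennreal (plummer 1 0 y) \<partial>lborel) < \<infinity>"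
    using le_less_trans ennreal_numeral_less_top by (metis infinity_ennreal_def)
  then show ?thesis
    unfolding integrable_iff_bounded using plummer_nonneg by auto
qed

lemma plummer_mass_ge: "plummer_mass \<ge> 1"
proof -
  have "(\<integral>y. 1/2 * indicator (cball (0::real^3) 1) y \<partial>lborel) \<le> plummer_mass"
    unfolding plummer_mass_def
  proof (rule integral_mono[OF _ plummer_integrable])
    fix y :: "real^3"
    show "1/2 * indicator (cball 0 1) y \<le> plummer 1 0 y"
    proof (cases "norm y \<le> 1")
      case True
      then have "(norm y)\<^sup>2 \<le> 1" by (simp add: power_le_one)
      then have "sdist 1 0 y \<le> sqrt 2" by (simp add: sdist_def)
      then have "sdist 1 0 y ^ 5 \<le> sqrt 2 ^ 5" using sdist_pos[of 1 0 y] by (intro power_mono) auto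
      also have "sqrt 2 ^ 5 = 4 * sqrt 2" by (simp add: eval_nat_numeral)
      also have "sqrt 2 \<le> 3/2" by (rule real_le_lsqrt) (auto simp: power2_eq_square)
      then have "4 * sqrt 2 \<le> 6" by simp
      finally have "sdist 1 0 y ^ 5 \<le> 6" .
      then have "1/2 \<le> plummer 1 0 y" unfolding plummer_def using sdist_pos[of 1 0 y] by (simp add: le_divide_eq)
      then show ?thesis using True by simp
    qed (use plummer_nonneg in \<open>auto simp: indicator_def\<close>)
  qed auto
  moreover have "measure lborel (cball (0::real^3) 1) = 4 / 3 * pi"
    using sphere_volume[of 1 0] by (simp add: content_cball_conv_ball)
  ultimately have "1/2 * (4 / 3 * pi) \<le> plummer_mass" by simp
  then show ?thesis using pi_gt3 by simp
qed

text \<open>Substituting \<open>y = x + \<kappa> z\<close> freezes the density and moves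
  \<open>\<kappa>\<close> into \<open>w\<close>. The extension of \<open>w\<close> by zero may jump
  at the sphere, but for each fixed \<open>z\<close> the moved point eventually stays in the ball,
  where \<open>w\<close> is continuous.\<close>

lemma plummer_approx_identity:
  fixes w :: "real^3 \<Rightarrow> real"
  assumes w: "continuous_on (ball 0 1) w" and b: "\<And>y. norm y < 1 \<Longrightarrow> \<bar>w y\<bar> \<le> C" and x: "norm x < 1"
  shows "(\<lambda>n. \<integral>y. w y * plummer (1 / real (Suc n)) x y \<partial>ballM) \<longlonglongrightarrow> plummer_mass * w x"
proof -
  define W where "W y = indicator (ball 0 1) y * w y" for y
  have [measurable]: "W \<in> borel_measurable borel"
    using borel_measurable_continuous_on_indicator[OF _ w] by (simp add: W_def[abs_def])
  have Wb: "\<bar>W y\<bar> \<le> \<bar>C\<bar>" for y using b[of y] by (auto simp: W_def indicator_def)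
  let ?k = "\<lambda>n. 1 / real (Suc n)"
  have eq: "(\<integral>y. w y * plummer (?k n) x y \<partial>ballM) = (\<integral>z. W (x + ?k n *\<^sub>R z) * plummer 1 0 z \<partial>lborel)" for n
  proof -
    let ?c = "?k n"
    have c: "?c > 0" by simp
    have K: "plummer ?c x (x + ?c *\<^sub>R z) = plummer 1 0 z / ?c ^ 3" for z
    proof -
      have "sdist c x (x + c *\<^sub>R z) = c * sdist 1 0 z" if "c > 0" for c
      proof -
        have "sdist c x (x + c *\<^sub>R z) = sqrt (c\<^sup>2 * ((norm z)\<^sup>2 + 1))"
          by (simp add: sdist_def power_mult_distrib algebra_simps)
        then show ?thesis using that by (simp add: sdist_def real_sqrt_mult)
      qed
      from this[OF c] have s: "sdist ?c x (x + ?c *\<^sub>R z) = ?c * sdist 1 0 z" .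
      have "3 * c\<^sup>2 / (c * s) ^ 5 = 3 * 1\<^sup>2 / s ^ 5 / c ^ 3" if "c > 0" "s > 0" for c s :: real
        using that by (simp add: field_simps eval_nat_numeral)
      from this[OF c sdist_pos[of 1 0 z]] show ?thesis unfolding plummer_def s by simp
    qed
    have "(\<integral>y. w y * plummer ?c x y \<partial>ballM) = (\<integral>y. W y * plummer ?c x y \<partial>lborel)"
      unfolding ballM_integral_eq W_def by (simp add: mult.assoc)
    also have "\<dots> = ?c ^ 3 * (\<integral>z. W (x + ?c *\<^sub>R z) * plummer ?c x (x + ?c *\<^sub>R z) \<partial>lborel)"
      by (subst lborel_integral_affine[of _ ?c x]) (use c in \<open>auto simp del: of_nat_Suc\<close>)
    also have "\<dots> = (\<integral>z. W (x + ?c *\<^sub>R z) * plummer 1 0 z \<partial>lborel)"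
      unfolding K using c by (simp del: of_nat_Suc)
    finally show ?thesis .
  qed
  have "(\<lambda>n. \<integral>z. W (x + ?k n *\<^sub>R z) * plummer 1 0 z \<partial>lborel) \<longlonglongrightarrow> (\<integral>z. w x * plummer 1 0 z \<partial>lborel)"
  proof (rule integral_dominated_convergence[where w="\<lambda>z. \<bar>C\<bar> * plummer 1 0 z"])
    show "AE z in lborel. (\<lambda>n. W (x + ?k n *\<^sub>R z) * plummer 1 0 z) \<longlonglongrightarrow> w x * plummer 1 0 z"
    proof (rule AE_I2)
      fix z :: "real^3"
      have l: "(\<lambda>n. x + ?k n *\<^sub>R z) \<longlonglongrightarrow> x"
        using tendsto_add[OF tendsto_const[of x] tendsto_scaleR[OF inv_Suc_tendsto tendsto_const[of z]]] by simp
      have "isCont w x" using w x by (simp add: continuous_on_eq_continuous_at)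
      then have 1: "(\<lambda>n. w (x + ?k n *\<^sub>R z)) \<longlonglongrightarrow> w x"
        using l isCont_tendsto_compose by blast
      have "\<forall>\<^sub>F n in sequentially. x + ?k n *\<^sub>R z \<in> ball 0 1"
        using topological_tendstoD[OF l, of "ball 0 1"] x by simp
      then have "\<forall>\<^sub>F n in sequentially. w (x + ?k n *\<^sub>R z) = W (x + ?k n *\<^sub>R z)"
        by eventually_elim (simp add: W_def)
      with 1 have "(\<lambda>n. W (x + ?k n *\<^sub>R z)) \<longlonglongrightarrow> w x" by (rule Lim_transform_eventually)
      then show "(\<lambda>n. W (x + ?k n *\<^sub>R z) * plummer 1 0 z) \<longlonglongrightarrow> w x * plummer 1 0 z"
        by (intro tendsto_intros)
    qed
    show "AE z in lborel. norm (W (x + ?k n *\<^sub>R z) * plummer 1 0 z) \<le> \<bar>C\<bar> * plummer 1 0 z" for n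
      using Wb plummer_nonneg by (auto simp: abs_mult intro!: mult_right_mono AE_I2)
    show "(\<lambda>z. W (x + ?k n *\<^sub>R z) * plummer 1 0 z) \<in> borel_measurable lborel" for n by measurable
    show "(\<lambda>z. w x * plummer 1 0 z) \<in> borel_measurable lborel" by measurable
    show "integrable lborel (\<lambda>z. \<bar>C\<bar> * plummer 1 0 z)" using plummer_integrable by simp
  qed
  then show ?thesis unfolding eq plummer_mass_def by (simp add: mult.commute)
qed

section \<open>From partial derivatives to gradients\<close>

lemma pd_component_derivative:
  assumes "f differentiable (at x)"
  shows "((\<lambda>x. f x $ k) has_derivative (\<lambda>h. (\<chi> i. pd i f x $ k) \<bullet> h)) (at x)"
proof -
  let ?D = "frechet_derivative f (at x)"
  have D: "(f has_derivative ?D) (at x)" using assms frechet_derivative_works by blast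
  have lin: "linear ?D" using D has_derivative_linear by blast
  have "?D h $ k = (\<chi> i. pd i f x $ k) \<bullet> h" for h
  proof -
    have "?D h = ?D (\<Sum>i\<in>UNIV. (h $ i) *\<^sub>R axis i 1)"
      using basis_expansion[of h] by (simp add: scalar_mult_eq_scaleR)
    also have "\<dots> = (\<Sum>i\<in>UNIV. (h $ i) *\<^sub>R ?D (axis i 1))"
      by (simp add: linear_sum[OF lin] linear_scale[OF lin])
    finally show ?thesis by (simp add: inner_vec_def pd_def mult.commute)
  qed
  moreover have "((\<lambda>x. f x $ k) has_derivative (\<lambda>h. ?D h $ k)) (at x)"
    by (rule bounded_linear.has_derivative[OF bounded_linear_vec_nth D])
  ultimately show ?thesis by simp
qed

lemma pd_C1_on:
  assumes "open S" "f differentiable_on S" "\<And>i. continuous_on S (pd i f)"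
  shows "C1_on S (\<lambda>x. f x $ k) (\<lambda>x. \<chi> i. pd i f x $ k)"
  unfolding C1_on_def
proof safe
  fix x assume "x \<in> S"
  then have "f differentiable (at x)" using assms differentiable_on_eq_differentiable_at by blast
  from pd_component_derivative[OF this, of k]
  show "((\<lambda>x. f x $ k) has_derivative (\<bullet>) (\<chi> i. pd i f x $ k)) (at x)" .
next
  show "continuous_on S (\<lambda>x. \<chi> i. pd i f x $ k)"
    by (intro continuous_on_vec_lambda continuous_intros assms)
qed

lemma ballM_bounded_cont:
  fixes h :: "real^3 \<Rightarrow> 'b::real_normed_vector"
  assumes "continuous_on UNIV h"
  obtains C where "C \<ge> 0" "\<And>x. norm x \<le> 1 \<Longrightarrow> norm (h x) \<le> C"
proof -
  have "compact (h ` cball 0 1)"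
    using assms continuous_on_subset by (intro compact_continuous_image) auto
  then obtain C where C: "\<And>x. x \<in> cball 0 1 \<Longrightarrow> norm (h x) \<le> C"
    by (meson bounded_iff compact_imp_bounded image_eqI)
  show ?thesis by (rule that[of "max C 0"]) (use C in \<open>auto simp: le_max_iff_disj\<close>)
qed

lemma ballM_integrable_mult_cont:
  fixes h f :: "real^3 \<Rightarrow> real"
  assumes h: "continuous_on UNIV h" and f: "integrable ballM f"
  shows "integrable ballM (\<lambda>x. h x * f x)"
proof -
  obtain C where C: "C \<ge> 0" "\<And>x. norm x \<le> 1 \<Longrightarrow> norm (h x) \<le> C"
    by (rule ballM_bounded_cont[OF h]) blast
  have [measurable]: "h \<in> borel_measurable ballM"
    using h by (intro ballM_borel borel_measurable_continuous_onI)
  have [measurable]: "f \<in> borel_measurable ballM" using f by auto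
  show ?thesis
    by (rule Bochner_Integration.integrable_bound[of _ "\<lambda>x. C * f x"])
       (use C f in \<open>auto intro!: AE_I2 mult_right_mono simp: abs_mult\<close>)
qed

lemma C1_on_of_deriv:
  assumes "C1_on S f G" "\<And>t. (p has_real_derivative p' t) (at t)" "continuous_on UNIV p'"
  shows "C1_on S (\<lambda>x. p (f x)) (\<lambda>x. p' (f x) *\<^sub>R G x)"
  by (rule C1_on_compose_real[OF assms(1,2)]) (rule continuous_on_subset[OF assms(3)], simp)

section \<open>The energy density, the tension field and local energy estimates\<close>

locale sphere_map =
  fixes d :: "real^3 \<Rightarrow> real^3" and \<epsilon> :: real
  assumes d: "d \<in> C_inf_e" and eps: "0 < \<epsilon>" "\<epsilon> \<le> 1"
    and energy: "energy d \<le> ennreal (\<epsilon>\<^sup>2)" and tension: "tension_sq d \<le> ennreal (\<epsilon>\<^sup>2)"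
begin

definition g :: "real^3 \<Rightarrow> real" where "g x = grad_sq d x"
definition tension_vec :: "real^3 \<Rightarrow> real^3" where "tension_vec x = laplacian d x + grad_sq d x *\<^sub>R d x"
definition tension_norm :: "real^3 \<Rightarrow> real" where "tension_norm x = norm (tension_vec x)"
definition grad_comp :: "3 \<Rightarrow> real^3 \<Rightarrow> real^3" where "grad_comp k x = (\<chi> i. pd i d x $ k)"
definition lap_comp :: "3 \<Rightarrow> real^3 \<Rightarrow> real" where "lap_comp k x = laplacian d x $ k"
definition u :: "3 \<Rightarrow> real^3 \<Rightarrow> real" where "u k x = d x $ k - e3 $ k"

lemma norm_e3: "norm e3 = 1"
proof -
  have "e3 \<bullet> e3 = 1" by (simp add: e3_def inner_vec_def sum_3)
  then show ?thesis by (simp add: norm_eq_1)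
qed

lemma diff0: "d differentiable_on ball 0 1"
  and diff1: "pd i d differentiable_on ball 0 1"
  and diff2: "pd j (pd i d) differentiable_on ball 0 1"
proof -
  have s: "foldr pd is d differentiable_on ball 0 1" for "is"
    using d unfolding C_inf_e_def smooth_on_def by blast
  show "d differentiable_on ball 0 1" using s[of "[]"] by simp
  show "pd i d differentiable_on ball 0 1" using s[of "[i]"] by simp
  show "pd j (pd i d) differentiable_on ball 0 1" using s[of "[j, i]"] by simp
qed

lemma cont_d: "continuous_on (cball 0 1) d" using d by (simp add: C_inf_e_def)

lemma d_sphere: "norm x = 1 \<Longrightarrow> d x = e3" using d by (simp add: C_inf_e_def)

lemma norm_d: "norm x \<le> 1 \<Longrightarrow> norm (d x) = 1"
  using d d_sphere[of x] norm_e3 by (cases "norm x = 1") (auto simp: C_inf_e_def)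

lemma C2_d: "C2_on (ball 0 1) (\<lambda>x. d x $ k) (grad_comp k) (lap_comp k)"
proof -
  have c1: "continuous_on (ball 0 1) (pd i d)" for i
    using diff1 differentiable_imp_continuous_on by blast
  have c2: "continuous_on (ball 0 1) (pd j (pd i d))" for i j
    using diff2 differentiable_imp_continuous_on by blast
  \<comment> \<open>\<open>C2_on\<close> indexes second derivatives by basis vectors while
    \<open>pd\<close> uses coordinate indices; \<open>ix\<close> translates back.\<close>
  define ix where "ix = inv (\<lambda>i::3. axis i (1::real))"
  have inj: "inj (\<lambda>i::3. axis i (1::real))" by (auto simp: inj_def axis_eq_axis)
  have ix: "ix (axis i 1) = i" for i unfolding ix_def by (rule inv_f_f[OF inj])
  have Bs: "(Basis :: (real^3) set) = (\<lambda>i. axis i 1) ` UNIV" by (auto simp: Basis_vec_def)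
  have gb: "grad_comp k x \<bullet> axis i 1 = pd i d x $ k" for x i by (simp add: grad_comp_def inner_axis)
  have "C1_on (ball 0 1) (\<lambda>x. d x $ k) (grad_comp k)"
    unfolding grad_comp_def by (rule pd_C1_on[OF open_ball diff0 c1])
  moreover have "\<forall>b\<in>Basis. C1_on (ball 0 1) (\<lambda>x. grad_comp k x \<bullet> b) (\<lambda>x. \<chi> j. pd j (pd (ix b) d) x $ k)"
    unfolding Bs using pd_C1_on[OF open_ball diff1 c2] by (simp add: gb ix)
  moreover have "lap_comp k x = (\<Sum>b\<in>Basis. (\<chi> j. pd j (pd (ix b) d) x $ k) \<bullet> b)" for x
    unfolding Bs by (simp add: sum.reindex[OF inj] ix inner_axis lap_comp_def laplacian_def)
  ultimately show ?thesis unfolding C2_on_def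
    by (intro conjI exI[of _ "\<lambda>b x. \<chi> j. pd j (pd (ix b) d) x $ k"]) auto
qed

lemma C2_u: "C2_on (ball 0 1) (u k) (grad_comp k) (lap_comp k)"
proof -
  have "C2_on (ball 0 1) (\<lambda>x::real^3. 0 * (x \<bullet> x) + 0 \<bullet> x + e3 $ k) (\<lambda>x. (2 * 0) *\<^sub>R x + 0) (\<lambda>x. 2 * 0 * real DIM(real^3))"
    by (rule C2_on_quadratic)
  from C2_on_diff[OF C2_d this] show ?thesis by (simp add: u_def[abs_def])
qed

lemmas C1_d = C2_on_C1[OF C2_d]
lemmas C1_u = C2_on_C1[OF C2_u]

lemma g_eq: "g x = (\<Sum>k\<in>UNIV. (norm (grad_comp k x))\<^sup>2)"
proof -
  have "g x = (\<Sum>i\<in>UNIV. \<Sum>k\<in>UNIV. (pd i d x $ k)\<^sup>2)"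
    unfolding g_def grad_sq_def power2_norm_eq_inner inner_vec_def by (simp add: power2_eq_square)
  also have "\<dots> = (\<Sum>k\<in>UNIV. \<Sum>i\<in>UNIV. (pd i d x $ k)\<^sup>2)" by (rule sum.swap)
  finally show ?thesis
    unfolding grad_comp_def power2_norm_eq_inner inner_vec_def by (simp add: power2_eq_square)
qed

lemma g_nonneg: "0 \<le> g x" by (simp add: g_eq sum_nonneg)
lemma tension_norm_nonneg: "0 \<le> tension_norm x" by (simp add: tension_norm_def)

lemma grad_comp_sq_le: "(norm (grad_comp k x))\<^sup>2 \<le> g x"
  unfolding g_eq by (rule member_le_sum) auto

lemma grad_comp_le: "norm (grad_comp k x) \<le> 1 + g x"
proof -
  have "2 * norm (grad_comp k x) \<le> 1 + (norm (grad_comp k x))\<^sup>2"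
    using sum_squares_bound[of 1 "norm (grad_comp k x)"] by simp
  then show ?thesis using grad_comp_sq_le[of k x] g_nonneg[of x] by linarith
qed

lemma lap_eq: "laplacian d x = tension_vec x - g x *\<^sub>R d x"
  by (simp add: tension_vec_def g_def)

lemma lap_comp_le: "norm x \<le> 1 \<Longrightarrow> \<bar>lap_comp k x\<bar> \<le> g x + tension_norm x"
proof -
  assume x: "norm x \<le> 1"
  have "\<bar>lap_comp k x\<bar> \<le> norm (laplacian d x)" unfolding lap_comp_def by (rule component_le_norm_cart)
  also have "\<dots> \<le> tension_norm x + g x" unfolding lap_eq tension_norm_def
    using norm_triangle_ineq4[of "tension_vec x" "g x *\<^sub>R d x"] norm_d[OF x] g_nonneg[of x] by simp
  finally show ?thesis by simp
qed

lemma cont_grad_comp: "continuous_on (ball 0 1) (grad_comp k)" by (rule C1_on_cont_grad[OF C1_d])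
lemma cont_lap_comp: "continuous_on (ball 0 1) (lap_comp k)" by (rule C2_on_cont_lap[OF C2_d])
lemma cont_g: "continuous_on (ball 0 1) g"
  unfolding g_eq[abs_def] by (intro continuous_intros cont_grad_comp)
lemma cont_db: "continuous_on (ball 0 1) d"
  using cont_d by (rule continuous_on_subset) auto
lemma cont_u: "continuous_on (cball 0 1) (u k)"
  unfolding u_def[abs_def] by (intro continuous_intros cont_d)
lemma cont_lap: "continuous_on (ball 0 1) (laplacian d)"
proof -
  have "laplacian d = (\<lambda>x. \<chi> k. lap_comp k x)" by (simp add: lap_comp_def vec_eq_iff fun_eq_iff)
  then show ?thesis by (simp only:) (intro continuous_on_vec_lambda cont_lap_comp)
qed
lemma cont_tension_vec: "continuous_on (ball 0 1) tension_vec"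
  unfolding tension_vec_def[abs_def] g_def[symmetric] by (intro continuous_intros cont_g cont_lap cont_db)
lemma cont_tension_norm: "continuous_on (ball 0 1) tension_norm"
  unfolding tension_norm_def[abs_def] by (intro continuous_intros cont_tension_vec)

lemma meas [measurable]: "g \<in> borel_measurable ballM" "tension_norm \<in> borel_measurable ballM" "lap_comp k \<in> borel_measurable ballM"
  "grad_comp k \<in> borel_measurable ballM" "u k \<in> borel_measurable ballM" "d \<in> borel_measurable ballM" "tension_vec \<in> borel_measurable ballM"
  using cont_g cont_tension_norm cont_lap_comp cont_grad_comp cont_tension_vec C1_on_cont[OF C1_u] cont_db by (auto intro!: ballM_cont)

lemma integral_bound_from_nn:
  assumes [measurable]: "f \<in> borel_measurable ballM" and f: "\<And>x. 0 \<le> f x"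
    and le: "(\<integral>\<^sup>+ x\<in>ball 0 1. ennreal (f x) \<partial>lborel) \<le> ennreal c" and c: "0 \<le> c"
  shows "integrable ballM f" "integral\<^sup>L ballM f \<le> c"
proof -
  have "(\<integral>\<^sup>+ x. ennreal (f x) \<partial>ballM) \<le> ennreal c"
    using le unfolding ballM_def by (subst nn_integral_restrict_space) auto
  then show i: "integrable ballM f" using f
    by (intro integrableI_nonneg) (auto intro: le_less_trans[OF _ ennreal_less_top])
  show "integral\<^sup>L ballM f \<le> c"
    using \<open>(\<integral>\<^sup>+ x. ennreal (f x) \<partial>ballM) \<le> ennreal c\<close> nn_integral_eq_integral[OF i] f c
    by (simp add: ennreal_le_iff)
qed

lemma g_int: "integrable ballM g" and g_integral: "integral\<^sup>L ballM g \<le> 2 * \<epsilon>\<^sup>2"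
proof -
  have "(\<integral>\<^sup>+ x\<in>ball 0 1. ennreal (g x / 2) \<partial>lborel) \<le> ennreal (\<epsilon>\<^sup>2)"
    using energy by (simp add: energy_def g_def)
  from integral_bound_from_nn[OF _ _ this] have "integrable ballM (\<lambda>x. g x / 2)" "integral\<^sup>L ballM (\<lambda>x. g x / 2) \<le> \<epsilon>\<^sup>2"
    using g_nonneg by auto
  then show "integrable ballM g" "integral\<^sup>L ballM g \<le> 2 * \<epsilon>\<^sup>2"
    using integrable_mult_right[of 2 ballM "\<lambda>x. g x / 2"] by auto
qed

lemma tn2_int: "integrable ballM (\<lambda>x. (tension_norm x)\<^sup>2)" and tn2_integral: "integral\<^sup>L ballM (\<lambda>x. (tension_norm x)\<^sup>2) \<le> \<epsilon>\<^sup>2"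
proof -
  have "(\<integral>\<^sup>+ x\<in>ball 0 1. ennreal ((tension_norm x)\<^sup>2) \<partial>lborel) \<le> ennreal (\<epsilon>\<^sup>2)"
    using tension by (simp add: tension_sq_def tension_norm_def tension_vec_def)
  from integral_bound_from_nn[OF _ _ this] show "integrable ballM (\<lambda>x. (tension_norm x)\<^sup>2)" "integral\<^sup>L ballM (\<lambda>x. (tension_norm x)\<^sup>2) \<le> \<epsilon>\<^sup>2"
    by auto
qed

lemma one_int: "integrable ballM (\<lambda>x. c :: real)"
  by (rule ballM_integrable_bounded[of _ "\<bar>c\<bar>"]) auto

lemma one_integral: "integral\<^sup>L ballM (\<lambda>x. 1 :: real) \<le> 5"
proof -
  have "integral\<^sup>L ballM (\<lambda>x. 1 :: real) \<le> integral\<^sup>L lborel (indicat_real (cball (0::real^3) 1))"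
    by (rule ballM_integral_le) auto
  also have "\<dots> \<le> 5" using measure_cball3_le[of 1 0] by simp
  finally show ?thesis .
qed

lemma tension_norm_le: "tension_norm x \<le> 1 + (tension_norm x)\<^sup>2"
  using sum_squares_bound[of 1 "tension_norm x"] tension_norm_nonneg[of x] by simp

lemma tension_norm_int: "integrable ballM tension_norm"
  by (rule Bochner_Integration.integrable_bound[of _ "\<lambda>x. 1 + (tension_norm x)\<^sup>2"])
     (use tension_norm_le tension_norm_nonneg tn2_int one_int in \<open>auto intro!: AE_I2\<close>)

lemma tension_norm_integral: "integral\<^sup>L ballM tension_norm \<le> 6"
proof -
  have "integral\<^sup>L ballM tension_norm \<le> integral\<^sup>L ballM (\<lambda>x. 1 + (tension_norm x)\<^sup>2)"
    by (rule integral_mono) (use tension_norm_le tension_norm_int tn2_int one_int in auto)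
  also have "\<dots> = integral\<^sup>L ballM (\<lambda>x. 1) + integral\<^sup>L ballM (\<lambda>x. (tension_norm x)\<^sup>2)"
    using tn2_int one_int by simp
  also have "\<dots> \<le> 5 + 1"
    using one_integral tn2_integral eps power_le_one[of \<epsilon> 2] by linarith
  finally show ?thesis by simp
qed

lemma lap_comp_int: "integrable ballM (lap_comp k)"
  by (rule Bochner_Integration.integrable_bound[of _ "\<lambda>x. g x + tension_norm x"])
     (use lap_comp_le g_int tension_norm_int g_nonneg tension_norm_nonneg in \<open>auto intro!: AE_I2\<close>)

lemma grad_comp_sq_int: "integrable ballM (\<lambda>x. (norm (grad_comp k x))\<^sup>2)"
  by (rule Bochner_Integration.integrable_bound[OF g_int])
     (use grad_comp_sq_le g_nonneg in \<open>auto intro!: AE_I2\<close>)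

lemma u_bound: "norm x \<le> 1 \<Longrightarrow> \<bar>u k x\<bar> \<le> 2"
proof -
  assume x: "norm x \<le> 1"
  have "\<bar>u k x\<bar> \<le> norm (d x - e3)" using component_le_norm_cart[of "d x - e3" k] by (simp add: u_def)
  also have "\<dots> \<le> norm (d x) + norm e3" by (rule norm_triangle_ineq4)
  finally show ?thesis using norm_d[OF x] norm_e3 by simp
qed

lemma u_sphere: "norm x = 1 \<Longrightarrow> u k x = 0"
  by (simp add: u_def d_sphere)

text \<open>The boundary condition enters here: continuity up to the sphere and zero values on it
  keep the set where a component is at least \<open>a\<close> strictly inside. Hence truncated
  components of \<open>d - e3\<close> have compact support in the open ball.\<close>

lemma u_level_compact:
  assumes "a > 0"
  shows "compact {x. norm x \<le> 1 \<and> a \<le> \<bar>u k x\<bar>}" "{x. norm x \<le> 1 \<and> a \<le> \<bar>u k x\<bar>} \<subseteq> ball 0 1"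
proof -
  have "closed (cball 0 1 \<inter> (\<lambda>x. \<bar>u k x\<bar>) -` {a..})"
    by (intro continuous_closed_preimage continuous_intros cont_u) auto
  then have "compact (cball 0 1 \<inter> (cball 0 1 \<inter> (\<lambda>x. \<bar>u k x\<bar>) -` {a..}))"
    by (intro compact_Int_closed) auto
  moreover have "cball 0 1 \<inter> (cball 0 1 \<inter> (\<lambda>x. \<bar>u k x\<bar>) -` {a..}) = {x. norm x \<le> 1 \<and> a \<le> \<bar>u k x\<bar>}" by auto
  ultimately show "compact {x. norm x \<le> 1 \<and> a \<le> \<bar>u k x\<bar>}" by simp
  show "{x. norm x \<le> 1 \<and> a \<le> \<bar>u k x\<bar>} \<subseteq> ball 0 1"
    using u_sphere assms by (force simp: less_le)
qed

text \<open>Needed because truncating \<open>u k\<close> near zero, which makes it compactly supported, discards its gradient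
  on the zero set.\<close>

lemma null_gradient: "AE x in ballM. u k x = 0 \<longrightarrow> grad_comp k x = 0"
proof -
  \<comment> \<open>The weight is an interior cutoff, and these cutoffs exhaust the ball as
    \<open>m\<close> grows. Starting at \<open>Suc (Suc m)\<close> makes the level less than 1, so
    that the square root in the support radius is that of a positive number.\<close>
  have "AE x in ballM. trunc (1 / real (Suc (Suc m))) (1 - x \<bullet> x) * (if u k x = 0 then (norm (grad_comp k x))\<^sup>2 else 0) = 0" for m
  proof -
    define b where "b = 1 / real (Suc (Suc m))"
    have b: "0 < b" "b < 1" by (auto simp: b_def)
    define \<eta> where "\<eta> x = trunc b (1 - x \<bullet> x)" for x :: "real^3"
    have "C1_on UNIV (\<lambda>x::real^3. (-1) * (x \<bullet> x) + 0 \<bullet> x + 1) (\<lambda>x. (2 * (-1)) *\<^sub>R x + 0)"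
      by (rule C2_on_C1[OF C2_on_quadratic])
    then have "C1_on UNIV (\<lambda>x::real^3. 1 - x \<bullet> x) (\<lambda>x. (- 2) *\<^sub>R x)" by simp
    from C1_on_of_deriv[OF this DERIV_trunc[OF b(1)] trunc_cont(2)[OF b(1)]]
    obtain E where E: "C1_on UNIV \<eta> E" unfolding \<eta>_def by blast
    have ce: "continuous_on UNIV \<eta>" "continuous_on UNIV E" using C1_on_cont[OF E] C1_on_cont_grad[OF E] by auto
    have [measurable]: "\<eta> \<in> borel_measurable ballM" "E \<in> borel_measurable ballM"
      using ce by (auto intro!: ballM_borel borel_measurable_continuous_onI)
    have en: "0 \<le> \<eta> x" for x using trunc_bounds(1)[OF b(1)] by (simp add: \<eta>_def)
    define a where "a n = 1 / real (Suc n)" for n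
    have a: "a n > 0" for n by (simp add: a_def)
    \<comment> \<open>The functions \<open>p n\<close> tend to zero uniformly while their
      derivatives tend to the indicator of the point zero. Testing with \<open>p n (u k x)\<close>
      therefore kills every term in the limit except the gradient on the zero set.\<close>
    define p where "p n t = a n * arctan (t / a n)" for n t
    define p' where "p' n t = 1 / (1 + (t / a n)\<^sup>2)" for n t
    have dp: "(p n has_real_derivative p' n t) (at t)" for n t
      unfolding p_def[abs_def] p'_def using a[of n]
      by (auto intro!: derivative_eq_intros simp: divide_simps)
    have cp': "continuous_on UNIV (p' n)" for n
      unfolding p'_def[abs_def] using a[of n]
      by (intro continuous_intros) (auto simp: add_nonneg_eq_0_iff)
    have cp: "continuous_on UNIV (p n)" for n
      using dp DERIV_isCont by (blast intro: continuous_at_imp_continuous_on)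
    have [measurable]: "p n \<in> borel_measurable borel" "p' n \<in> borel_measurable borel" for n
      using cp cp' by (auto intro!: borel_measurable_continuous_onI)
    have pb: "\<bar>p n t\<bar> \<le> 2 * a n" for n t
    proof -
      have "\<bar>arctan (t / a n)\<bar> \<le> 2" using arctan_bounded[of "t / a n"] pi_less_4 by linarith
      then show ?thesis using mult_left_mono[of "\<bar>arctan (t / a n)\<bar>" 2 "a n"] a[of n] by (simp add: p_def abs_mult)
    qed
    have a1: "a n \<le> 1" for n by (simp add: a_def)
    have p'b: "0 \<le> p' n t" "p' n t \<le> 1" for n t using zero_le_power2[of "t / a n"]
      by (simp_all add: p'_def divide_le_eq_1 add_pos_nonneg)
    let ?F = "\<lambda>n x. (\<eta> x * p n (u k x)) * lap_comp k x + (\<eta> x *\<^sub>R (p' n (u k x) *\<^sub>R grad_comp k x) + p n (u k x) *\<^sub>R E x) \<bullet> grad_comp k x"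
    have zero: "integral\<^sup>L ballM (?F n) = 0" for n
      unfolding ballM_def
    proof (rule green_first(2)[OF _ C2_u open_ball])
      show "C1_on (ball 0 1) (\<lambda>x. \<eta> x * p n (u k x)) (\<lambda>x. \<eta> x *\<^sub>R (p' n (u k x) *\<^sub>R grad_comp k x) + p n (u k x) *\<^sub>R E x)"
        by (intro C1_on_mult C1_on_subset[OF E subset_UNIV] C1_on_of_deriv[OF C1_u dp cp'])
      show "compact (cball (0::real^3) (sqrt (1 - b)))" by simp
      show "cball (0::real^3) (sqrt (1 - b)) \<subseteq> ball 0 1"
      proof -
        have "sqrt (1 - b) < 1" using b by (simp add: real_sqrt_less_iff[of _ 1, simplified])
        then show ?thesis by (simp only: cball_subset_ball_iff dist_self) simp
      qed
      fix x :: "real^3" assume "x \<in> ball 0 1 - cball 0 (sqrt (1 - b))"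
      then have "sqrt (1 - b) < norm x" by simp
      then have "(sqrt (1 - b))\<^sup>2 \<le> (norm x)\<^sup>2" using b by (intro power_mono) auto
      then have "1 - x \<bullet> x \<le> b" using b by (simp add: power2_norm_eq_inner)
      then have "\<eta> x = 0" unfolding \<eta>_def by (rule trunc_small(1)[OF b(1)])
      then show "\<eta> x * p n (u k x) = 0 \<or> grad_comp k x = 0" by simp
    qed
    obtain C where C: "C \<ge> 0" "\<And>x. norm x \<le> 1 \<Longrightarrow> norm (\<eta> x) \<le> C" by (rule ballM_bounded_cont[OF ce(1)]) blast
    obtain C' where C': "C' \<ge> 0" "\<And>x. norm x \<le> 1 \<Longrightarrow> norm (E x) \<le> C'" by (rule ballM_bounded_cont[OF ce(2)]) blast
    let ?L = "\<lambda>x. \<eta> x * (if u k x = 0 then (norm (grad_comp k x))\<^sup>2 else 0)"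
    let ?w = "\<lambda>x. 2 * C * \<bar>lap_comp k x\<bar> + C * g x + 2 * C' * (1 + g x)"
    have iw: "integrable ballM ?w" using lap_comp_int g_int one_int by auto
    have bd: "AE x in ballM. norm (?F n x) \<le> ?w x" for n
    proof (rule AE_I2)
      fix x assume "x \<in> space ballM"
      then have x: "norm x \<le> 1" by simp
      have p2: "\<bar>p n (u k x)\<bar> \<le> 2" using pb[of n "u k x"] a1[of n] by linarith
      have "\<bar>\<eta> x * p n (u k x) * lap_comp k x\<bar> \<le> C * 2 * \<bar>lap_comp k x\<bar>"
        unfolding abs_mult using C(2)[OF x] p2 C(1) by (intro mult_mono) auto
      moreover have "\<bar>\<eta> x * p' n (u k x) * (grad_comp k x \<bullet> grad_comp k x)\<bar> \<le> C * 1 * g x"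
        unfolding abs_mult using C(2)[OF x] p'b[of n "u k x"] C(1) grad_comp_sq_le[of k x]
        by (intro mult_mono) (auto simp: power2_norm_eq_inner)
      moreover have "\<bar>p n (u k x) * (E x \<bullet> grad_comp k x)\<bar> \<le> 2 * (C' * (1 + g x))"
      proof -
        have "\<bar>E x \<bullet> grad_comp k x\<bar> \<le> norm (E x) * norm (grad_comp k x)" by (rule Cauchy_Schwarz_ineq2)
        also have "\<dots> \<le> C' * (1 + g x)" using C'(2)[OF x] grad_comp_le[of k x] C'(1) by (intro mult_mono) auto
        finally show ?thesis unfolding abs_mult using p2 by (intro mult_mono) auto
      qed
      ultimately show "norm (?F n x) \<le> ?w x" by (simp add: inner_add_left algebra_simps)
    qed
    have lim: "(\<lambda>n. ?F n x) \<longlonglongrightarrow> ?L x" for x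
    proof -
      have 1: "(\<lambda>n. p n (u k x)) \<longlonglongrightarrow> 0"
      proof (rule Lim_null_comparison)
        show "(\<lambda>n. 2 * a n) \<longlonglongrightarrow> 0" unfolding a_def
          using tendsto_mult[OF tendsto_const inv_Suc_tendsto, of 2] by simp
      qed (use pb in auto)
      have 2: "(\<lambda>n. p' n (u k x)) \<longlonglongrightarrow> (if u k x = 0 then 1 else 0)"
      proof (cases "u k x = 0")
        case False
        have "(\<lambda>n. (a n)\<^sup>2 / ((a n)\<^sup>2 + (u k x)\<^sup>2)) \<longlonglongrightarrow> 0\<^sup>2 / (0\<^sup>2 + (u k x)\<^sup>2)"
          unfolding a_def using False by (intro tendsto_intros inv_Suc_tendsto) auto
        moreover have "(a n)\<^sup>2 / ((a n)\<^sup>2 + (u k x)\<^sup>2) = p' n (u k x)" for n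
          using a[of n] by (simp add: p'_def power_divide field_simps)
        ultimately show ?thesis using False by simp
      qed (simp add: p'_def)
      have eqF: "?F n x = (\<eta> x * p n (u k x)) * lap_comp k x + (\<eta> x * (p' n (u k x) * (grad_comp k x \<bullet> grad_comp k x)) + p n (u k x) * (E x \<bullet> grad_comp k x))" for n
        by (simp add: inner_add_left)
      have eqL: "?L x = (\<eta> x * 0) * lap_comp k x + (\<eta> x * ((if u k x = 0 then 1 else 0) * (grad_comp k x \<bullet> grad_comp k x)) + 0 * (E x \<bullet> grad_comp k x))"
        by (simp add: power2_norm_eq_inner)
      show ?thesis unfolding eqF eqL by (intro tendsto_intros 1 2)
    qed
    have mL: "?L \<in> borel_measurable ballM" by measurable
    have mF: "?F n \<in> borel_measurable ballM" for n by measurable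
    have iL: "integrable ballM ?L"
      by (rule integrable_dominated_convergence[OF mL mF iw AE_I2[OF lim] bd])
    have "(\<lambda>n. integral\<^sup>L ballM (?F n)) \<longlonglongrightarrow> integral\<^sup>L ballM ?L"
      by (rule integral_dominated_convergence[OF mL mF iw AE_I2[OF lim] bd])
    then have "integral\<^sup>L ballM ?L = 0" unfolding zero by (simp add: LIMSEQ_const_iff)
    then have "AE x in ballM. ?L x = 0"
      using integral_nonneg_eq_0_iff_AE[OF iL] en by auto
    then show ?thesis unfolding \<eta>_def b_def .
  qed
  then have "AE x in ballM. \<forall>m. trunc (1 / real (Suc (Suc m))) (1 - x \<bullet> x) * (if u k x = 0 then (norm (grad_comp k x))\<^sup>2 else 0) = 0"
    by (subst AE_all_countable) blast
  then show ?thesis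
  proof (rule AE_mp, intro AE_I2 impI)
    fix x assume x: "x \<in> space ballM" and u0: "u k x = 0"
      and H: "\<forall>m. trunc (1 / real (Suc (Suc m))) (1 - x \<bullet> x) * (if u k x = 0 then (norm (grad_comp k x))\<^sup>2 else 0) = 0"
    have "(norm x)\<^sup>2 < 1" using x by (simp add: power_less_one_iff)
    then have p: "1 - x \<bullet> x > 0" by (simp add: power2_norm_eq_inner)
    obtain m where m: "2 * (1 / real (Suc m)) < 1 - x \<bullet> x"
      using eventually_happens[OF ev_inv_Suc_less[OF p]] by auto
    have "1 / real (Suc (Suc m)) \<le> 1 / real (Suc m)" by (simp add: frac_le)
    then have "0 < trunc (1 / real (Suc (Suc m))) (1 - x \<bullet> x)"
      using trunc_bounds(3)[of "1 / real (Suc (Suc m))" "1 - x \<bullet> x"] m by (simp del: of_nat_Suc)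
    then show "grad_comp k x = 0" using H[rule_format, of m] u0 by auto
  qed
qed

text \<open>With \<open>w\<close> the \<open>k\<close>-th component of \<open>d - c\<close>,
  subtract Green's identity for \<open>w * w / 2\<close> against \<open>\<eta>\<close> from the one
  for \<open>\<eta> * w\<close> against \<open>w\<close>; the mixed gradient terms cancel. Boundary
  contributions are absent either because \<open>\<eta>\<close> has compact support or because
  \<open>c = e3\<close> makes \<open>w\<close> vanish on the sphere.\<close>

lemma local_energy_identity:
  assumes H: "C2_on UNIV \<eta> G L"
    and K: "(compact K \<and> K \<subseteq> ball 0 1 \<and> (\<forall>y\<in>ball 0 1 - K. \<eta> y = 0 \<and> G y = 0)) \<or> c = e3"
  shows "integrable ballM (\<lambda>x. \<eta> x * (d x $ k - c $ k) * lap_comp k x + \<eta> x * (norm (grad_comp k x))\<^sup>2 - (d x $ k - c $ k)\<^sup>2 / 2 * L x)"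
    (is "integrable ballM ?I")
    and "integral\<^sup>L ballM (\<lambda>x. \<eta> x * (d x $ k - c $ k) * lap_comp k x + \<eta> x * (norm (grad_comp k x))\<^sup>2 - (d x $ k - c $ k)\<^sup>2 / 2 * L x) = 0"
proof -
  have H1: "C1_on UNIV \<eta> G" by (rule C2_on_C1[OF H])
  have HB: "C2_on (ball 0 1) \<eta> G L" by (rule C2_on_subset[OF H]) simp
  \<comment> \<open>Both cases at once: \<open>p\<close> is a plain shift when \<open>\<eta>\<close>
    has compact support and \<open>odd_trunc\<close> when \<open>c = e3\<close>. The mixed terms
    cancel only where \<open>p' = 1\<close>, so they are kept.\<close>
  have key: "integrable ballM (\<lambda>x. \<eta> x * p (f x) * lap_comp k x + \<eta> x * p' (f x) * (norm (grad_comp k x))\<^sup>2 + p (f x) * (G x \<bullet> grad_comp k x)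
           - (p (f x))\<^sup>2 / 2 * L x - p (f x) * p' (f x) * (grad_comp k x \<bullet> G x))"
      "integral\<^sup>L ballM (\<lambda>x. \<eta> x * p (f x) * lap_comp k x + \<eta> x * p' (f x) * (norm (grad_comp k x))\<^sup>2 + p (f x) * (G x \<bullet> grad_comp k x)
           - (p (f x))\<^sup>2 / 2 * L x - p (f x) * p' (f x) * (grad_comp k x \<bullet> G x)) = 0"
    if p: "\<And>t. (p has_real_derivative p' t) (at t)" "continuous_on UNIV p'"
      and f: "C2_on (ball 0 1) f (grad_comp k) (lap_comp k)"
      and K: "compact K" "K \<subseteq> ball 0 1" "\<And>y. y \<in> ball 0 1 - K \<Longrightarrow> (\<eta> y = 0 \<and> G y = 0) \<or> p (f y) = 0" for p p' f K
  proof -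
    note f1 = C2_on_C1[OF f]
    have pc: "C1_on (ball 0 1) (\<lambda>x. p (f x)) (\<lambda>x. p' (f x) *\<^sub>R grad_comp k x)"
      by (rule C1_on_of_deriv[OF f1 p])
    have c1: "C1_on (ball 0 1) (\<lambda>x. \<eta> x * p (f x)) (\<lambda>x. \<eta> x *\<^sub>R (p' (f x) *\<^sub>R grad_comp k x) + p (f x) *\<^sub>R G x)"
      by (rule C1_on_mult[OF C1_on_subset[OF H1 subset_UNIV] pc])
    have c2: "C1_on (ball 0 1) (\<lambda>x. p (f x) * (p (f x) * (1/2))) (\<lambda>x. p (f x) *\<^sub>R (p (f x) *\<^sub>R 0 + (1/2) *\<^sub>R p' (f x) *\<^sub>R grad_comp k x) + (p (f x) * (1/2)) *\<^sub>R p' (f x) *\<^sub>R grad_comp k x)"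
      by (intro C1_on_mult pc C1_on_const)
    have z1: "\<And>x. x \<in> ball 0 1 - K \<Longrightarrow> \<eta> x * p (f x) = 0 \<or> grad_comp k x = 0" using K(3) by auto
    have z2: "\<And>x. x \<in> ball 0 1 - K \<Longrightarrow> p (f x) * (p (f x) * (1/2)) = 0 \<or> G x = 0" using K(3) by auto
    note A = green_first[OF c1 f open_ball K(1,2) z1, folded ballM_def]
    note B = green_first[OF c2 HB open_ball K(1,2) z2, folded ballM_def]
    have eq: "\<eta> x * p (f x) * lap_comp k x + \<eta> x * p' (f x) * (norm (grad_comp k x))\<^sup>2 + p (f x) * (G x \<bullet> grad_comp k x)
           - (p (f x))\<^sup>2 / 2 * L x - p (f x) * p' (f x) * (grad_comp k x \<bullet> G x) = (\<eta> x * p (f x) * lap_comp k x + (\<eta> x *\<^sub>R (p' (f x) *\<^sub>R grad_comp k x) + p (f x) *\<^sub>R G x) \<bullet> grad_comp k x)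
      - (p (f x) * (p (f x) * (1/2)) * L x + (p (f x) *\<^sub>R (p (f x) *\<^sub>R 0 + (1/2) *\<^sub>R p' (f x) *\<^sub>R grad_comp k x) + (p (f x) * (1/2)) *\<^sub>R p' (f x) *\<^sub>R grad_comp k x) \<bullet> G x)" for x
      unfolding power2_norm_eq_inner inner_add_left inner_scaleR_left inner_zero_left
      by (simp add: power2_eq_square algebra_simps)
    show "integrable ballM (\<lambda>x. \<eta> x * p (f x) * lap_comp k x + \<eta> x * p' (f x) * (norm (grad_comp k x))\<^sup>2 + p (f x) * (G x \<bullet> grad_comp k x)
           - (p (f x))\<^sup>2 / 2 * L x - p (f x) * p' (f x) * (grad_comp k x \<bullet> G x))"
      "integral\<^sup>L ballM (\<lambda>x. \<eta> x * p (f x) * lap_comp k x + \<eta> x * p' (f x) * (norm (grad_comp k x))\<^sup>2 + p (f x) * (G x \<bullet> grad_comp k x)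
           - (p (f x))\<^sup>2 / 2 * L x - p (f x) * p' (f x) * (grad_comp k x \<bullet> G x)) = 0"
      unfolding eq[abs_def] using A B by auto
  qed
  have goal: "integrable ballM ?I \<and> integral\<^sup>L ballM ?I = 0"
    using K
  proof
    assume K: "compact K \<and> K \<subseteq> ball 0 1 \<and> (\<forall>y\<in>ball 0 1 - K. \<eta> y = 0 \<and> G y = 0)"
    have e: "?I = (\<lambda>x. \<eta> x * (d x $ k - c $ k) * lap_comp k x + \<eta> x * 1 * (norm (grad_comp k x))\<^sup>2 + (d x $ k - c $ k) * (G x \<bullet> grad_comp k x)
           - (d x $ k - c $ k)\<^sup>2 / 2 * L x - (d x $ k - c $ k) * 1 * (grad_comp k x \<bullet> G x))"
      by (simp add: inner_commute algebra_simps)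
    show ?thesis unfolding e
      by (intro conjI; rule key[where p="\<lambda>t. t - c $ k" and p'="\<lambda>t. 1" and f="\<lambda>x. d x $ k" and K=K, OF _ _ C2_d])
         (use K in \<open>auto intro!: derivative_eq_intros\<close>)
  next
    assume c: "c = e3"
    define a where "a n = 1 / real (Suc n)" for n
    have a: "a n > 0" for n by (simp add: a_def)
    let ?F = "\<lambda>n x. \<eta> x * odd_trunc (a n) (u k x) * lap_comp k x + \<eta> x * odd_trunc1 (a n) (u k x) * (norm (grad_comp k x))\<^sup>2 + odd_trunc (a n) (u k x) * (G x \<bullet> grad_comp k x)
           - (odd_trunc (a n) (u k x))\<^sup>2 / 2 * L x - odd_trunc (a n) (u k x) * odd_trunc1 (a n) (u k x) * (grad_comp k x \<bullet> G x)"
    have zero: "integral\<^sup>L ballM (?F n) = 0" for n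
      by (rule key(2)[where K="{x. norm x \<le> 1 \<and> a n \<le> \<bar>u k x\<bar>}", OF DERIV_odd_trunc[OF a] odd_trunc_cont(2)[OF a] C2_u u_level_compact[OF a]])
         (auto intro!: odd_trunc_small(1)[OF a])
    have ce: "continuous_on UNIV \<eta>" "continuous_on UNIV G" "continuous_on UNIV L"
      using C1_on_cont[OF H1] C1_on_cont_grad[OF H1] C2_on_cont_lap[OF H] by auto
    have [measurable]: "\<eta> \<in> borel_measurable ballM" "G \<in> borel_measurable ballM" "L \<in> borel_measurable ballM"
      using ce by (auto intro!: ballM_borel borel_measurable_continuous_onI)
    obtain C1 where C1: "C1 \<ge> 0" "\<And>x. norm x \<le> 1 \<Longrightarrow> norm (\<eta> x) \<le> C1" by (rule ballM_bounded_cont[OF ce(1)]) blast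
    obtain C2 where C2: "C2 \<ge> 0" "\<And>x. norm x \<le> 1 \<Longrightarrow> norm (G x) \<le> C2" by (rule ballM_bounded_cont[OF ce(2)]) blast
    obtain C3 where C3: "C3 \<ge> 0" "\<And>x. norm x \<le> 1 \<Longrightarrow> norm (L x) \<le> C3" by (rule ballM_bounded_cont[OF ce(3)]) blast
    have [measurable]: "odd_trunc (a n) \<in> borel_measurable borel" "odd_trunc1 (a n) \<in> borel_measurable borel" for n
      using odd_trunc_cont[OF a] by (auto intro!: borel_measurable_continuous_onI)
    let ?w = "\<lambda>x. C1 * 2 * \<bar>lap_comp k x\<bar> + C1 * g x + 4 * (C2 * (1 + g x)) + 2 * C3"
    have iw: "integrable ballM ?w" using lap_comp_int g_int one_int by auto
    have bd: "AE x in ballM. norm (?F n x) \<le> ?w x" for n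
    proof (rule AE_I2)
      fix x assume "x \<in> space ballM"
      then have x: "norm x \<le> 1" by simp
      have o: "\<bar>odd_trunc (a n) (u k x)\<bar> \<le> 2" using odd_trunc_bounds(1)[OF a, of n "u k x"] u_bound[OF x, of k] by linarith
      have o1: "\<bar>odd_trunc1 (a n) (u k x)\<bar> \<le> 1" using odd_trunc1_bounds[OF a, of n "u k x"] by simp
      have "\<bar>G x \<bullet> grad_comp k x\<bar> \<le> norm (G x) * norm (grad_comp k x)" by (rule Cauchy_Schwarz_ineq2)
      also have "\<dots> \<le> C2 * (1 + g x)" using C2(2)[OF x] grad_comp_le[of k x] C2(1) by (intro mult_mono) auto
      finally have cs: "\<bar>G x \<bullet> grad_comp k x\<bar> \<le> C2 * (1 + g x)" .
      have "\<bar>\<eta> x * odd_trunc (a n) (u k x) * lap_comp k x\<bar> \<le> C1 * 2 * \<bar>lap_comp k x\<bar>"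
        unfolding abs_mult using C1(2)[OF x] o C1(1) by (intro mult_mono) auto
      moreover have "\<bar>\<eta> x * odd_trunc1 (a n) (u k x) * (norm (grad_comp k x))\<^sup>2\<bar> \<le> C1 * 1 * g x"
        unfolding abs_mult using C1(2)[OF x] o1 C1(1) grad_comp_sq_le[of k x] by (intro mult_mono) auto
      moreover have "\<bar>odd_trunc (a n) (u k x) * (G x \<bullet> grad_comp k x)\<bar> \<le> 2 * (C2 * (1 + g x))"
        unfolding abs_mult using o cs by (intro mult_mono) auto
      moreover have "\<bar>odd_trunc (a n) (u k x) * odd_trunc1 (a n) (u k x) * (grad_comp k x \<bullet> G x)\<bar> \<le> 2 * 1 * (C2 * (1 + g x))"
        unfolding abs_mult inner_commute[of "grad_comp k x"] using o o1 cs by (intro mult_mono) auto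
      moreover have "\<bar>(odd_trunc (a n) (u k x))\<^sup>2 / 2 * L x\<bar> \<le> 2 * C3"
      proof -
        have "(odd_trunc (a n) (u k x))\<^sup>2 \<le> 2\<^sup>2" using o by (simp add: abs_le_square_iff[of _ 2, simplified])
        then show ?thesis unfolding abs_mult using C3(2)[OF x] by (intro mult_mono) auto
      qed
      ultimately show "norm (?F n x) \<le> ?w x" by simp
    qed
    \<comment> \<open>Convergence holds almost everywhere only: the truncated slope tends to 0 on
      the zero set of \<open>u k\<close>, where \<open>null_gradient\<close> makes the gradient
      vanish as well.\<close>
    have lim: "AE x in ballM. (\<lambda>n. ?F n x) \<longlonglongrightarrow> ?I x"
      using null_gradient[of k]
    proof eventually_elim
      fix x assume u0: "u k x = 0 \<longrightarrow> grad_comp k x = 0"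
      let ?i = "if u k x = 0 then 0 else 1 :: real"
      have I: "?I x = \<eta> x * u k x * lap_comp k x + \<eta> x * ?i * (norm (grad_comp k x))\<^sup>2 + u k x * (G x \<bullet> grad_comp k x)
           - (u k x)\<^sup>2 / 2 * L x - u k x * ?i * (grad_comp k x \<bullet> G x)"
        using u0 by (cases "u k x = 0") (auto simp: c u_def inner_commute algebra_simps)
      show "(\<lambda>n. ?F n x) \<longlonglongrightarrow> ?I x"
        unfolding I a_def by (intro tendsto_intros odd_trunc_tendsto odd_trunc1_tendsto) auto
    qed
    have [measurable]: "(\<lambda>x. d x $ k) \<in> borel_measurable ballM" by (rule ballM_cont[OF C1_on_cont[OF C1_d]])
    have [measurable]: "(\<lambda>x. d x $ k - c $ k) \<in> borel_measurable ballM" by simp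
    have mI: "?I \<in> borel_measurable ballM" by measurable
    have mF: "?F n \<in> borel_measurable ballM" for n by measurable
    have "integrable ballM ?I"
      by (rule integrable_dominated_convergence[OF mI mF iw lim bd])
    moreover have "(\<lambda>n. integral\<^sup>L ballM (?F n)) \<longlonglongrightarrow> integral\<^sup>L ballM ?I"
      by (rule integral_dominated_convergence[OF mI mF iw lim bd])
    then have "integral\<^sup>L ballM ?I = 0" unfolding zero by (simp add: LIMSEQ_const_iff)
    ultimately show ?thesis by simp
  qed
  then show "integrable ballM ?I" "integral\<^sup>L ballM ?I = 0" by auto
qed

lemma ballM_sdist_meas [measurable]: "(\<lambda>y. sdist \<kappa> x y) \<in> borel_measurable ballM"
  by (rule ballM_borel[OF sdist_meas])

text \<open>Young's inequality splits the product into the squared tension, of integral at most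
  \<open>\<epsilon>\<^sup>2\<close>, and \<open>1 / sdist\<^sup>2\<close>, of integral at most
  \<open>40 * r\<close>. The weight \<open>sqrt r / \<epsilon>\<close> balances the two and gives
  \<open>(1 / 2 + 20) * \<epsilon> * sqrt r\<close>. Here the exponent one half of the Holder bound
  originates.\<close>

lemma tension_near:
  assumes k: "\<kappa> > 0" and r: "r > 0"
  shows "integral\<^sup>L ballM (\<lambda>y. if sdist \<kappa> x y \<le> r then tension_norm y / sdist \<kappa> x y else 0) \<le> 21 * \<epsilon> * sqrt r"
    and "integrable ballM (\<lambda>y. if sdist \<kappa> x y \<le> r then tension_norm y / sdist \<kappa> x y else 0)"
proof -
  let ?h = "\<lambda>y. if sdist \<kappa> x y \<le> r then tension_norm y / sdist \<kappa> x y else 0"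
  let ?q = "\<lambda>y. indicator (cball x r) y / (sdist \<kappa> x y)\<^sup>2 :: real"
  define lam where "lam = sqrt r / \<epsilon>"
  have l: "lam > 0" using r eps by (simp add: lam_def)
  have [measurable]: "?q \<in> borel_measurable ballM"
    using integral_inv_sdist_sq(1)[OF k r, of x] by (intro ballM_borel) auto
  have qi: "integrable ballM ?q"
  proof (rule ballM_integrable_bounded)
    show "\<bar>?q y\<bar> \<le> 1 / \<kappa>\<^sup>2" for y
      using k sdist_ge(2)[of \<kappa>] by (auto simp: indicator_def intro!: frac_le power_mono)
  qed measurable
  have qI: "integral\<^sup>L ballM ?q \<le> 40 * r"
    by (rule order_trans[OF ballM_integral_le[OF integral_inv_sdist_sq(1)[OF k r]] integral_inv_sdist_sq(2)[OF k r]]) auto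
  have half: "2 * a \<le> b \<Longrightarrow> a \<le> b / 2" for a b :: real by simp
  have le: "?h y \<le> lam / 2 * (tension_norm y)\<^sup>2 + 1 / (2 * lam) * ?q y" for y
  proof (cases "sdist \<kappa> x y \<le> r")
    case True
    then have "y \<in> cball x r" using sdist_ge(1)[of \<kappa> y x] k by (simp add: dist_norm norm_minus_commute)
    moreover have "2 * (sqrt lam * tension_norm y) * (1 / (sqrt lam * sdist \<kappa> x y)) \<le> (sqrt lam * tension_norm y)\<^sup>2 + (1 / (sqrt lam * sdist \<kappa> x y))\<^sup>2"
      by (rule sum_squares_bound)
    then have "2 * (tension_norm y / sdist \<kappa> x y) \<le> lam * (tension_norm y)\<^sup>2 + 1 / (lam * (sdist \<kappa> x y)\<^sup>2)"
      using l by (simp add: power_mult_distrib power_divide)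
    then have "tension_norm y / sdist \<kappa> x y \<le> (lam * (tension_norm y)\<^sup>2 + 1 / (lam * (sdist \<kappa> x y)\<^sup>2)) / 2"
      using half[of "tension_norm y / sdist \<kappa> x y"] by blast
    moreover have "lam / 2 * (tension_norm y)\<^sup>2 + 1 / (2 * lam) * (1 / (sdist \<kappa> x y)\<^sup>2) = (lam * (tension_norm y)\<^sup>2 + 1 / (lam * (sdist \<kappa> x y)\<^sup>2)) / 2"
      by (simp add: add_divide_distrib)
    ultimately show ?thesis using True by (simp only: if_True indicator_simps)
  qed (use l in auto)
  have n: "0 \<le> ?h y" for y using tension_norm_nonneg sdist_pos[OF k] by (auto simp: less_imp_le)
  have ri: "integrable ballM (\<lambda>y. lam / 2 * (tension_norm y)\<^sup>2 + 1 / (2 * lam) * ?q y)"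
    using tn2_int qi by (intro Bochner_Integration.integrable_add integrable_mult_right)
  have mh: "?h \<in> borel_measurable ballM" by measurable
  show hi: "integrable ballM ?h"
    by (rule Bochner_Integration.integrable_bound[OF ri mh], rule AE_I2) (use le n in \<open>smt (verit) real_norm_def\<close>)
  have "integral\<^sup>L ballM ?h \<le> integral\<^sup>L ballM (\<lambda>y. lam / 2 * (tension_norm y)\<^sup>2 + 1 / (2 * lam) * ?q y)"
    by (rule integral_mono[OF hi ri le])
  also have "\<dots> = lam / 2 * integral\<^sup>L ballM (\<lambda>y. (tension_norm y)\<^sup>2) + 1 / (2 * lam) * integral\<^sup>L ballM ?q"
    by (simp only: Bochner_Integration.integral_add[OF integrable_mult_right[OF tn2_int] integrable_mult_right[OF qi]]
        integral_mult_right_zero)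
  also have "\<dots> \<le> lam / 2 * \<epsilon>\<^sup>2 + 1 / (2 * lam) * (40 * r)"
    using l tn2_integral qI by (intro add_mono mult_left_mono) auto
  also have "\<dots> = sqrt r * \<epsilon> / 2 + 20 * \<epsilon> * (r / sqrt r)"
    using eps r by (simp add: lam_def power2_eq_square field_simps)
  also have "\<dots> = 41 / 2 * (\<epsilon> * sqrt r)" using r by (simp add: real_div_sqrt)
  also have "\<dots> \<le> 21 * (\<epsilon> * sqrt r)" using eps r by (intro mult_right_mono) auto
  finally show "integral\<^sup>L ballM ?h \<le> 21 * \<epsilon> * sqrt r" by simp
qed

text \<open>Since \<open>d x\<close> and \<open>c\<close> are both unit vectors,
  \<open>(d x - c) \<bullet> d x\<close> is half the squared distance. The nonlinear term of the
  equation thus becomes quadratic in the deviation from \<open>c\<close>.\<close>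

lemma w_dot_lap:
  assumes "norm x \<le> 1" "norm c = 1"
  shows "(\<Sum>k\<in>UNIV. (d x $ k - c $ k) * lap_comp k x) = (d x - c) \<bullet> tension_vec x - g x * (norm (d x - c))\<^sup>2 / 2"
proof -
  have "(\<Sum>k\<in>UNIV. (d x $ k - c $ k) * lap_comp k x) = (d x - c) \<bullet> laplacian d x"
    by (simp add: inner_vec_def lap_comp_def)
  also have "\<dots> = (d x - c) \<bullet> tension_vec x - g x * ((d x - c) \<bullet> d x)"
    by (simp add: lap_eq inner_diff_right)
  also have "(d x - c) \<bullet> d x = (norm (d x - c))\<^sup>2 / 2"
    using norm_d[OF assms(1)] assms(2) unfolding norm_eq_1 power2_norm_eq_inner
    by (simp add: inner_diff_left inner_diff_right inner_commute)
  finally show ?thesis by simp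
qed

text \<open>As the deviation from \<open>c\<close> is at most 1, the nonlinear term takes away at
  most half of the weighted energy. What bounds the other half is the Laplacian of the kernel times
  the squared deviation, and the mass of \<open>etaN\<close> is independent of the scale; hence the
  power \<open>\<omega>\<^sup>2\<close>.\<close>

lemma caccioppoli:
  assumes k: "\<kappa> > 0" and s: "s > 0" and x: "norm x < 1" and om: "0 \<le> \<omega>" "\<omega> \<le> 1/2"
    and osc: "\<And>y. norm y \<le> 1 \<Longrightarrow> norm (y - x) \<le> 2 * s \<Longrightarrow> norm (d y - d x) \<le> \<omega>"
  shows "integral\<^sup>L ballM (\<lambda>y. if sdist \<kappa> x y \<le> s / 2 then (g y + tension_norm y) / sdist \<kappa> x y else 0) \<le> 1280 * \<omega>\<^sup>2 + 141 * \<epsilon> * sqrt s"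
proof -
  \<comment> \<open>The kernel then vanishes beyond distance \<open>2 * s\<close>, where the
    oscillation hypothesis ends, and is at least half of \<open>1 / sdist\<close> for
    \<open>sdist\<close> up to \<open>1 / (4 * a) = s / 2\<close>.\<close>
  define a where "a = 1 / (2 * s)"
  have a: "a > 0" using s by (simp add: a_def)
  have ia: "1 / a = 2 * s" by (simp add: a_def)
  let ?\<eta> = "eta \<kappa> a x" and ?G = "etaG \<kappa> a x" and ?L = "etaL \<kappa> a x"
  note H = C2_on_eta[OF k a, of x]
  note far = eta_far[OF k a, unfolded ia]
  \<comment> \<open>If the ball of radius \<open>2 * s\<close> stays inside, \<open>c = d x\<close>
    works. Otherwise it meets the sphere, so \<open>e3\<close> is within \<open>\<omega>\<close> of
    \<open>d x\<close> and \<open>c = e3\<close> costs a second \<open>\<omega>\<close>.\<close>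
  have "\<exists>c K. norm c = 1 \<and> (\<forall>y. norm y \<le> 1 \<longrightarrow> norm (y - x) \<le> 2 * s \<longrightarrow> norm (d y - c) \<le> 2 * \<omega>) \<and>
    ((compact K \<and> K \<subseteq> ball 0 1 \<and> (\<forall>y\<in>ball 0 1 - K. ?\<eta> y = 0 \<and> ?G y = 0)) \<or> c = e3)"
  proof (cases "cball x (2 * s) \<subseteq> ball 0 1")
    case True
    have "\<forall>y\<in>ball 0 1 - cball x (2 * s). ?\<eta> y = 0 \<and> ?G y = 0"
      using far by (auto simp: dist_norm norm_minus_commute)
    moreover have "\<forall>y. norm y \<le> 1 \<longrightarrow> norm (y - x) \<le> 2 * s \<longrightarrow> norm (d y - d x) \<le> 2 * \<omega>"
      using osc om by (smt (verit))
    ultimately show ?thesis using True norm_d[of x] x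
      by (intro exI[of _ "d x"] exI[of _ "cball x (2 * s)"]) auto
  next
    case False
    then obtain y' where y': "y' \<in> cball x (2 * s)" "y' \<notin> ball 0 1" by blast
    have xs: "x \<in> cball x (2 * s)" using s by simp
    have "connected (cball x (2 * s))" by simp
    then have "cball x (2 * s) \<inter> frontier (ball 0 1) \<noteq> {}"
    proof (rule connected_Int_frontier)
      show "cball x (2 * s) \<inter> ball 0 1 \<noteq> {}" using xs x by force
      show "cball x (2 * s) - ball 0 1 \<noteq> {}" using y' by blast
    qed
    then obtain z where z: "norm z = 1" "norm (z - x) \<le> 2 * s"
      by (auto simp: dist_norm norm_minus_commute)
    have ze: "norm (e3 - d x) \<le> \<omega>" using osc[of z] z d_sphere[of z] by simp
    have "norm (d y - e3) \<le> 2 * \<omega>" if "norm y \<le> 1" "norm (y - x) \<le> 2 * s" for y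
      using norm_triangle_ineq4[of "d y - d x" "e3 - d x"] osc[OF that] ze by simp
    then show ?thesis using norm_e3 by blast
  qed
  then obtain c K where c: "norm c = 1" and W: "\<And>y. norm y \<le> 1 \<Longrightarrow> norm (y - x) \<le> 2 * s \<Longrightarrow> norm (d y - c) \<le> 2 * \<omega>"
    and K: "(compact K \<and> K \<subseteq> ball 0 1 \<and> (\<forall>y\<in>ball 0 1 - K. ?\<eta> y = 0 \<and> ?G y = 0)) \<or> c = e3" by blast
  note I = local_energy_identity[OF H K]
  let ?I = "\<lambda>k x. ?\<eta> x * (d x $ k - c $ k) * lap_comp k x + ?\<eta> x * (norm (grad_comp k x))\<^sup>2 - (d x $ k - c $ k)\<^sup>2 / 2 * ?L x"
  have sum: "(\<Sum>k\<in>UNIV. ?I k y) = ?\<eta> y * ((d y - c) \<bullet> tension_vec y - g y * (norm (d y - c))\<^sup>2 / 2) + ?\<eta> y * g y - (norm (d y - c))\<^sup>2 / 2 * ?L y"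
    if "norm y \<le> 1" for y
  proof -
    have "(\<Sum>k\<in>UNIV. (d y $ k - c $ k)\<^sup>2) = (norm (d y - c))\<^sup>2"
      unfolding power2_norm_eq_inner inner_vec_def by (simp add: power2_eq_square)
    moreover have "(\<Sum>k\<in>UNIV. ?I k y) = ?\<eta> y * (\<Sum>k\<in>UNIV. (d y $ k - c $ k) * lap_comp k y) + ?\<eta> y * (\<Sum>k\<in>UNIV. (norm (grad_comp k y))\<^sup>2)
       - (\<Sum>k\<in>UNIV. (d y $ k - c $ k)\<^sup>2) / 2 * ?L y"
      by (simp add: sum.distrib sum_subtractf sum_distrib_left sum_distrib_right sum_divide_distrib mult.assoc)
    ultimately show ?thesis using w_dot_lap[OF that c] g_eq[of y] by simp
  qed
  let ?t = "\<lambda>y. if sdist \<kappa> x y \<le> 2 * s then tension_norm y / sdist \<kappa> x y else 0"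
  have low: "?\<eta> y * g y / 2 - 2 * \<omega> * ?t y - 2 * \<omega>\<^sup>2 * etaN \<kappa> a x y \<le> (\<Sum>k\<in>UNIV. ?I k y)" if y: "norm y \<le> 1" for y
  proof (cases "norm (y - x) \<le> 2 * s")
    case False
    then have "2 * s \<le> norm (y - x)" by simp
    note f = far[OF this]
    have "0 \<le> ?t y" using tension_norm_nonneg sdist_pos[OF k, of x y] by simp
    then show ?thesis unfolding sum[OF y] using f om by simp
  next
    case True
    note w = W[OF y True]
    have e0: "0 \<le> ?\<eta> y" by (rule eta_bounds[OF k a])
    have w2: "(norm (d y - c))\<^sup>2 \<le> (2 * \<omega>)\<^sup>2" using w by (intro power_mono) auto
    also have "\<dots> \<le> 1\<^sup>2" using om by (intro power_mono) auto
    finally have w1: "(norm (d y - c))\<^sup>2 \<le> 1" by simp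
    have et: "?\<eta> y * tension_norm y \<le> ?t y"
    proof (cases "sdist \<kappa> x y \<le> 2 * s")
      case True
      show ?thesis using True mult_right_mono[OF eta_bounds(2)[OF k a, of x y] tension_norm_nonneg[of y]] by simp
    next
      case False
      have "1 / sdist \<kappa> x y \<le> a" using False s sdist_pos[OF k, of x y] by (simp add: a_def frac_le)
      then have "?\<eta> y = 0" unfolding eta_def by (rule trunc_small[OF a])
      then show ?thesis using tension_norm_nonneg sdist_pos[OF k, of x y] by simp
    qed
    have "\<bar>(d y - c) \<bullet> tension_vec y\<bar> \<le> norm (d y - c) * tension_norm y" unfolding tension_norm_def by (rule Cauchy_Schwarz_ineq2)
    also have "\<dots> \<le> 2 * \<omega> * tension_norm y" using w tension_norm_nonneg by (intro mult_right_mono) auto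
    finally have "- (2 * \<omega> * tension_norm y) \<le> (d y - c) \<bullet> tension_vec y" by linarith
    then have 1: "?\<eta> y * (- (2 * \<omega> * tension_norm y)) \<le> ?\<eta> y * ((d y - c) \<bullet> tension_vec y)" using e0 by (rule mult_left_mono)
    have "2 * \<omega> * (?\<eta> y * tension_norm y) \<le> 2 * \<omega> * ?t y" using et om by (intro mult_left_mono) auto
    with 1 have A: "- (2 * \<omega> * ?t y) \<le> ?\<eta> y * ((d y - c) \<bullet> tension_vec y)" by (simp add: algebra_simps)
    have B: "?\<eta> y * (g y * (norm (d y - c))\<^sup>2 / 2) \<le> ?\<eta> y * (g y * 1 / 2)"
      using w1 e0 g_nonneg by (intro mult_left_mono divide_right_mono) auto
    have C: "(norm (d y - c))\<^sup>2 / 2 * ?L y \<le> 2 * \<omega>\<^sup>2 * etaN \<kappa> a x y"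
    proof -
      have "(norm (d y - c))\<^sup>2 / 2 * ?L y \<le> (norm (d y - c))\<^sup>2 / 2 * etaN \<kappa> a x y"
        by (intro mult_left_mono etaL_le[OF k a]) auto
      also have "\<dots> \<le> (2 * \<omega>)\<^sup>2 / 2 * etaN \<kappa> a x y"
        using w2 etaN_bounds(1)[OF k a] by (intro mult_right_mono divide_right_mono) auto
      finally show ?thesis by (simp add: power_mult_distrib)
    qed
    show ?thesis unfolding sum[OF y] using A B C by (simp add: algebra_simps)
  qed
  have cont_eta: "continuous_on UNIV ?\<eta>" using C1_on_cont[OF C2_on_C1[OF H]] .
  have egi: "integrable ballM (\<lambda>y. ?\<eta> y * g y)" by (rule ballM_integrable_mult_cont[OF cont_eta g_int])
  have Ni: "integrable ballM (etaN \<kappa> a x)"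
  proof (rule ballM_integrable_bounded)
    show "\<bar>etaN \<kappa> a x y\<bar> \<le> 32 * a ^ 3" for y
      using order_trans[OF etaN_bounds(2)[OF k a, of x y], of "32 * a ^ 3"] etaN_bounds(1)[OF k a, of x y] a
      by (simp add: indicator_def)
  qed (rule ballM_borel[OF etaN_meas[OF k a]])
  have NI: "integral\<^sup>L ballM (etaN \<kappa> a x) \<le> 160"
    by (rule order_trans[OF ballM_integral_le[OF etaN_integral(1)[OF k a]] etaN_integral(2)[OF k a]])
       (use etaN_bounds[OF k a] in auto)
  have s2: "2 * s > 0" using s by simp
  note T = tension_near[OF k s2, of x]
  have "integral\<^sup>L ballM (\<lambda>y. ?\<eta> y * g y / 2 - 2 * \<omega> * ?t y - 2 * \<omega>\<^sup>2 * etaN \<kappa> a x y) \<le> integral\<^sup>L ballM (\<lambda>y. \<Sum>k\<in>UNIV. ?I k y)"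
  proof (rule integral_mono)
    show "integrable ballM (\<lambda>y. ?\<eta> y * g y / 2 - 2 * \<omega> * ?t y - 2 * \<omega>\<^sup>2 * etaN \<kappa> a x y)"
      using egi Ni T(2) by (intro Bochner_Integration.integrable_diff integrable_mult_right) auto
    show "integrable ballM (\<lambda>y. \<Sum>k\<in>UNIV. ?I k y)" by (intro Bochner_Integration.integrable_sum I(1))
  qed (use low in auto)
  also have "\<dots> = 0" using I by (subst Bochner_Integration.integral_sum) auto
  also have "integral\<^sup>L ballM (\<lambda>y. ?\<eta> y * g y / 2 - 2 * \<omega> * ?t y - 2 * \<omega>\<^sup>2 * etaN \<kappa> a x y)
     = integral\<^sup>L ballM (\<lambda>y. ?\<eta> y * g y) / 2 - 2 * \<omega> * integral\<^sup>L ballM ?t - 2 * \<omega>\<^sup>2 * integral\<^sup>L ballM (etaN \<kappa> a x)"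
    using egi Ni T(2) by (simp del: if_split)
  finally have "integral\<^sup>L ballM (\<lambda>y. ?\<eta> y * g y) \<le> 4 * \<omega> * integral\<^sup>L ballM ?t + 4 * \<omega>\<^sup>2 * integral\<^sup>L ballM (etaN \<kappa> a x)"
    by simp
  also have "\<dots> \<le> 2 * (21 * \<epsilon> * sqrt (2 * s)) + 4 * \<omega>\<^sup>2 * 160"
    using om T(1) NI etaN_bounds(1)[OF k a] Bochner_Integration.integral_nonneg[of ballM ?t] tension_norm_nonneg sdist_pos[OF k, of x]
    by (intro add_mono mult_mono) (auto intro!: Bochner_Integration.integral_nonneg simp: less_imp_le)
  also have "sqrt (2 * s) \<le> 10/7 * sqrt s"
  proof -
    have "sqrt 2 \<le> 10/7" by (rule real_le_lsqrt) (auto simp: power2_eq_square)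
    then show ?thesis using s by (simp add: real_sqrt_mult)
  qed
  finally have eg: "integral\<^sup>L ballM (\<lambda>y. ?\<eta> y * g y) \<le> 60 * \<epsilon> * sqrt s + 640 * \<omega>\<^sup>2" using eps by simp
  have s3: "s / 2 > 0" using s by simp
  note T' = tension_near[OF k s3, of x]
  let ?p = "\<lambda>y. if sdist \<kappa> x y \<le> s / 2 then tension_norm y / sdist \<kappa> x y else 0"
  have "integral\<^sup>L ballM (\<lambda>y. if sdist \<kappa> x y \<le> s / 2 then (g y + tension_norm y) / sdist \<kappa> x y else 0)
     \<le> integral\<^sup>L ballM (\<lambda>y. 2 * (?\<eta> y * g y) + ?p y)"
  proof (rule integral_mono')
    show "integrable ballM (\<lambda>y. 2 * (?\<eta> y * g y) + ?p y)"
      by (rule Bochner_Integration.integrable_add[OF integrable_mult_right[OF egi] T'(2)])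
    fix y
    have e0: "0 \<le> ?\<eta> y" by (rule eta_bounds[OF k a])
    show "0 \<le> 2 * (?\<eta> y * g y) + ?p y" using e0 g_nonneg[of y] tension_norm_nonneg[of y] sdist_pos[OF k, of x y] by simp
    show "(if sdist \<kappa> x y \<le> s / 2 then (g y + tension_norm y) / sdist \<kappa> x y else 0) \<le> 2 * (?\<eta> y * g y) + ?p y"
    proof (cases "sdist \<kappa> x y \<le> s / 2")
      case True
      then have "1 / (2 * sdist \<kappa> x y) \<le> ?\<eta> y" by (intro eta_lower[OF k a]) (simp add: a_def)
      then have "1 / (2 * sdist \<kappa> x y) * g y \<le> ?\<eta> y * g y" using g_nonneg by (rule mult_right_mono)
      then show ?thesis using True by (simp add: add_divide_distrib)
    qed (use e0 g_nonneg[of y] in simp)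
  qed
  also have "\<dots> = 2 * integral\<^sup>L ballM (\<lambda>y. ?\<eta> y * g y) + integral\<^sup>L ballM ?p"
    using egi T'(2) by (subst Bochner_Integration.integral_add) auto
  \<comment> \<open>Here \<open>640 = 4 * 160\<close> from the mass of \<open>etaN\<close>, and 60
    bounds \<open>42 * sqrt 2\<close>, using \<open>4 * \<omega> \<le> 2\<close> and
    \<open>sqrt 2 \<le> 10/7\<close>. Doubling undoes the one half in the lower bound for the
    kernel.\<close>
  also have "\<dots> \<le> 2 * (60 * \<epsilon> * sqrt s + 640 * \<omega>\<^sup>2) + 21 * \<epsilon> * sqrt (s / 2)"
    using eg T'(1) by simp
  also have "21 * \<epsilon> * sqrt (s / 2) \<le> 21 * \<epsilon> * sqrt s" using eps s by (intro mult_left_mono) auto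
  finally show ?thesis by simp
qed

section \<open>Representation by the Green function\<close>

text \<open>Second Green identity when \<open>u k\<close> has no boundary derivative. Truncating
  \<open>h\<close> at level \<open>a n\<close> makes both sides compactly supported and leaves one
  error term, the integral of \<open>u k\<close> against
  \<open>trunc2 (a n) (h y) * (G y \<bullet> G y)\<close>. That density has bounded mass and
  concentrates at the sphere, where \<open>u k\<close> tends to zero.\<close>

lemma green_zero_boundary:
  assumes H: "C2_on UNIV h G L" and h0: "\<And>y. norm y = 1 \<Longrightarrow> h y = 0" and hp: "\<And>y. norm y < 1 \<Longrightarrow> h y > 0"
  shows "integral\<^sup>L ballM (\<lambda>y. h y * lap_comp k y) = integral\<^sup>L ballM (\<lambda>y. u k y * L y)"
proof -
  define a where "a n = 1 / real (Suc n)" for n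
  have a: "a n > 0" for n by (simp add: a_def)
  have ch: "continuous_on UNIV h" and cG: "continuous_on UNIV G" and cL: "continuous_on UNIV L"
    using C1_on_cont[OF C2_on_C1[OF H]] C1_on_cont_grad[OF C2_on_C1[OF H]] C2_on_cont_lap[OF H] by auto
  have [measurable]: "h \<in> borel_measurable ballM" "G \<in> borel_measurable ballM" "L \<in> borel_measurable ballM"
    using ch cG cL by (auto intro!: ballM_borel borel_measurable_continuous_onI)
  have [measurable]: "trunc (a n) \<in> borel_measurable borel" "trunc1 (a n) \<in> borel_measurable borel" "trunc2 (a n) \<in> borel_measurable borel" for n
    using trunc_cont[OF a] by (auto intro!: borel_measurable_continuous_onI)
  obtain C1 where C1: "C1 \<ge> 0" "\<And>x. norm x \<le> 1 \<Longrightarrow> norm (h x) \<le> C1" by (rule ballM_bounded_cont[OF ch]) blast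
  obtain C2 where C2: "C2 \<ge> 0" "\<And>x. norm x \<le> 1 \<Longrightarrow> norm (G x) \<le> C2" by (rule ballM_bounded_cont[OF cG]) blast
  obtain C3 where C3: "C3 \<ge> 0" "\<And>x. norm x \<le> 1 \<Longrightarrow> norm (L x) \<le> C3" by (rule ballM_bounded_cont[OF cL]) blast
  let ?K = "\<lambda>n. {y. norm y \<le> 1 \<and> a n \<le> h y}"
  have K: "compact (?K n)" "?K n \<subseteq> ball 0 1" for n
  proof -
    have "closed (cball 0 1 \<inter> h -` {a n..})"
      by (intro continuous_closed_preimage continuous_on_subset[OF ch]) auto
    then have "compact (cball 0 1 \<inter> (cball 0 1 \<inter> h -` {a n..}))" by (intro compact_Int_closed) auto
    moreover have "cball 0 1 \<inter> (cball 0 1 \<inter> h -` {a n..}) = ?K n" by auto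
    ultimately show "compact (?K n)" by simp
    show "?K n \<subseteq> ball 0 1" using h0 a[of n] by (force simp: less_le)
  qed
  let ?p = "\<lambda>n y. trunc (a n) (h y)" and ?p1 = "\<lambda>n y. trunc1 (a n) (h y)" and ?p2 = "\<lambda>n y. trunc2 (a n) (h y)"
  have P: "C2_on UNIV (?p n) (\<lambda>y. ?p1 n y *\<^sub>R G y) (\<lambda>y. ?p1 n y * L y + ?p2 n y * (G y \<bullet> G y))" for n
    by (rule C2_on_compose_real[OF H DERIV_trunc[OF a] DERIV_trunc1[OF a]]) (rule trunc_cont[OF a])
  have PB: "C2_on (ball 0 1) (?p n) (\<lambda>y. ?p1 n y *\<^sub>R G y) (\<lambda>y. ?p1 n y * L y + ?p2 n y * (G y \<bullet> G y))" for n
    by (rule C2_on_subset[OF P]) simp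
  have out: "?p n y = 0" "?p1 n y = 0" "?p2 n y = 0" if "y \<in> ball 0 1 - ?K n" for n y
    using that trunc_small[OF a, of "h y" n] by auto
  have A: "integrable ballM (\<lambda>y. ?p n y * lap_comp k y + (?p1 n y *\<^sub>R G y) \<bullet> grad_comp k y)" 
       "integral\<^sup>L ballM (\<lambda>y. ?p n y * lap_comp k y + (?p1 n y *\<^sub>R G y) \<bullet> grad_comp k y) = 0" for n
    using green_first[OF C2_on_C1[OF PB[of n]] C2_u[of k] open_ball K(1)[of n] K(2)[of n]] out unfolding ballM_def by auto
  have B: "integrable ballM (\<lambda>y. u k y * (?p1 n y * L y + ?p2 n y * (G y \<bullet> G y)) + grad_comp k y \<bullet> (?p1 n y *\<^sub>R G y))" 
       "integral\<^sup>L ballM (\<lambda>y. u k y * (?p1 n y * L y + ?p2 n y * (G y \<bullet> G y)) + grad_comp k y \<bullet> (?p1 n y *\<^sub>R G y)) = 0" for n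
    using green_first[OF C1_u[of k] PB[of n] open_ball K(1)[of n] K(2)[of n]] out unfolding ballM_def by auto
  \<comment> \<open>The constant test function expresses the mass of the concentrating density
    through the bounded Laplacian \<open>L\<close>.\<close>
  have D: "integrable ballM (\<lambda>y. ?p1 n y * L y + ?p2 n y * (G y \<bullet> G y))" 
       "integral\<^sup>L ballM (\<lambda>y. ?p1 n y * L y + ?p2 n y * (G y \<bullet> G y)) = 0" for n
    using green_first[OF C1_on_const[of _ 1] PB[of n] open_ball K(1)[of n] K(2)[of n]] out unfolding ballM_def by auto
  have p1L: "integrable ballM (\<lambda>y. ?p1 n y * L y)" for n
  proof (rule ballM_integrable_bounded)
    show "\<bar>?p1 n y * L y\<bar> \<le> 1 * C3" if "norm y < 1" for y
      unfolding abs_mult using trunc1_bounds[OF a, of n "h y"] C3(2)[of y] that by (intro mult_mono) auto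
  qed measurable
  have p2G: "integrable ballM (\<lambda>y. ?p2 n y * (G y \<bullet> G y))" for n
    using Bochner_Integration.integrable_diff[OF D(1)[of n] p1L[of n]] by simp
  have up1L: "integrable ballM (\<lambda>y. u k y * (?p1 n y * L y))" for n
  proof (rule ballM_integrable_bounded)
    show "\<bar>u k y * (?p1 n y * L y)\<bar> \<le> 2 * (1 * C3)" if "norm y < 1" for y
      unfolding abs_mult using trunc1_bounds[OF a, of n "h y"] C3(2)[of y] that u_bound[of y k] by (intro mult_mono) auto
  qed measurable
  have up2G: "integrable ballM (\<lambda>y. u k y * (?p2 n y * (G y \<bullet> G y)))" for n
  proof (rule ballM_integrable_bounded)
    show "\<bar>u k y * (?p2 n y * (G y \<bullet> G y))\<bar> \<le> 2 * (2 / a n * C2\<^sup>2)" if "norm y < 1" for y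
    proof -
      have "G y \<bullet> G y \<le> C2\<^sup>2" unfolding power2_norm_eq_inner[symmetric] using C2(2)[of y] that by (intro power_mono) auto
      then show ?thesis unfolding abs_mult
        using trunc2_bounds[OF a, of n "h y"] u_bound[of y k] that a[of n] by (intro mult_mono) auto
    qed
  qed measurable
  have ip: "integrable ballM (\<lambda>y. ?p n y * lap_comp k y)" for n
  proof (rule Bochner_Integration.integrable_bound[of _ "\<lambda>y. C1 * lap_comp k y"])
    show "AE y in ballM. norm (?p n y * lap_comp k y) \<le> norm (C1 * lap_comp k y)"
    proof (rule AE_I2)
      fix y assume "y \<in> space ballM"
      then have y: "norm y < 1" by simp
      have "\<bar>?p n y\<bar> \<le> C1" using trunc_bounds[OF a[of n], where t="h y"] hp[OF y] C1(2)[of y] y by simp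
      then show "norm (?p n y * lap_comp k y) \<le> norm (C1 * lap_comp k y)" using C1(1) by (simp add: abs_mult mult_right_mono)
    qed
  qed (use lap_comp_int in auto)
  define R where "R n = integral\<^sup>L ballM (\<lambda>y. u k y * (?p2 n y * (G y \<bullet> G y)))" for n
  define CL where "CL = integral\<^sup>L ballM (\<lambda>y. \<bar>L y\<bar>)"
  have Li: "integrable ballM (\<lambda>y. \<bar>L y\<bar>)"
    by (rule ballM_integrable_bounded[of _ C3]) (use C3 in auto)
  have CL: "CL \<ge> 0" unfolding CL_def by (rule Bochner_Integration.integral_nonneg) simp
  have mass: "integral\<^sup>L ballM (\<lambda>y. ?p2 n y * (G y \<bullet> G y)) \<le> CL" for n
  proof -
    have "integral\<^sup>L ballM (\<lambda>y. ?p2 n y * (G y \<bullet> G y)) = - integral\<^sup>L ballM (\<lambda>y. ?p1 n y * L y)"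
      using D(2)[of n] p1L[of n] p2G[of n] by (simp add: Bochner_Integration.integral_add)
    also have "\<dots> = integral\<^sup>L ballM (\<lambda>y. - (?p1 n y * L y))" by simp
    also have "\<dots> \<le> CL" unfolding CL_def
    proof (rule integral_mono)
      fix y
      have "\<bar>?p1 n y * L y\<bar> \<le> 1 * \<bar>L y\<bar>" unfolding abs_mult
        using trunc1_bounds[OF a, of n "h y"] by (intro mult_right_mono) auto
      then show "- (?p1 n y * L y) \<le> \<bar>L y\<bar>" by linarith
    qed (use p1L Li in auto)
    finally show ?thesis .
  qed
  have R0: "R \<longlonglongrightarrow> 0"
  proof (rule LIMSEQ_I)
    fix r :: real assume r: "r > 0"
    define e where "e = r / (2 * (CL + 1))"
    have e: "e > 0" using r CL by (simp add: e_def)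
    let ?S = "{x. norm x \<le> 1 \<and> e \<le> \<bar>u k x\<bar>}"
    \<comment> \<open>On the compact set where \<open>u k\<close> is not small, \<open>h\<close> has
      a positive minimum. Once \<open>2 * a n\<close> is below it, the density is supported where
      \<open>u k\<close> is at most \<open>e\<close> in absolute value.\<close>
    obtain m where m: "m > 0" "\<And>y. y \<in> ?S \<Longrightarrow> m \<le> h y"
    proof (cases "?S = {}")
      case True then show ?thesis using that[of 1] by auto
    next
      case False
      obtain z where z: "z \<in> ?S" "\<And>y. y \<in> ?S \<Longrightarrow> h z \<le> h y"
        using continuous_attains_inf[OF u_level_compact(1)[OF e] False, of h] continuous_on_subset[OF ch] by blast
      have "h z > 0" using z(1) u_level_compact(2)[OF e, of k] hp by auto
      then show ?thesis using z(2) that by blast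
    qed
    have "\<forall>\<^sub>F n in sequentially. norm (R n - 0) < r"
      using ev_inv_Suc_less[OF m(1)]
    proof eventually_elim
      fix n assume n: "2 * (1 / real (Suc n)) < m"
      have "norm (R n) \<le> integral\<^sup>L ballM (\<lambda>y. e * (?p2 n y * (G y \<bullet> G y)))"
        unfolding R_def
      proof (rule Bochner_Integration.integral_norm_bound_integral[OF up2G integrable_mult_right[OF p2G]])
        fix y assume "y \<in> space ballM"
        then have y: "norm y < 1" by simp
        show "norm (u k y * (?p2 n y * (G y \<bullet> G y))) \<le> e * (?p2 n y * (G y \<bullet> G y))"
        proof (cases "2 * a n \<le> h y")
          case True then show ?thesis using trunc_large(2)[OF a True] by simp
        next
          case False
          then have "h y < m" using n by (simp add: a_def)
          then have "\<bar>u k y\<bar> \<le> e" using m(2)[of y] y by force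
          moreover have "0 \<le> ?p2 n y * (G y \<bullet> G y)" using trunc2_bounds(1)[OF a, of n "h y"] by simp
          ultimately show ?thesis by (simp add: abs_mult mult_right_mono trunc2_bounds(1)[OF a])
        qed
      qed
      also have "\<dots> \<le> e * CL" using mass[of n] e by simp
      also have "\<dots> < r" using r CL by (simp add: e_def field_simps) (smt (verit) mult_nonneg_nonneg)
      finally show "norm (R n - 0) < r" by simp
    qed
    then show "\<exists>no. \<forall>n\<ge>no. norm (R n - 0) < r" by (simp add: eventually_sequentially)
  qed
  have eq: "integral\<^sup>L ballM (\<lambda>y. ?p n y * lap_comp k y) - integral\<^sup>L ballM (\<lambda>y. u k y * (?p1 n y * L y)) = R n" for n
  proof -
    have "0 = integral\<^sup>L ballM (\<lambda>y. (?p n y * lap_comp k y + (?p1 n y *\<^sub>R G y) \<bullet> grad_comp k y) 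
        - (u k y * (?p1 n y * L y + ?p2 n y * (G y \<bullet> G y)) + grad_comp k y \<bullet> (?p1 n y *\<^sub>R G y)))"
      using A[of n] B[of n] by simp
    also have "\<dots> = integral\<^sup>L ballM (\<lambda>y. ?p n y * lap_comp k y - u k y * (?p1 n y * L y) - u k y * (?p2 n y * (G y \<bullet> G y)))"
      by (rule Bochner_Integration.integral_cong) (auto simp: inner_commute algebra_simps)
    also have "\<dots> = integral\<^sup>L ballM (\<lambda>y. ?p n y * lap_comp k y) - integral\<^sup>L ballM (\<lambda>y. u k y * (?p1 n y * L y)) - R n"
      unfolding R_def using ip[of n] up1L[of n] up2G[of n] by simp
    finally show ?thesis by simp
  qed
  have l1: "(\<lambda>n. integral\<^sup>L ballM (\<lambda>y. ?p n y * lap_comp k y)) \<longlonglongrightarrow> integral\<^sup>L ballM (\<lambda>y. h y * lap_comp k y)"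
  proof (rule integral_dominated_convergence)
    show "integrable ballM (\<lambda>y. C1 * \<bar>lap_comp k y\<bar>)" using lap_comp_int by simp
    show "AE y in ballM. (\<lambda>n. ?p n y * lap_comp k y) \<longlonglongrightarrow> h y * lap_comp k y"
    proof (rule AE_I2)
      fix y assume "y \<in> space ballM"
      then have "0 \<le> h y" using hp[of y] by simp
      then show "(\<lambda>n. ?p n y * lap_comp k y) \<longlonglongrightarrow> h y * lap_comp k y"
        unfolding a_def by (intro tendsto_intros trunc_tendsto)
    qed
    show "AE y in ballM. norm (?p n y * lap_comp k y) \<le> C1 * \<bar>lap_comp k y\<bar>" for n
    proof (rule AE_I2)
      fix y assume "y \<in> space ballM"
      then have y: "norm y < 1" by simp
      have "\<bar>?p n y\<bar> \<le> C1" using trunc_bounds[OF a[of n], where t="h y"] hp[OF y] C1(2)[of y] y by simp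
      then show "norm (?p n y * lap_comp k y) \<le> C1 * \<bar>lap_comp k y\<bar>" by (simp add: abs_mult mult_right_mono)
    qed
  qed measurable
  have l2: "(\<lambda>n. integral\<^sup>L ballM (\<lambda>y. u k y * (?p1 n y * L y))) \<longlonglongrightarrow> integral\<^sup>L ballM (\<lambda>y. u k y * L y)"
  proof (rule integral_dominated_convergence)
    show "integrable ballM (\<lambda>y. 2 * C3)" by (rule one_int)
    show "AE y in ballM. (\<lambda>n. u k y * (?p1 n y * L y)) \<longlonglongrightarrow> u k y * L y"
    proof (rule AE_I2)
      fix y assume "y \<in> space ballM"
      then have "0 < h y" using hp[of y] by simp
      then have "(\<lambda>n. u k y * (?p1 n y * L y)) \<longlonglongrightarrow> u k y * (1 * L y)"
        unfolding a_def by (intro tendsto_intros trunc1_tendsto)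
      then show "(\<lambda>n. u k y * (?p1 n y * L y)) \<longlonglongrightarrow> u k y * L y" by simp
    qed
    show "AE y in ballM. norm (u k y * (?p1 n y * L y)) \<le> 2 * C3" for n
    proof (rule AE_I2)
      fix y assume "y \<in> space ballM"
      then have y: "norm y < 1" by simp
      have "\<bar>u k y * (?p1 n y * L y)\<bar> \<le> 2 * (1 * C3)"
        unfolding abs_mult using trunc1_bounds[OF a, of n "h y"] C3(2)[of y] y u_bound[of y k] by (intro mult_mono) auto
      then show "norm (u k y * (?p1 n y * L y)) \<le> 2 * C3" by simp
    qed
  qed measurable
  have "(\<lambda>n. R n) \<longlonglongrightarrow> integral\<^sup>L ballM (\<lambda>y. h y * lap_comp k y) - integral\<^sup>L ballM (\<lambda>y. u k y * L y)"
    unfolding eq[symmetric] by (intro tendsto_diff l1 l2)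
  with R0 show ?thesis using LIMSEQ_unique by fastforce
qed

text \<open>The Laplacian of the kernel consists of an image part and minus a Plummer density. For
  fixed interior \<open>x\<close> the image distance is at least \<open>1 - norm x\<close>, so the
  image part is of order \<open>\<kappa>\<^sup>2\<close>, while the Plummer part reproduces
  \<open>u k x\<close>.\<close>

lemma green_representation:
  assumes x: "norm x < 1"
  shows "(\<lambda>n. - integral\<^sup>L ballM (\<lambda>y. green (1 / real (Suc n)) x y * lap_comp k y)) \<longlonglongrightarrow> plummer_mass * u k x"
proof -
  let ?k = "\<lambda>n. 1 / real (Suc n)"
  let ?Q = "\<lambda>n y. 3 * (norm x)\<^sup>2 * (?k n)\<^sup>2 / reflected_dist (?k n) x y ^ 5"
  have k: "?k n > 0" for n by simp
  define b where "b = 1 - norm x"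
  have b: "b > 0" using x by (simp add: b_def)
  have sqb: "b \<le> reflected_dist \<kappa> x y" if "norm y < 1" for \<kappa> y
  proof -
    have "norm x * norm y \<le> norm x" using that by (simp add: mult_left_le)
    then have "b\<^sup>2 \<le> (1 - norm x * norm y)\<^sup>2" using b unfolding b_def by (intro power_mono) auto
    also have "\<dots> \<le> (norm x)\<^sup>2 * (norm y)\<^sup>2 - 2 * (x \<bullet> y) + 1 + \<kappa>\<^sup>2"
      using reflected_dist_quad_nonneg[of x y] by (simp add: add_increasing2)
    finally show ?thesis unfolding reflected_dist_def by (rule real_le_rsqrt)
  qed
  have Qb: "\<bar>u k y * ?Q n y\<bar> \<le> 6 / b ^ 5 * (?k n)\<^sup>2" if y: "norm y < 1" for n y
  proof -
    have "0 \<le> ?Q n y" using reflected_dist_pos[OF k, of n x y] by simp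
    moreover have "?Q n y \<le> 3 * 1 * (?k n)\<^sup>2 / b ^ 5"
      using sqb[OF y, of "?k n"] b x by (intro frac_le mult_right_mono mult_left_mono power_mono) (auto simp: power_le_one)
    ultimately have "\<bar>u k y * ?Q n y\<bar> \<le> 2 * (3 * 1 * (?k n)\<^sup>2 / b ^ 5)"
      unfolding abs_mult using u_bound[of y k] y by (intro mult_mono) auto
    then show ?thesis by simp
  qed
  have cQ: "continuous_on UNIV (?Q n)" for n
    using reflected_dist_pos[OF k, of n x] by (intro continuous_intros) (auto simp: less_imp_neq[THEN not_sym])
  have [measurable]: "?Q n \<in> borel_measurable ballM" for n
    using cQ by (intro ballM_borel borel_measurable_continuous_onI)
  have [measurable]: "plummer \<kappa> x \<in> borel_measurable ballM" for \<kappa> by (rule ballM_borel[OF plummer_meas])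
  have Qi: "integrable ballM (\<lambda>y. u k y * ?Q n y)" for n
    by (rule ballM_integrable_bounded[OF _ Qb]) measurable
  have Ki: "integrable ballM (\<lambda>y. u k y * plummer (?k n) x y)" for n
  proof (rule ballM_integrable_bounded)
    show "\<bar>u k y * plummer (?k n) x y\<bar> \<le> 2 * (3 * (?k n)\<^sup>2 / (?k n) ^ 5)" if y: "norm y < 1" for y
    proof -
      have "plummer (?k n) x y \<le> 3 * (?k n)\<^sup>2 / (?k n) ^ 5" unfolding plummer_def
        using sdist_ge(2)[of "?k n" x y] k[of n] by (intro divide_left_mono power_mono mult_pos_pos zero_less_power sdist_pos) auto
      then show ?thesis unfolding abs_mult using u_bound[of y k] y plummer_nonneg by (intro mult_mono) auto
    qed
  qed measurable
  have eq: "- integral\<^sup>L ballM (\<lambda>y. green (?k n) x y * lap_comp k y)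
     = integral\<^sup>L ballM (\<lambda>y. u k y * plummer (?k n) x y) - integral\<^sup>L ballM (\<lambda>y. u k y * ?Q n y)" for n
  proof -
    obtain G where G: "C2_on UNIV (green (?k n) x) G (\<lambda>y. 3 * (norm x)\<^sup>2 * (?k n)\<^sup>2 / reflected_dist (?k n) x y ^ 5 - 3 * (?k n)\<^sup>2 / sdist (?k n) x y ^ 5)"
      using C2_on_green[OF k] by blast
    have "integral\<^sup>L ballM (\<lambda>y. green (?k n) x y * lap_comp k y) = integral\<^sup>L ballM (\<lambda>y. u k y * (?Q n y - plummer (?k n) x y))"
      unfolding plummer_def by (rule green_zero_boundary[OF G green_sphere]) (use green_pos[OF k x] in auto)
    also have "\<dots> = integral\<^sup>L ballM (\<lambda>y. u k y * ?Q n y) - integral\<^sup>L ballM (\<lambda>y. u k y * plummer (?k n) x y)"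
      using Bochner_Integration.integral_diff[OF Qi[of n] Ki[of n]] by (simp add: right_diff_distrib del: of_nat_Suc)
    finally show ?thesis by simp
  qed
  have l1: "(\<lambda>n. integral\<^sup>L ballM (\<lambda>y. u k y * plummer (?k n) x y)) \<longlonglongrightarrow> plummer_mass * u k x"
    by (rule plummer_approx_identity[OF C1_on_cont[OF C1_u] _ x, of _ 2]) (use u_bound in auto)
  have l2: "(\<lambda>n. integral\<^sup>L ballM (\<lambda>y. u k y * ?Q n y)) \<longlonglongrightarrow> 0"
  proof (rule Lim_null_comparison)
    show "\<forall>\<^sub>F n in sequentially. norm (integral\<^sup>L ballM (\<lambda>y. u k y * ?Q n y)) \<le> 6 / b ^ 5 * (?k n)\<^sup>2 * integral\<^sup>L ballM (\<lambda>y. 1)"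
    proof (rule always_eventually, rule allI)
      fix n
      have "norm (integral\<^sup>L ballM (\<lambda>y. u k y * ?Q n y)) \<le> integral\<^sup>L ballM (\<lambda>y. 6 / b ^ 5 * (?k n)\<^sup>2 * 1)"
        by (rule Bochner_Integration.integral_norm_bound_integral[OF Qi one_int]) (use Qb in auto)
      then show "norm (integral\<^sup>L ballM (\<lambda>y. u k y * ?Q n y)) \<le> 6 / b ^ 5 * (?k n)\<^sup>2 * integral\<^sup>L ballM (\<lambda>y. 1)"
        by (simp only: integral_mult_right_zero)
    qed
    have "(\<lambda>n. 6 / b ^ 5 * (?k n)\<^sup>2 * integral\<^sup>L ballM (\<lambda>y. 1)) \<longlonglongrightarrow> 6 / b ^ 5 * 0\<^sup>2 * integral\<^sup>L ballM (\<lambda>y. 1)"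
      by (intro tendsto_intros inv_Suc_tendsto)
    then show "(\<lambda>n. 6 / b ^ 5 * (?k n)\<^sup>2 * integral\<^sup>L ballM (\<lambda>y. 1)) \<longlonglongrightarrow> 0" by simp
  qed
  show ?thesis unfolding eq using tendsto_diff[OF l1 l2] by simp
qed

text \<open>The kernel is comparable to \<open>1 / s\<close> for \<open>s \<le> \<rho>\<close> and
  to \<open>\<rho> / s\<^sup>2\<close> beyond: the size of a difference of Newton kernels whose
  poles are \<open>\<rho>\<close> apart. The density dominates the Laplacian of each
  component.\<close>

definition potential :: "real \<Rightarrow> real^3 \<Rightarrow> real \<Rightarrow> real" where
  "potential \<kappa> x \<rho> = integral\<^sup>L ballM (\<lambda>y. \<rho> / (sdist \<kappa> x y * (sdist \<kappa> x y + \<rho>)) * (g y + tension_norm y))"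

lemma gt_int: "integrable ballM (\<lambda>y. g y + tension_norm y)" using g_int tension_norm_int by simp

lemma potential_int:
  assumes "\<kappa> > 0" "\<rho> > 0"
  shows "integrable ballM (\<lambda>y. \<rho> / (sdist \<kappa> x y * (sdist \<kappa> x y + \<rho>)) * (g y + tension_norm y))"
proof (rule ballM_integrable_mult_cont[OF _ gt_int], intro continuous_intros ballI)
  fix y show "sdist \<kappa> x y * (sdist \<kappa> x y + \<rho>) \<noteq> 0" using sdist_pos[OF assms(1), of x y] assms by simp
qed

text \<open>Factor 2 from \<open>green_diff\<close> and 3 from \<open>kernel_split\<close>, two
  potentials, and three components give 36; the normalisation is harmless because
  \<open>plummer_mass\<close> is at least 1. Bounds uniform in \<open>\<kappa>\<close> survive the
  limit in the representation.\<close>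

lemma oscillation_by_potential:
  assumes x: "norm x < 1" "norm x' < 1" and r: "norm (x - x') = \<rho>" "\<rho> > 0"
    and Z: "\<And>\<kappa>. 0 < \<kappa> \<Longrightarrow> \<kappa> \<le> 1 \<Longrightarrow> potential \<kappa> x \<rho> \<le> Z" "\<And>\<kappa>. 0 < \<kappa> \<Longrightarrow> \<kappa> \<le> 1 \<Longrightarrow> potential \<kappa> x' \<rho> \<le> Z"
  shows "norm (d x - d x') \<le> 36 * Z"
proof -
  let ?k = "\<lambda>n. 1 / real (Suc n)"
  have k: "?k n > 0" "?k n \<le> 1" for n by auto
  have J0: "0 \<le> potential \<kappa> x \<rho>" if "\<kappa> > 0" for \<kappa> x unfolding potential_def
    using g_nonneg tension_norm_nonneg sdist_pos[OF that, of x] r by (intro Bochner_Integration.integral_nonneg) (auto intro!: mult_nonneg_nonneg divide_nonneg_nonneg add_nonneg_nonneg simp: less_imp_le)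
  have Z0: "Z \<ge> 0" using J0[of 1 x] Z(1)[of 1] by simp
  have ui: "\<bar>u k x - u k x'\<bar> \<le> 12 * Z" for k
  proof -
    have gi: "integrable ballM (\<lambda>y. green (?k n) x y * lap_comp k y)" for n x
    proof (rule ballM_integrable_mult_cont[OF _ lap_comp_int])
      show "continuous_on UNIV (green (?k n) x)" using C2_on_green[OF k(1), of n x] C1_on_cont C2_on_C1 by blast
    qed
    have bd: "\<bar>(- integral\<^sup>L ballM (\<lambda>y. green (?k n) x y * lap_comp k y)) - (- integral\<^sup>L ballM (\<lambda>y. green (?k n) x' y * lap_comp k y))\<bar> \<le> 12 * Z" for n
    proof -
      let ?\<kappa> = "?k n"
      let ?q = "\<lambda>x y. \<rho> / (sdist ?\<kappa> x y * (sdist ?\<kappa> x y + \<rho>)) * (g y + tension_norm y)"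
      have "\<bar>(- integral\<^sup>L ballM (\<lambda>y. green ?\<kappa> x y * lap_comp k y)) - (- integral\<^sup>L ballM (\<lambda>y. green ?\<kappa> x' y * lap_comp k y))\<bar>
        = norm (integral\<^sup>L ballM (\<lambda>y. green ?\<kappa> x y * lap_comp k y - green ?\<kappa> x' y * lap_comp k y))"
        using gi[of n x] gi[of n x'] by (simp add: abs_minus_commute del: of_nat_Suc)
      also have "\<dots> \<le> integral\<^sup>L ballM (\<lambda>y. 6 * (?q x y + ?q x' y))"
      proof (rule Bochner_Integration.integral_norm_bound_integral)
        show "integrable ballM (\<lambda>y. green ?\<kappa> x y * lap_comp k y - green ?\<kappa> x' y * lap_comp k y)" using gi by (intro Bochner_Integration.integrable_diff)
        show "integrable ballM (\<lambda>y. 6 * (?q x y + ?q x' y))"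
          by (intro integrable_mult_right Bochner_Integration.integrable_add potential_int k r)
        fix y assume "y \<in> space ballM"
        then have y: "norm y < 1" by simp
        let ?s = "sdist ?\<kappa> x y" and ?t = "sdist ?\<kappa> x' y"
        have "\<bar>green ?\<kappa> x y - green ?\<kappa> x' y\<bar> \<le> 2 * (\<rho> / (?s * ?t))"
          using green_diff[OF k(1), of x x' y n] x y r by simp
        also have "\<dots> \<le> 2 * (3 * (\<rho> / (?s * (?s + \<rho>)) + \<rho> / (?t * (?t + \<rho>))))"
          by (intro mult_left_mono kernel_split[OF k(1) r]) simp
        finally have 1: "\<bar>green ?\<kappa> x y - green ?\<kappa> x' y\<bar> \<le> 6 * (\<rho> / (?s * (?s + \<rho>)) + \<rho> / (?t * (?t + \<rho>)))" by simp
        have "norm (green ?\<kappa> x y * lap_comp k y - green ?\<kappa> x' y * lap_comp k y) = \<bar>green ?\<kappa> x y - green ?\<kappa> x' y\<bar> * \<bar>lap_comp k y\<bar>"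
          by (simp add: abs_mult[symmetric] left_diff_distrib del: of_nat_Suc)
        also have "\<dots> \<le> 6 * (\<rho> / (?s * (?s + \<rho>)) + \<rho> / (?t * (?t + \<rho>))) * (g y + tension_norm y)"
          using 1 lap_comp_le[of y k] y by (intro mult_mono) (auto intro: order_trans[OF abs_ge_zero])
        also have "\<dots> = 6 * (?q x y + ?q x' y)" by (simp only: distrib_left distrib_right mult.assoc)
        finally show "norm (green ?\<kappa> x y * lap_comp k y - green ?\<kappa> x' y * lap_comp k y) \<le> 6 * (?q x y + ?q x' y)" .
      qed
      also have "\<dots> = 6 * (potential ?\<kappa> x \<rho> + potential ?\<kappa> x' \<rho>)" unfolding potential_def
        by (simp only: integral_mult_right_zero Bochner_Integration.integral_add[OF potential_int[OF k(1) r(2)] potential_int[OF k(1) r(2)]])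
      also have "\<dots> \<le> 6 * (Z + Z)" using Z[OF k] by (intro mult_left_mono add_mono) auto
      finally show ?thesis by simp
    qed
    have "(\<lambda>n. \<bar>(- integral\<^sup>L ballM (\<lambda>y. green (?k n) x y * lap_comp k y)) - (- integral\<^sup>L ballM (\<lambda>y. green (?k n) x' y * lap_comp k y))\<bar>)
       \<longlonglongrightarrow> \<bar>plummer_mass * u k x - plummer_mass * u k x'\<bar>"
      by (intro tendsto_rabs tendsto_diff green_representation x)
    then have "\<bar>plummer_mass * u k x - plummer_mass * u k x'\<bar> \<le> 12 * Z"
      by (rule LIMSEQ_le_const2) (use bd in auto)
    then have 1: "plummer_mass * \<bar>u k x - u k x'\<bar> \<le> 12 * Z"
      using plummer_mass_ge by (simp add: right_diff_distrib[symmetric] abs_mult)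
    have "1 * \<bar>u k x - u k x'\<bar> \<le> plummer_mass * \<bar>u k x - u k x'\<bar>" by (intro mult_right_mono plummer_mass_ge) auto
    from order_trans[OF this 1] show ?thesis by simp
  qed
  have "norm (d x - d x') \<le> (\<Sum>k\<in>UNIV. \<bar>(d x - d x') $ k\<bar>)" by (rule norm_le_l1_cart)
  also have "\<dots> \<le> (\<Sum>k\<in>(UNIV::3 set). 12 * Z)" using ui by (intro sum_mono) (simp add: u_def)
  finally show ?thesis by simp
qed

end

lemma kernel_le:
  fixes s r :: real assumes "s > 0" "r > 0" shows "r / (s * (s + r)) \<le> 1 / s"
proof -
  have "r / (s * (s + r)) \<le> r / (s * r)"
    using assms by (intro divide_left_mono mult_left_mono mult_pos_pos) auto
  then show ?thesis using assms by simp
qed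

context sphere_map
begin

section \<open>Holder estimate at a scale of small oscillation\<close>

definition near_potential :: "real \<Rightarrow> real^3 \<Rightarrow> real \<Rightarrow> real" where
  "near_potential \<kappa> x r = integral\<^sup>L ballM (\<lambda>y. if sdist \<kappa> x y \<le> r then (g y + tension_norm y) / sdist \<kappa> x y else 0)"

lemma near_potential_int:
  assumes "\<kappa> > 0"
  shows "integrable ballM (\<lambda>y. if sdist \<kappa> x y \<le> r then (g y + tension_norm y) / sdist \<kappa> x y else 0)"
proof (rule Bochner_Integration.integrable_bound[of _ "\<lambda>y. 1 / \<kappa> * (g y + tension_norm y)"])
  show "AE y in ballM. norm (if sdist \<kappa> x y \<le> r then (g y + tension_norm y) / sdist \<kappa> x y else 0) \<le> norm (1 / \<kappa> * (g y + tension_norm y))"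
  proof (rule AE_I2)
    fix y
    have "(g y + tension_norm y) / sdist \<kappa> x y \<le> (g y + tension_norm y) / \<kappa>"
      using sdist_ge(2)[of \<kappa> x y] assms g_nonneg[of y] tension_norm_nonneg[of y] by (intro divide_left_mono mult_pos_pos sdist_pos) auto
    then show "norm (if sdist \<kappa> x y \<le> r then (g y + tension_norm y) / sdist \<kappa> x y else 0) \<le> norm (1 / \<kappa> * (g y + tension_norm y))"
      using assms g_nonneg[of y] tension_norm_nonneg[of y] sdist_pos[OF assms, of x y] by simp
  qed
qed (use gt_int in auto)

text \<open>For \<open>s \<ge> 2 * \<rho>\<close> doubling \<open>\<rho>\<close> enlarges the kernel
  by \<open>2 * (s + \<rho>) / (s + 2 * \<rho>) \<ge> 3 / 2\<close>. The resulting factor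
  \<open>2 / 3\<close> beats the growth \<open>sqrt 2\<close> of the desired bound
  \<open>sqrt \<rho>\<close>, so the recursion over scales closes for exponent one half.\<close>

lemma potential_recursion:
  assumes k: "\<kappa> > 0" and r: "\<rho> > 0"
  shows "potential \<kappa> x \<rho> \<le> near_potential \<kappa> x (2 * \<rho>) + 2 / 3 * potential \<kappa> x (2 * \<rho>)"
proof -
  let ?n = "\<lambda>y. if sdist \<kappa> x y \<le> 2 * \<rho> then (g y + tension_norm y) / sdist \<kappa> x y else 0"
  let ?j = "\<lambda>\<rho> y. \<rho> / (sdist \<kappa> x y * (sdist \<kappa> x y + \<rho>)) * (g y + tension_norm y)"
  have r2: "2 * \<rho> > 0" using r by simp
  have "potential \<kappa> x \<rho> \<le> integral\<^sup>L ballM (\<lambda>y. ?n y + 2 / 3 * ?j (2 * \<rho>) y)"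
    unfolding potential_def
  proof (rule integral_mono[OF potential_int[OF k r] Bochner_Integration.integrable_add[OF near_potential_int[OF k] integrable_mult_right[OF potential_int[OF k r2]]]])
    fix y
    let ?s = "sdist \<kappa> x y"
    have s: "?s > 0" by (rule sdist_pos[OF k])
    have G: "0 \<le> g y + tension_norm y" using g_nonneg[of y] tension_norm_nonneg[of y] by simp
    have j0: "0 \<le> 2 / 3 * ?j (2 * \<rho>) y" using s r G by (intro mult_nonneg_nonneg divide_nonneg_nonneg) auto
    show "?j \<rho> y \<le> ?n y + 2 / 3 * ?j (2 * \<rho>) y"
    proof (cases "?s \<le> 2 * \<rho>")
      case True
      have "\<rho> / (?s * (?s + \<rho>)) \<le> 1 / ?s" using s r by (rule kernel_le)
      from mult_right_mono[OF this G] have "?j \<rho> y \<le> 1 / ?s * (g y + tension_norm y)" .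
      also have "\<dots> = ?n y" using True by simp
      finally show ?thesis using j0 by linarith
    next
      case False
      have "\<rho> / (?s * (?s + \<rho>)) \<le> 2 / 3 * (2 * \<rho> / (?s * (?s + 2 * \<rho>)))"
      proof -
        have "3 * (?s + 2 * \<rho>) \<le> 4 * (?s + \<rho>)" using False by simp
        then have "\<rho> / ?s * (1 / (?s + \<rho>)) \<le> \<rho> / ?s * (4 / (3 * (?s + 2 * \<rho>)))"
          using s r by (intro mult_left_mono) (auto simp: divide_simps)
        then show ?thesis by (simp add: field_simps)
      qed
      then have "?j \<rho> y \<le> 2 / 3 * (2 * \<rho> / (?s * (?s + 2 * \<rho>))) * (g y + tension_norm y)" using G by (rule mult_right_mono)
      then show ?thesis using False by simp
    qed
  qed
  also have "\<dots> = near_potential \<kappa> x (2 * \<rho>) + 2 / 3 * potential \<kappa> x (2 * \<rho>)"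
    unfolding near_potential_def potential_def
    by (simp only: Bochner_Integration.integral_add[OF near_potential_int[OF k] integrable_mult_right[OF potential_int[OF k r2]]] integral_mult_right_zero)
  finally show ?thesis .
qed

lemma near_potential_le:
  assumes "\<kappa> > 0" "s > 0" "norm x < 1" "0 \<le> \<omega>" "\<omega> \<le> 1/2"
    and "\<And>y. norm y \<le> 1 \<Longrightarrow> norm (y - x) \<le> 2 * s \<Longrightarrow> norm (d y - d x) \<le> \<omega>"
  shows "near_potential \<kappa> x (s / 2) \<le> 1280 * \<omega>\<^sup>2 + 141 * \<epsilon> * sqrt s"
  unfolding near_potential_def by (rule caccioppoli[OF assms])

lemma gt_integral: "integral\<^sup>L ballM (\<lambda>y. g y + tension_norm y) \<le> 8"
proof -
  have "\<epsilon>\<^sup>2 \<le> 1" using eps by (simp add: power_le_one)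
  then show ?thesis using g_integral tension_norm_integral g_int tension_norm_int by simp
qed

lemma potential_le_near_potential:
  assumes k: "\<kappa> > 0" and r: "\<rho> > 0" and b: "b > 0"
  shows "potential \<kappa> x \<rho> \<le> near_potential \<kappa> x b + 8 / b"
proof -
  let ?n = "\<lambda>y. if sdist \<kappa> x y \<le> b then (g y + tension_norm y) / sdist \<kappa> x y else 0"
  have "potential \<kappa> x \<rho> \<le> integral\<^sup>L ballM (\<lambda>y. ?n y + 1 / b * (g y + tension_norm y))"
    unfolding potential_def
  proof (rule integral_mono[OF potential_int[OF k r] Bochner_Integration.integrable_add[OF near_potential_int[OF k] integrable_mult_right[OF gt_int]]])
    fix y
    let ?s = "sdist \<kappa> x y"
    have s: "?s > 0" by (rule sdist_pos[OF k])
    have G: "0 \<le> g y + tension_norm y" using g_nonneg[of y] tension_norm_nonneg[of y] by simp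
    have "\<rho> / (?s * (?s + \<rho>)) \<le> 1 / ?s" using s r by (rule kernel_le)
    then have 1: "\<rho> / (?s * (?s + \<rho>)) * (g y + tension_norm y) \<le> 1 / ?s * (g y + tension_norm y)" using G by (rule mult_right_mono)
    show "\<rho> / (?s * (?s + \<rho>)) * (g y + tension_norm y) \<le> ?n y + 1 / b * (g y + tension_norm y)"
    proof (cases "?s \<le> b")
      case True
      have "0 \<le> 1 / b * (g y + tension_norm y)" using b G by (intro mult_nonneg_nonneg) auto
      then show ?thesis using 1 True by simp
    next
      case False
      then have "1 / ?s * (g y + tension_norm y) \<le> 1 / b * (g y + tension_norm y)" using b G by (intro mult_right_mono frac_le) auto
      then show ?thesis using 1 False by simp
    qed
  qed
  also have "\<dots> = near_potential \<kappa> x b + 1 / b * integral\<^sup>L ballM (\<lambda>y. g y + tension_norm y)"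
    unfolding near_potential_def
    by (simp only: Bochner_Integration.integral_add[OF near_potential_int[OF k] integrable_mult_right[OF gt_int]] integral_mult_right_zero)
  also have "\<dots> \<le> near_potential \<kappa> x b + 1 / b * 8" using gt_integral b by (intro add_left_mono mult_left_mono) auto
  finally show ?thesis by simp
qed

text \<open>Shrinking both points towards the centre brings them into the open ball without
  increasing their distance; continuity of \<open>d\<close> up to the sphere does the rest.\<close>

lemma oscillation_closure:
  assumes b: "\<And>x y. norm x < 1 \<Longrightarrow> norm y < 1 \<Longrightarrow> norm (y - x) \<le> r \<Longrightarrow> norm (d y - d x) \<le> q"
    and x: "norm x \<le> 1" "norm y \<le> 1" "norm (y - x) \<le> r"
  shows "norm (d y - d x) \<le> q"
proof -
  define t where "t n = 1 - 1 / real (Suc n)" for n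
  have t: "0 \<le> t n" "t n < 1" for n by (auto simp: t_def)
  have tl: "t \<longlonglongrightarrow> 1" unfolding t_def using tendsto_diff[OF tendsto_const inv_Suc_tendsto, of 1] by simp
  have c: "(\<lambda>n. d (t n *\<^sub>R z)) \<longlonglongrightarrow> d z" if z: "norm z \<le> 1" for z
  proof (rule continuous_on_tendsto_compose[OF cont_d])
    show "(\<lambda>n. t n *\<^sub>R z) \<longlonglongrightarrow> z" using tendsto_scaleR[OF tl tendsto_const[of z]] by simp
    show "\<forall>\<^sub>F n in sequentially. t n *\<^sub>R z \<in> cball 0 1"
      using t z by (intro always_eventually) (auto simp: mult_le_one less_imp_le)
  qed (use z in auto)
  have "(\<lambda>n. norm (d (t n *\<^sub>R y) - d (t n *\<^sub>R x))) \<longlonglongrightarrow> norm (d y - d x)"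
    using x by (intro tendsto_intros c)
  moreover have "norm (d (t n *\<^sub>R y) - d (t n *\<^sub>R x)) \<le> q" for n
  proof (rule b)
    have *: "norm (t n *\<^sub>R z) < 1" if "norm z \<le> 1" for z :: "real^3"
      using t[of n] that mult_left_le[of "norm z" "t n"] by simp
    show "norm (t n *\<^sub>R x) < 1" "norm (t n *\<^sub>R y) < 1" using * x by auto
    have "norm (t n *\<^sub>R y - t n *\<^sub>R x) = t n * norm (y - x)"
      using t[of n] by (simp add: scaleR_diff_right[symmetric])
    also have "\<dots> \<le> norm (y - x)" using t[of n] by (simp add: mult_left_le_one_le)
    finally show "norm (t n *\<^sub>R y - t n *\<^sub>R x) \<le> r" using x by simp
  qed
  ultimately show ?thesis by (intro LIMSEQ_le_const2) auto
qed

text \<open>36 comes from \<open>oscillation_by_potential\<close>, \<open>5076 = 18 * 282\<close>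
  from the recursion at small scales, and \<open>11624 = 8 * 1453\<close> from the scales above
  \<open>r / 8\<close>.\<close>

definition holder_const :: "real \<Rightarrow> real" where "holder_const r = 36 * (5076 + 11624 / r\<^sup>2)"

text \<open>In the quadratic bound for the near potential, one factor of the oscillation is
  estimated by the threshold and the other by the current seminorm \<open>A\<close>. The threshold
  \<open>1 / 10 ^ 7\<close> is small enough that \<open>36 * 18 * 3840 / 10 ^ 7 \<le> 1 / 4\<close>,
  which gives the contraction.\<close>

lemma holder_improvement:
  fixes A r \<delta> :: real
  assumes r: "0 < r" "r \<le> 1" and A: "A \<ge> 0" and del: "\<delta> > 0"
    and osc: "\<And>x y. norm x \<le> 1 \<Longrightarrow> norm y \<le> 1 \<Longrightarrow> norm (y - x) \<le> r \<Longrightarrow> norm (d y - d x) \<le> 1 / 10 ^ 7"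
    and hol: "\<And>x y. norm x \<le> 1 \<Longrightarrow> norm y \<le> 1 \<Longrightarrow> norm (y - x) \<le> 2 \<Longrightarrow> norm (d y - d x) \<le> A * sqrt (norm (y - x) + \<delta>)"
    and x: "norm x \<le> 1" "norm y \<le> 1"
  shows "norm (d y - d x) \<le> (A / 4 + holder_const r) * sqrt (norm (y - x) + \<delta>)"
proof -
  let ?h = "1 / 10 ^ 7 :: real"
  define C where "C = 3840 * ?h * A + 282"
  define B where "B = 18 * C + 11624 / r\<^sup>2"
  have C0: "C \<ge> 0" using A by (simp add: C_def)
  have D0: "11624 / r\<^sup>2 \<ge> 0" by simp
  \<comment> \<open>Induction downwards through dyadic scales. At the top scale the crude bound
    \<open>1280 + 141 + 32 / r \<le> 1453 / r\<close> suffices, because there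
    \<open>sqrt (\<rho> + \<delta>)\<close> is at least \<open>r / 8\<close>.\<close>
  have JB: "potential \<kappa> x \<rho> \<le> B * sqrt (\<rho> + \<delta>)" if "r / (8 * 2 ^ n) < \<rho>" "0 < \<kappa>" "norm x < 1" for n \<rho> \<kappa> x
    using that
  proof (induction n arbitrary: \<rho>)
    case 0
    then have rho: "r / 8 < \<rho>" by simp
    then have rp: "\<rho> > 0" using r by linarith
    have N1: "near_potential \<kappa> x (r / 2 / 2) \<le> 1280 * ?h\<^sup>2 + 141 * \<epsilon> * sqrt (r / 2)"
      by (rule near_potential_le) (use 0 r osc[of x] in auto)
    have "potential \<kappa> x \<rho> \<le> near_potential \<kappa> x (r / 4) + 8 / (r / 4)"
      by (rule potential_le_near_potential) (use 0 r rp in auto)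
    also have "\<dots> \<le> 1280 * 1 + 141 * 1 * 1 + 32 / r"
    proof -
      have "141 * \<epsilon> * sqrt (r / 2) \<le> 141 * 1 * 1" using eps r by (intro mult_mono) auto
      moreover have "1280 * ?h\<^sup>2 \<le> 1280 * 1" by (simp add: power2_eq_square)
      ultimately show ?thesis using N1 by simp
    qed
    also have "\<dots> \<le> 1453 / r"
      using r by (simp add: field_simps)
    also have "\<dots> = 11624 / r\<^sup>2 * (r / 8)" using r by (simp add: power2_eq_square)
    finally have J1: "potential \<kappa> x \<rho> \<le> 11624 / r\<^sup>2 * (r / 8)" .
    have "r / 8 \<le> sqrt (\<rho> + \<delta>)"
    proof (rule real_le_rsqrt)
      have "(r / 8)\<^sup>2 \<le> r / 8" using r by (simp add: power2_eq_square divide_simps)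
      then show "(r / 8)\<^sup>2 \<le> \<rho> + \<delta>" using rho del by linarith
    qed
    then have "potential \<kappa> x \<rho> \<le> 11624 / r\<^sup>2 * sqrt (\<rho> + \<delta>)"
      by (rule order_trans[OF J1 mult_left_mono]) simp
    also have "\<dots> \<le> B * sqrt (\<rho> + \<delta>)"
      unfolding B_def using C0 rp del by (intro mult_right_mono) auto
    finally show ?case .
  next
    case (Suc n)
    have rp: "\<rho> > 0" using Suc.prems(1) r by (smt (verit) divide_pos_pos zero_less_power mult_pos_pos)
    show ?case
    proof (cases "r / (8 * 2 ^ n) < \<rho>")
      case True then show ?thesis using Suc by blast
    next
      case False
      have "r / (8 * 2 ^ n) \<le> r / 8" using r by (intro divide_left_mono) auto
      then have r8: "8 * \<rho> \<le> r" using False by linarith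
      have "r / (8 * 2 ^ n) < 2 * \<rho>" using Suc.prems(1) by (simp add: field_simps)
      from Suc.IH[OF this Suc.prems(2,3)]
      have J2: "potential \<kappa> x (2 * \<rho>) \<le> B * sqrt (2 * \<rho> + \<delta>)" .
      define S where "S = sqrt (\<rho> + \<delta>)"
      have S0: "S > 0" using rp del by (simp add: S_def)
      have s8: "sqrt (8 * \<rho> + \<delta>) \<le> 3 * S"
        unfolding S_def by (rule real_le_lsqrt) (use rp del in \<open>auto simp: power_mult_distrib\<close>)
      \<comment> \<open>\<open>17/12\<close> exceeds \<open>sqrt 2\<close>, yet
        \<open>2/3 * 17/12 = 17/18\<close> is still below 1. This gap of \<open>1/18\<close> is the
        reason for the factor 18 in \<open>B\<close>.\<close>
      have s2: "sqrt (2 * \<rho> + \<delta>) \<le> 17/12 * S"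
        unfolding S_def by (rule real_le_lsqrt) (use rp del in \<open>auto simp: power_mult_distrib power2_eq_square\<close>)
      have s1: "sqrt (4 * \<rho>) \<le> 2 * S"
        unfolding S_def by (rule real_le_lsqrt) (use rp del in \<open>auto simp: power_mult_distrib\<close>)
      \<comment> \<open>Both bounds are kept, so that \<open>\<omega>\<^sup>2\<close> is at most
        their product: linear in \<open>A\<close> with a small coefficient.\<close>
      define \<omega> where "\<omega> = min ?h (A * sqrt (8 * \<rho> + \<delta>))"
      have om: "0 \<le> \<omega>" "\<omega> \<le> ?h" "\<omega> \<le> A * sqrt (8 * \<rho> + \<delta>)" using A rp del by (auto simp: \<omega>_def)
      have "near_potential \<kappa> x (4 * \<rho> / 2) \<le> 1280 * \<omega>\<^sup>2 + 141 * \<epsilon> * sqrt (4 * \<rho>)"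
      proof (rule near_potential_le)
        fix y assume y: "norm y \<le> 1" "norm (y - x) \<le> 2 * (4 * \<rho>)"
        have "norm (d y - d x) \<le> ?h" using osc[of x y] y r8 Suc.prems(3) by simp
        moreover have "norm (d y - d x) \<le> A * sqrt (norm (y - x) + \<delta>)"
          using hol[of x y] y Suc.prems(3) r8 r by simp
        moreover have "A * sqrt (norm (y - x) + \<delta>) \<le> A * sqrt (8 * \<rho> + \<delta>)"
          using y A by (intro mult_left_mono) auto
        ultimately show "norm (d y - d x) \<le> \<omega>" by (simp add: \<omega>_def)
      qed (use Suc.prems rp om in auto)
      also have "\<dots> \<le> 1280 * (?h * (A * (3 * S))) + 141 * 1 * (2 * S)"
      proof -
        have "\<omega>\<^sup>2 \<le> ?h * (A * sqrt (8 * \<rho> + \<delta>))" unfolding power2_eq_square using om by (intro mult_mono) auto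
        also have "\<dots> \<le> ?h * (A * (3 * S))" using s8 A by (intro mult_left_mono) auto
        finally have "1280 * \<omega>\<^sup>2 \<le> 1280 * (?h * (A * (3 * S)))" by simp
        moreover have "141 * \<epsilon> * sqrt (4 * \<rho>) \<le> 141 * 1 * (2 * S)" using eps s1 rp S0 by (intro mult_mono) auto
        ultimately show ?thesis by linarith
      qed
      also have "\<dots> = C * S" by (simp add: C_def algebra_simps)
      finally have N2: "near_potential \<kappa> x (2 * \<rho>) \<le> C * S" by simp
      have B0: "B \<ge> 0" using C0 D0 by (simp add: B_def)
      have "potential \<kappa> x \<rho> \<le> near_potential \<kappa> x (2 * \<rho>) + 2 / 3 * potential \<kappa> x (2 * \<rho>)" by (rule potential_recursion[OF Suc.prems(2) rp])
      also have "\<dots> \<le> C * S + 2 / 3 * (B * (17/12 * S))"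
        using N2 order_trans[OF J2 mult_left_mono[OF s2 B0]] by simp
      also have "\<dots> = (C + 17/18 * B) * S" by (simp add: algebra_simps)
      also have "\<dots> \<le> B * S"
      proof (intro mult_right_mono)
        have "18 * C \<le> B" using D0 by (simp add: B_def)
        then show "C + 17/18 * B \<le> B" by linarith
      qed (use S0 in simp)
      finally show ?thesis by (simp add: S_def)
    qed
  qed
  have main: "norm (d y - d x) \<le> (A / 4 + holder_const r) * sqrt (norm (y - x) + \<delta>)" if x: "norm x < 1" "norm y < 1" for x y
  proof (cases "y = x")
    case True
    then show ?thesis using A r del by (simp add: holder_const_def)
  next
    case False
    define \<rho> where "\<rho> = norm (y - x)"
    have rp: "\<rho> > 0" using False by (simp add: \<rho>_def)
    obtain n where n: "r / 8 / \<rho> < 2 ^ n" using real_arch_pow[of 2] by auto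
    then have n': "r / (8 * 2 ^ n) < \<rho>" using rp by (simp add: field_simps)
    have "norm (d y - d x) \<le> 36 * (B * sqrt (\<rho> + \<delta>))"
      by (rule oscillation_by_potential) (use x rp n' in \<open>auto simp: \<rho>_def intro!: JB[of n]\<close>)
    also have "\<dots> \<le> (A / 4 + holder_const r) * sqrt (\<rho> + \<delta>)"
    proof -
      have "36 * B \<le> A / 4 + holder_const r" unfolding B_def C_def holder_const_def using A by simp
      then have "36 * B * sqrt (\<rho> + \<delta>) \<le> (A / 4 + holder_const r) * sqrt (\<rho> + \<delta>)" using rp del by (intro mult_right_mono) auto
      then show ?thesis by simp
    qed
    finally show ?thesis by (simp add: \<rho>_def)
  qed
  show ?thesis
  proof (rule oscillation_closure[OF _ x order_refl])
    fix a b :: "real^3" assume ab: "norm a < 1" "norm b < 1" "norm (b - a) \<le> norm (y - x)"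
    have "A / 4 + holder_const r \<ge> 0" using A by (simp add: holder_const_def)
    then have "(A / 4 + holder_const r) * sqrt (norm (b - a) + \<delta>) \<le> (A / 4 + holder_const r) * sqrt (norm (y - x) + \<delta>)"
      using ab by (intro mult_left_mono) auto
    with main[OF ab(1,2)] show "norm (d b - d a) \<le> (A / 4 + holder_const r) * sqrt (norm (y - x) + \<delta>)" by linarith
  qed
qed

text \<open>For \<open>\<delta> > 0\<close> the seminorm is finite a priori, since unit vectors
  differ by at most 2; this gives the start \<open>2 / sqrt \<delta>\<close>. Each improvement
  quarters the excess over \<open>2 * holder_const r\<close>, so the limit is independent of
  \<open>\<delta>\<close>, which may then tend to zero.\<close>

lemma holder_estimate:
  assumes r: "0 < r" "r \<le> 1"
    and osc: "\<And>x y. norm x \<le> 1 \<Longrightarrow> norm y \<le> 1 \<Longrightarrow> norm (y - x) \<le> r \<Longrightarrow> norm (d y - d x) \<le> 1 / 10 ^ 7"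
    and x: "norm x \<le> 1" "norm y \<le> 1"
  shows "norm (d y - d x) \<le> 2 * holder_const r * sqrt (norm (y - x))"
proof -
  have K0: "holder_const r \<ge> 0" by (simp add: holder_const_def)
  have del: "norm (d y - d x) \<le> 2 * holder_const r * sqrt (norm (y - x) + \<delta>)" if dp: "\<delta> > 0" for \<delta>
  proof -
    let ?A0 = "2 / sqrt \<delta>"
    have A0: "?A0 \<ge> 0" using dp by simp
    have it: "norm (d y - d x) \<le> (?A0 / 4 ^ n + 2 * holder_const r) * sqrt (norm (y - x) + \<delta>)"
      if "norm x \<le> 1" "norm y \<le> 1" for n x y
      using that
    proof (induction n arbitrary: x y)
      case 0
      have "norm (d y - d x) \<le> 2" using norm_triangle_ineq4[of "d y" "d x"] norm_d[of x] norm_d[of y] 0 by simp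
      also have "2 = ?A0 * sqrt \<delta>" using dp by simp
      also have "\<dots> \<le> (?A0 / 4 ^ 0 + 2 * holder_const r) * sqrt (norm (y - x) + \<delta>)"
        using K0 dp by (intro mult_mono) auto
      finally show ?case .
    next
      case (Suc n)
      have "norm (d y - d x) \<le> ((?A0 / 4 ^ n + 2 * holder_const r) / 4 + holder_const r) * sqrt (norm (y - x) + \<delta>)"
        by (rule holder_improvement[OF r _ dp osc Suc.IH Suc.prems]) (use A0 K0 in auto)
      also have "\<dots> \<le> (?A0 / 4 ^ Suc n + 2 * holder_const r) * sqrt (norm (y - x) + \<delta>)"
        using K0 dp by (intro mult_right_mono) (auto simp: add_divide_distrib)
      finally show ?case .
    qed
    have l: "(\<lambda>n. ?A0 * (1 / 4) ^ n) \<longlonglongrightarrow> ?A0 * 0" by (intro tendsto_intros LIMSEQ_realpow_zero) auto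
    have "(\<lambda>n. (?A0 * (1 / 4) ^ n + 2 * holder_const r) * sqrt (norm (y - x) + \<delta>)) \<longlonglongrightarrow> (?A0 * 0 + 2 * holder_const r) * sqrt (norm (y - x) + \<delta>)"
      by (intro tendsto_intros l)
    then have "norm (d y - d x) \<le> (?A0 * 0 + 2 * holder_const r) * sqrt (norm (y - x) + \<delta>)"
      by (rule LIMSEQ_le_const) (use it[OF x] in \<open>auto simp: power_divide\<close>)
    then show ?thesis by simp
  qed
  have "(\<lambda>n. 2 * holder_const r * sqrt (norm (y - x) + 1 / real (Suc n))) \<longlonglongrightarrow> 2 * holder_const r * sqrt (norm (y - x) + 0)"
    by (intro tendsto_intros inv_Suc_tendsto)
  then have "norm (d y - d x) \<le> 2 * holder_const r * sqrt (norm (y - x) + 0)"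
    by (rule LIMSEQ_le_const) (use del in auto)
  then show ?thesis by simp
qed

end

section \<open>Dilations and square-integrable differences\<close>

lemma C1_on_dilate:
  assumes f: "C1_on UNIV f G"
  shows "C1_on UNIV (\<lambda>y. f (y + t *\<^sub>R (y - p))) (\<lambda>y. (1 + t) *\<^sub>R G (y + t *\<^sub>R (y - p)))"
  unfolding C1_on_def
proof safe
  fix y
  have "((\<lambda>y. f (y + t *\<^sub>R (y - p))) has_derivative (\<lambda>h. G (y + t *\<^sub>R (y - p)) \<bullet> (h + t *\<^sub>R h))) (at y)"
    by (rule has_derivative_compose[OF _ C1_on_deriv[OF f UNIV_I]])
       (auto intro!: derivative_eq_intros)
  then show "((\<lambda>y. f (y + t *\<^sub>R (y - p))) has_derivative (\<bullet>) ((1 + t) *\<^sub>R G (y + t *\<^sub>R (y - p)))) (at y)"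
    by (rule has_derivative_eq_rhs) (auto simp: fun_eq_iff inner_add_right algebra_simps)
next
  show "continuous_on UNIV (\<lambda>y. (1 + t) *\<^sub>R G (y + t *\<^sub>R (y - p)))"
    by (intro continuous_intros continuous_on_compose2[OF C1_on_cont_grad[OF f]]) auto
qed

text \<open>Jensen's inequality for the square on the unit interval, obtained by integrating
  \<open>2 * c * D - c\<^sup>2 \<le> D\<^sup>2\<close> with \<open>D\<close> the derivative along
  the segment and \<open>c\<close> its mean.\<close>

lemma segment_difference_sq:
  assumes f: "C1_on UNIV f G"
  shows "ennreal ((f (y + v) - f y)\<^sup>2) \<le> (\<integral>\<^sup>+\<theta>. ennreal ((norm v)\<^sup>2 * (norm (G (y + \<theta> *\<^sub>R v)))\<^sup>2) * indicator {0..1::real} \<theta> \<partial>lborel)"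
proof -
  let ?F = "\<lambda>\<theta>. f (y + \<theta> *\<^sub>R v)" and ?D = "\<lambda>\<theta>. G (y + \<theta> *\<^sub>R v) \<bullet> v"
  let ?c = "f (y + v) - f y"
  let ?Q = "\<lambda>\<theta>. (norm v)\<^sup>2 * (norm (G (y + \<theta> *\<^sub>R v)))\<^sup>2"
  have cG: "continuous_on UNIV (\<lambda>\<theta>. G (y + \<theta> *\<^sub>R v))"
    by (intro continuous_intros continuous_on_compose2[OF C1_on_cont_grad[OF f]]) auto
  have cD: "continuous_on UNIV ?D" by (intro continuous_intros cG)
  have der: "(?F has_real_derivative ?D \<theta>) (at \<theta>)" for \<theta>
  proof -
    have "(?F has_derivative (\<lambda>h. G (y + \<theta> *\<^sub>R v) \<bullet> (h *\<^sub>R v))) (at \<theta>)"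
      by (rule has_derivative_compose[OF _ C1_on_deriv[OF f UNIV_I]]) (auto intro!: derivative_eq_intros)
    then show ?thesis by (simp add: has_field_derivative_def mult_commute_abs)
  qed
  have F: "has_bochner_integral lborel (\<lambda>\<theta>. ?D \<theta> * indicator {0..1} \<theta>) ?c"
    using has_bochner_integral_FTC_Icc_real[of 0 1 ?F ?D] der cD
    by (simp add: continuous_on_eq_continuous_at)
  have one: "has_bochner_integral lborel (\<lambda>\<theta>. indicator {0..1::real} \<theta>) (1::real)"
    by (simp add: has_bochner_integral_iff)
  have L: "has_bochner_integral lborel (\<lambda>\<theta>. 2 * ?c * (?D \<theta> * indicator {0..1} \<theta>) - ?c\<^sup>2 * indicator {0..1} \<theta>) (2 * ?c * ?c - ?c\<^sup>2 * 1)"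
    by (intro has_bochner_integral_diff has_bochner_integral_mult_right F one)
  have Qi: "integrable lborel (\<lambda>\<theta>. ?Q \<theta> * indicator {0..1} \<theta>)"
  proof -
    have "continuous_on {0..1} ?Q" by (intro continuous_intros continuous_on_subset[OF cG]) auto
    then have "integrable lborel (\<lambda>\<theta>. indicator {0..1} \<theta> *\<^sub>R ?Q \<theta>)"
      using borel_integrable_compact[of "{0..1}" ?Q] by (auto simp: set_integrable_def)
    then show ?thesis by (simp add: mult.commute)
  qed
  have "?c\<^sup>2 = integral\<^sup>L lborel (\<lambda>\<theta>. 2 * ?c * (?D \<theta> * indicator {0..1} \<theta>) - ?c\<^sup>2 * indicator {0..1} \<theta>)"
    using has_bochner_integral_integral_eq[OF L] by (simp add: power2_eq_square)
  also have "\<dots> \<le> integral\<^sup>L lborel (\<lambda>\<theta>. ?Q \<theta> * indicator {0..1} \<theta>)"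
  proof (rule integral_mono)
    fix \<theta>
    have "\<bar>?D \<theta>\<bar> \<le> norm (G (y + \<theta> *\<^sub>R v)) * norm v" by (rule Cauchy_Schwarz_ineq2)
    then have "\<bar>?D \<theta>\<bar>\<^sup>2 \<le> (norm (G (y + \<theta> *\<^sub>R v)) * norm v)\<^sup>2" by (rule power_mono) simp
    then have "(?D \<theta>)\<^sup>2 \<le> ?Q \<theta>" by (simp add: power_mult_distrib mult.commute)
    moreover have "2 * ?c * ?D \<theta> - ?c\<^sup>2 \<le> (?D \<theta>)\<^sup>2" using sum_squares_bound[of ?c "?D \<theta>"] by simp
    ultimately show "2 * ?c * (?D \<theta> * indicator {0..1} \<theta>) - ?c\<^sup>2 * indicator {0..1} \<theta> \<le> ?Q \<theta> * indicator {0..1} \<theta>"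
      by (auto simp: indicator_def)
  qed (use Qi has_bochner_integral_iff[THEN iffD1, OF L] in auto)
  finally have "ennreal (?c\<^sup>2) \<le> ennreal (integral\<^sup>L lborel (\<lambda>\<theta>. ?Q \<theta> * indicator {0..1} \<theta>))" by (rule ennreal_leI)
  also have "\<dots> = (\<integral>\<^sup>+\<theta>. ennreal (?Q \<theta> * indicator {0..1} \<theta>) \<partial>lborel)"
    by (rule nn_integral_eq_integral[symmetric, OF Qi]) auto
  also have "\<dots> = (\<integral>\<^sup>+\<theta>. ennreal (?Q \<theta>) * indicator {0..1} \<theta> \<partial>lborel)"
    by (intro nn_integral_cong) (auto simp: indicator_def)
  finally show ?thesis .
qed

text \<open>Write the difference along segments and exchange the integrals. Each intermediate
  dilation has factor \<open>1 + \<theta> * t \<ge> 1\<close>, so the change of variables only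
  helps, and the factor \<open>\<zeta>\<close> compensates for displacements that grow with
  \<open>norm (y - p)\<close>.\<close>

lemma dilation_difference_L2:
  fixes f :: "'a::euclidean_space \<Rightarrow> real"
  assumes f: "C1_on UNIV f G" and t: "t \<ge> 0" and z: "\<And>y. \<bar>\<zeta> y\<bar> * norm (y - p) \<le> 1"
  shows "(\<integral>\<^sup>+y. ennreal ((\<zeta> y * (f (y + t *\<^sub>R (y - p)) - f y))\<^sup>2) \<partial>lborel)
     \<le> ennreal (t\<^sup>2) * (\<integral>\<^sup>+y. ennreal ((norm (G y))\<^sup>2) \<partial>lborel)"
proof -
  have [measurable]: "G \<in> borel_measurable borel" using C1_on_cont_grad[OF f] by (rule borel_measurable_continuous_onI)
  let ?E = "\<lambda>\<theta> y. ennreal ((norm (G (y + \<theta> *\<^sub>R t *\<^sub>R (y - p))))\<^sup>2) * indicator {0..1::real} \<theta>"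
  have pt: "ennreal ((\<zeta> y * (f (y + t *\<^sub>R (y - p)) - f y))\<^sup>2) \<le> ennreal (t\<^sup>2) * (\<integral>\<^sup>+\<theta>. ?E \<theta> y \<partial>lborel)" for y
  proof -
    let ?v = "t *\<^sub>R (y - p)"
    have "ennreal ((\<zeta> y * (f (y + ?v) - f y))\<^sup>2) = ennreal ((\<zeta> y)\<^sup>2) * ennreal ((f (y + ?v) - f y)\<^sup>2)"
      by (simp add: power_mult_distrib ennreal_mult)
    also have "\<dots> \<le> ennreal ((\<zeta> y)\<^sup>2) * (\<integral>\<^sup>+\<theta>. ennreal ((norm ?v)\<^sup>2 * (norm (G (y + \<theta> *\<^sub>R ?v)))\<^sup>2) * indicator {0..1::real} \<theta> \<partial>lborel)"
      by (intro mult_left_mono segment_difference_sq[OF f]) simp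
    also have "\<dots> = ennreal ((\<zeta> y)\<^sup>2 * (norm ?v)\<^sup>2) * (\<integral>\<^sup>+\<theta>. ?E \<theta> y \<partial>lborel)"
      by (subst nn_integral_cmult[symmetric], measurable)
         (auto simp: nn_integral_cmult[symmetric] ennreal_mult mult.assoc intro!: nn_integral_cong)
    also have "\<dots> \<le> ennreal (t\<^sup>2) * (\<integral>\<^sup>+\<theta>. ?E \<theta> y \<partial>lborel)"
    proof (intro mult_right_mono ennreal_leI)
      have "(\<bar>\<zeta> y\<bar> * norm (y - p))\<^sup>2 \<le> 1\<^sup>2" using z[of y] by (intro power_mono) auto
      then have "t\<^sup>2 * (\<bar>\<zeta> y\<bar> * norm (y - p))\<^sup>2 \<le> t\<^sup>2 * 1" by (intro mult_left_mono) auto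
      then show "(\<zeta> y)\<^sup>2 * (norm ?v)\<^sup>2 \<le> t\<^sup>2" by (simp add: power_mult_distrib mult_ac)
    qed simp
    finally show ?thesis .
  qed
  have "(\<integral>\<^sup>+y. ennreal ((\<zeta> y * (f (y + t *\<^sub>R (y - p)) - f y))\<^sup>2) \<partial>lborel)
     \<le> (\<integral>\<^sup>+y. ennreal (t\<^sup>2) * (\<integral>\<^sup>+\<theta>. ?E \<theta> y \<partial>lborel) \<partial>lborel)"
    by (intro nn_integral_mono pt)
  also have "\<dots> = ennreal (t\<^sup>2) * (\<integral>\<^sup>+y. (\<integral>\<^sup>+\<theta>. ?E \<theta> y \<partial>lborel) \<partial>lborel)"
    by (rule nn_integral_cmult) measurable
  also have "(\<integral>\<^sup>+y. (\<integral>\<^sup>+\<theta>. ?E \<theta> y \<partial>lborel) \<partial>lborel) = (\<integral>\<^sup>+\<theta>. (\<integral>\<^sup>+y. ?E \<theta> y \<partial>lborel) \<partial>lborel)"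
    by (rule lborel_pair.Fubini') measurable
  also have "\<dots> \<le> (\<integral>\<^sup>+\<theta>. (\<integral>\<^sup>+y. ennreal ((norm (G y))\<^sup>2) \<partial>lborel) * indicator {0..1::real} \<theta> \<partial>lborel)"
  proof (rule nn_integral_mono)
    fix \<theta> :: real
    show "(\<integral>\<^sup>+y. ?E \<theta> y \<partial>lborel) \<le> (\<integral>\<^sup>+y. ennreal ((norm (G y))\<^sup>2) \<partial>lborel) * indicator {0..1::real} \<theta>"
    proof (cases "\<theta> \<in> {0..1}")
      case True
      define c where "c = 1 + \<theta> * t"
      have c: "c \<ge> 1" using True t by (simp add: c_def)
      have e: "y + \<theta> *\<^sub>R t *\<^sub>R (y - p) = (- (\<theta> * t)) *\<^sub>R p + c *\<^sub>R y" for y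
        by (simp add: c_def algebra_simps)
      let ?I = "\<integral>\<^sup>+y. ennreal ((norm (G ((- (\<theta> * t)) *\<^sub>R p + c *\<^sub>R y)))\<^sup>2) \<partial>lborel"
      have "?I \<le> \<bar>c\<bar> ^ DIM('a) * ?I"
      proof -
        have "1 \<le> \<bar>c\<bar> ^ DIM('a)" using c by (intro one_le_power) auto
        then have "ennreal 1 \<le> ennreal (\<bar>c\<bar> ^ DIM('a))" by (rule ennreal_leI)
        from mult_right_mono[OF this, of ?I] show ?thesis by simp
      qed
      also have "\<dots> = (\<integral>\<^sup>+y. ennreal ((norm (G y))\<^sup>2) \<partial>lborel)"
        using lborel_nn_integral_affine[of "\<lambda>y. ennreal ((norm (G y))\<^sup>2)" c "(- (\<theta> * t)) *\<^sub>R p"] c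
        by (simp add: ennreal_power)
      finally show ?thesis using True unfolding e by simp
    qed simp
  qed
  also have "\<dots> = (\<integral>\<^sup>+y. ennreal ((norm (G y))\<^sup>2) \<partial>lborel)"
    by (subst nn_integral_cmult) auto
  finally show ?thesis by (simp add: mult_left_mono)
qed

section \<open>Monotonicity up to the boundary\<close>

text \<open>Homogeneous of degree -1 when \<open>y - p\<close> and \<open>R\<close> are scaled
  together, so a dilation turns it into the weight of another radius. Softening by \<open>R\<close>
  makes it differentiable at \<open>p\<close>.\<close>

definition dil_weight :: "real \<Rightarrow> real^3 \<Rightarrow> real^3 \<Rightarrow> real" where "dil_weight R p y = 1 / (sdist R p y + R)"

definition dil_weight_grad :: "real \<Rightarrow> real^3 \<Rightarrow> real^3 \<Rightarrow> real^3" where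
  "dil_weight_grad R p y = (- 1 / (sdist R p y * (sdist R p y + R)\<^sup>2)) *\<^sub>R (y - p)"

abbreviation dilate :: "real^3 \<Rightarrow> real \<Rightarrow> real^3 \<Rightarrow> real^3" where "dilate p t y \<equiv> y + t *\<^sub>R (y - p)"

context fixes R :: real and p :: "real^3" assumes R: "R > 0"
begin

lemma C1_dil_weight: "C1_on UNIV (dil_weight R p) (dil_weight_grad R p)"
proof -
  let ?q = "\<lambda>t. t / (1 + R * t)" and ?q' = "\<lambda>t. 1 / (1 + R * t)\<^sup>2"
  have s: "sdist R p y > 0" for y by (rule sdist_pos[OF R])
  have n: "1 + R * (1 / sdist R p y) \<noteq> 0" for y using s[of y] R by (simp add: add_nonneg_eq_0_iff)
  have C: "C1_on UNIV (\<lambda>y. ?q (1 / sdist R p y)) (\<lambda>y. ?q' (1 / sdist R p y) *\<^sub>R ((- 1 / sdist R p y ^ 3) *\<^sub>R (y - p)))"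
  proof (rule C1_on_compose_real[OF C2_on_C1[OF C2_on_newton[OF R]]])
    show "(?q has_real_derivative ?q' (1 / sdist R p y)) (at (1 / sdist R p y))" for y
      using n[of y] by (auto intro!: derivative_eq_intros simp: power2_eq_square)
    show "continuous_on (range (\<lambda>y. 1 / sdist R p y)) ?q'"
      using n by (intro continuous_intros) auto
  qed
  have e1: "?q (1 / sdist R p y) = dil_weight R p y" for y
    using s[of y] R by (simp add: dil_weight_def divide_simps)
  have e2: "?q' (1 / sdist R p y) *\<^sub>R ((- 1 / sdist R p y ^ 3) *\<^sub>R (y - p)) = dil_weight_grad R p y" for y
  proof -
    have "1 / (1 + R * (1 / a))\<^sup>2 * (- 1 / a ^ 3) = - 1 / (a * (a + R)\<^sup>2)" if "a > 0" for a
    proof -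
      have "(1 + R * (1 / a))\<^sup>2 = (a + R)\<^sup>2 / a\<^sup>2" using that by (simp add: power_divide[symmetric] add_divide_distrib)
      then show ?thesis using that by (simp add: field_simps power2_eq_square power3_eq_cube)
    qed
    then show ?thesis unfolding scaleR_scaleR dil_weight_grad_def using s by simp
  qed
  show ?thesis using C unfolding e1 e2 .
qed

lemma dil_weight_bounds: "0 < dil_weight R p y" "dil_weight R p y \<le> 1 / R" "\<bar>dil_weight R p y\<bar> * norm (y - p) \<le> 1"
proof -
  have s: "sdist R p y > 0" by (rule sdist_pos[OF R])
  show "0 < dil_weight R p y" "dil_weight R p y \<le> 1 / R" using s R by (auto simp: dil_weight_def frac_le)
  show "\<bar>dil_weight R p y\<bar> * norm (y - p) \<le> 1"
    using sdist_ge(1)[of R y p] s R by (simp add: dil_weight_def divide_le_eq)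
qed

lemma dil_weight_grad_bound: "norm (dil_weight_grad R p y) \<le> dil_weight R p y * (1 / R)"
proof -
  have s: "sdist R p y > 0" by (rule sdist_pos[OF R])
  have "norm (dil_weight_grad R p y) = norm (y - p) / sdist R p y * (1 / (sdist R p y + R)\<^sup>2)"
    using s R by (simp add: dil_weight_grad_def abs_mult)
  also have "\<dots> \<le> 1 * (1 / (sdist R p y + R)\<^sup>2)"
    using sdist_ge(1)[of R y p] s R by (intro mult_right_mono) (auto simp: divide_le_eq)
  also have "\<dots> = dil_weight R p y * dil_weight R p y" by (simp add: dil_weight_def power2_eq_square)
  also have "\<dots> \<le> dil_weight R p y * (1 / R)" using dil_weight_bounds[of y] by (intro mult_left_mono) auto
  finally show ?thesis .
qed

lemma dil_weight_cont: "continuous_on UNIV (dil_weight R p)" "continuous_on UNIV (dil_weight_grad R p)"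
  using C1_on_cont[OF C1_dil_weight] C1_on_cont_grad[OF C1_dil_weight] by auto

lemma dil_weight_meas [measurable]: "dil_weight R p \<in> borel_measurable borel" "dil_weight_grad R p \<in> borel_measurable borel"
  using dil_weight_cont by (auto intro: borel_measurable_continuous_onI)

lemma dil_weight_grad_dot: "dil_weight_grad R p y \<bullet> v = - 1 / (sdist R p y * (sdist R p y + R)\<^sup>2) * ((y - p) \<bullet> v)"
  by (simp add: dil_weight_grad_def)

lemma sdist_dilate: "t \<ge> 0 \<Longrightarrow> sdist (R * (1 + t)) p (dilate p t y) = (1 + t) * sdist R p y"
proof -
  assume t: "t \<ge> 0"
  have "dilate p t y - p = (1 + t) *\<^sub>R (y - p)" by (simp add: algebra_simps)
  then have n: "norm (dilate p t y - p) = (1 + t) * norm (y - p)" using t by simp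
  have "(norm (dilate p t y - p))\<^sup>2 + (R * (1 + t))\<^sup>2 = (1 + t)\<^sup>2 * ((norm (y - p))\<^sup>2 + R\<^sup>2)"
    unfolding n by (simp add: power2_eq_square algebra_simps)
  then show ?thesis using t by (simp add: sdist_def real_sqrt_mult)
qed

text \<open>Going from \<open>R\<close> to \<open>R * (1 + t)\<close> the softened distance does not
  decrease, so the denominator grows by at least \<open>R * t\<close> and at most by the factor
  \<open>1 + t\<close>. The loss in the weight is the density that monotonicity controls.\<close>

lemma weight_gain:
  assumes t: "t \<ge> 0"
  shows "1 / (sdist (R * (1 + t)) p y + R * (1 + t)) - dil_weight R p y \<le> - (t / (1 + t)) * (R / (sdist R p y + R)\<^sup>2)"
proof -
  let ?s = "sdist R p y" and ?s' = "sdist (R * (1 + t)) p y"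
  have s: "?s > 0" by (rule sdist_pos[OF R])
  have a: "?s \<le> ?s'" unfolding sdist_def using R t by (intro real_sqrt_le_mono add_left_mono power_mono) auto
  have b: "?s' \<le> (1 + t) * ?s"
  proof -
    have "(norm (y - p))\<^sup>2 * 1 \<le> (norm (y - p))\<^sup>2 * (1 + t)\<^sup>2" using t by (intro mult_left_mono one_le_power) auto
    then have "(norm (y - p))\<^sup>2 + (R * (1 + t))\<^sup>2 \<le> (1 + t)\<^sup>2 * ((norm (y - p))\<^sup>2 + R\<^sup>2)"
      unfolding power_mult_distrib[of R] distrib_left[of "(1 + t)\<^sup>2"] by (simp add: mult.commute)
    then have "?s' \<le> sqrt ((1 + t)\<^sup>2 * ((norm (y - p))\<^sup>2 + R\<^sup>2))" unfolding sdist_def by (rule real_sqrt_le_mono)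
    also have "\<dots> = (1 + t) * ?s" unfolding sdist_def real_sqrt_mult using t by simp
    finally show ?thesis .
  qed
  define A where "A = ?s + R"
  define B where "B = ?s' + R * (1 + t)"
  have A: "A > 0" using s R by (simp add: A_def)
  have BA: "B \<ge> A + R * t" using a by (simp add: A_def B_def algebra_simps)
  have BA': "B \<le> (1 + t) * A" using b by (simp add: A_def B_def algebra_simps)
  have Bp: "B > 0" using A BA R t mult_nonneg_nonneg[of R t] by linarith
  have "t / (1 + t) * (R / A\<^sup>2) = R * t / (((1 + t) * A) * A)" by (simp add: power2_eq_square mult_ac)
  also have "\<dots> \<le> R * t / (B * A)" using R t A Bp BA' by (intro divide_left_mono mult_right_mono mult_pos_pos mult_nonneg_nonneg) auto
  also have "\<dots> \<le> (B - A) / (B * A)" using BA A Bp by (intro divide_right_mono) auto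
  also have "\<dots> = 1 / A - 1 / B" using A Bp by (simp add: field_simps)
  finally show ?thesis by (simp add: dil_weight_def A_def B_def)
qed

end

lemma ballM_of_lborel: "integrable lborel (f :: real^3 \<Rightarrow> real) \<Longrightarrow> integrable ballM f"
  unfolding ballM_integrable_iff by (rule integrable_mult_indicator[of _ _ f, simplified]) auto

context sphere_map
begin

section \<open>Extension across the sphere and its truncations\<close>

definition ext_u :: "3 \<Rightarrow> real^3 \<Rightarrow> real" where "ext_u k z = (if norm z < 1 then u k z else 0)"
definition ext_grad_sq :: "3 \<Rightarrow> real^3 \<Rightarrow> real" where "ext_grad_sq k z = (if norm z < 1 then (norm (grad_comp k z))\<^sup>2 else 0)"
definition ext_d :: "real^3 \<Rightarrow> real^3" where "ext_d z = (if norm z < 1 then d z else e3)"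
definition trunc_u :: "nat \<Rightarrow> 3 \<Rightarrow> real^3 \<Rightarrow> real" where
  "trunc_u n k z = (if z \<in> ball 0 1 then odd_trunc (1 / real (Suc n)) (u k z) else 0)"
definition trunc_grad :: "nat \<Rightarrow> 3 \<Rightarrow> real^3 \<Rightarrow> real^3" where
  "trunc_grad n k z = (if z \<in> ball 0 1 then odd_trunc1 (1 / real (Suc n)) (u k z) *\<^sub>R grad_comp k z else 0)"

lemma ext_u_meas [measurable]: "ext_u k \<in> borel_measurable borel"
proof -
  have "(\<lambda>x. indicator (ball 0 1) x *\<^sub>R u k x) \<in> borel_measurable borel"
    by (rule borel_measurable_continuous_on_indicator) (auto intro: C1_on_cont[OF C1_u])
  moreover have "(\<lambda>x. indicator (ball 0 1) x *\<^sub>R u k x) = ext_u k" by (auto simp: ext_u_def indicator_def)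
  ultimately show ?thesis by simp
qed

lemma ext_grad_sq_eq_ind: "ext_grad_sq k = (\<lambda>x. indicator (ball 0 1) x * (norm (grad_comp k x))\<^sup>2)"
  by (auto simp: ext_grad_sq_def indicator_def)

lemma ext_grad_sq_int: "integrable lborel (ext_grad_sq k)"
  using grad_comp_sq_int[of k] unfolding ballM_integrable_iff ext_grad_sq_eq_ind .

lemma ext_grad_sq_meas [measurable]: "ext_grad_sq k \<in> borel_measurable borel"
  using ext_grad_sq_int[of k] by auto

lemma ext_grad_sq_nonneg: "0 \<le> ext_grad_sq k z" by (simp add: ext_grad_sq_def)

lemma ext_u_bound: "\<bar>ext_u k z\<bar> \<le> 2" using u_bound[of z k] by (simp add: ext_u_def)

lemma level_pos: "1 / real (Suc n) > 0" by simp

lemma C1_trunc_u: "C1_on UNIV (trunc_u n k) (trunc_grad n k)"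
  unfolding trunc_u_def[abs_def] trunc_grad_def[abs_def]
proof (rule C1_on_extend_zero[OF _ open_ball u_level_compact[OF level_pos]])
  show "C1_on (ball 0 1) (\<lambda>z. odd_trunc (1 / real (Suc n)) (u k z)) (\<lambda>z. odd_trunc1 (1 / real (Suc n)) (u k z) *\<^sub>R grad_comp k z)"
    by (rule C1_on_of_deriv[OF C1_u DERIV_odd_trunc[OF level_pos] odd_trunc_cont(2)[OF level_pos]])
  fix x assume "x \<in> ball 0 1 - {x. norm x \<le> 1 \<and> 1 / real (Suc n) \<le> \<bar>u k x\<bar>}"
  then show "odd_trunc (1 / real (Suc n)) (u k x) = 0" by (intro odd_trunc_small(1)[OF level_pos]) auto
qed

lemma trunc_u_support: "trunc_u n k z \<noteq> 0 \<Longrightarrow> norm z \<le> 1 \<and> 1 / real (Suc n) \<le> \<bar>u k z\<bar>"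
  using odd_trunc_small(1)[OF level_pos, of "u k z" n] by (auto simp: trunc_u_def split: if_splits) (meson not_less less_imp_le)

lemma trunc_u_bound: "\<bar>trunc_u n k z\<bar> \<le> 2"
  using odd_trunc_bounds(1)[OF level_pos, of n "u k z"] u_bound[of z k] by (auto simp: trunc_u_def)

lemma trunc_u_tendsto: "(\<lambda>n. trunc_u n k z) \<longlonglongrightarrow> ext_u k z"
  using odd_trunc_tendsto[of "u k z"] by (simp add: trunc_u_def ext_u_def)

lemma trunc_grad_sq_le: "(norm (trunc_grad n k z))\<^sup>2 \<le> ext_grad_sq k z"
proof (cases "norm z < 1")
  case True
  have "\<bar>odd_trunc1 (1 / real (Suc n)) (u k z)\<bar>\<^sup>2 \<le> 1\<^sup>2"
    using odd_trunc1_bounds[OF level_pos, of n "u k z"] by (intro power_mono) auto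
  then have "\<bar>odd_trunc1 (1 / real (Suc n)) (u k z)\<bar>\<^sup>2 * (norm (grad_comp k z))\<^sup>2 \<le> 1 * (norm (grad_comp k z))\<^sup>2" by (intro mult_right_mono) auto
  then show ?thesis using True by (simp add: trunc_grad_def ext_grad_sq_def power_mult_distrib)
qed (simp add: trunc_grad_def ext_grad_sq_def)

lemma trunc_u_meas [measurable]: "trunc_u n k \<in> borel_measurable borel" "trunc_grad n k \<in> borel_measurable borel"
  using C1_on_cont[OF C1_trunc_u] C1_on_cont_grad[OF C1_trunc_u] by (auto intro: borel_measurable_continuous_onI)

lemma ballM_integral_ext_grad_sq: "integral\<^sup>L lborel (ext_grad_sq k) = integral\<^sup>L ballM (\<lambda>y. (norm (grad_comp k y))\<^sup>2)"
  unfolding ballM_integral_eq ext_grad_sq_eq_ind ..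

lemma sum_ext_grad_sq: "norm y < 1 \<Longrightarrow> (\<Sum>k\<in>UNIV. ext_grad_sq k y) = g y"
  by (simp add: ext_grad_sq_def g_eq)

lemma sum_integral_ext_grad_sq: "(\<Sum>k\<in>UNIV. integral\<^sup>L lborel (ext_grad_sq k)) = integral\<^sup>L ballM g"
  unfolding ballM_integral_ext_grad_sq g_eq[abs_def]
  by (rule Bochner_Integration.integral_sum[symmetric]) (rule grad_comp_sq_int)

text \<open>The extension need not be \<open>C1\<close> across the sphere, so the estimate is made
  for the truncations, whose gradients are no larger, and then passes to the limit.\<close>

lemma difference_L2:
  assumes R: "R > 0" and t: "t \<ge> 0"
  shows "integrable ballM (\<lambda>y. (dil_weight R p y * (ext_u k (dilate p t y) - ext_u k y))\<^sup>2)"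
    and "integral\<^sup>L ballM (\<lambda>y. (dil_weight R p y * (ext_u k (dilate p t y) - ext_u k y))\<^sup>2) \<le> t\<^sup>2 * integral\<^sup>L lborel (ext_grad_sq k)"
proof -
  note [measurable] = dil_weight_meas[OF R]
  let ?F = "\<lambda>n y. (dil_weight R p y * (trunc_u n k (dilate p t y) - trunc_u n k y))\<^sup>2"
  let ?L = "\<lambda>y. (dil_weight R p y * (ext_u k (dilate p t y) - ext_u k y))\<^sup>2"
  have bd: "(dil_weight R p y * (a - b))\<^sup>2 \<le> (1 / R * 4)\<^sup>2" if "\<bar>a\<bar> \<le> 2" "\<bar>b\<bar> \<le> 2" for a b y
  proof -
    have "\<bar>dil_weight R p y * (a - b)\<bar> \<le> 1 / R * 4" unfolding abs_mult using dil_weight_bounds[OF R, of p y] that R by (intro mult_mono) auto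
    then have "\<bar>dil_weight R p y * (a - b)\<bar>\<^sup>2 \<le> (1 / R * 4)\<^sup>2" by (rule power_mono) simp
    then show ?thesis by simp
  qed
  have mF: "?F n \<in> borel_measurable ballM" for n by (rule ballM_borel) measurable
  have mL: "?L \<in> borel_measurable ballM" by (rule ballM_borel) measurable
  have iF: "integrable ballM (?F n)" for n
    by (rule ballM_integrable_bounded[OF mF, of _ "(1 / R * 4)\<^sup>2"]) (use bd trunc_u_bound in simp)
  show "integrable ballM ?L"
    by (rule ballM_integrable_bounded[OF mL, of "(1 / R * 4)\<^sup>2"]) (use bd ext_u_bound in simp)
  have le: "integral\<^sup>L ballM (?F n) \<le> t\<^sup>2 * integral\<^sup>L lborel (ext_grad_sq k)" for n
  proof -
    have "ennreal (integral\<^sup>L ballM (?F n)) = (\<integral>\<^sup>+y. ennreal (?F n y) \<partial>ballM)"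
      by (rule nn_integral_eq_integral[symmetric, OF iF]) auto
    also have "\<dots> \<le> (\<integral>\<^sup>+y. ennreal (?F n y) \<partial>lborel)"
      unfolding ballM_def by (subst nn_integral_restrict_space) (auto intro!: nn_integral_mono simp: indicator_def)
    also have "\<dots> \<le> ennreal (t\<^sup>2) * (\<integral>\<^sup>+y. ennreal ((norm (trunc_grad n k y))\<^sup>2) \<partial>lborel)"
      by (rule dilation_difference_L2[OF C1_trunc_u t]) (rule dil_weight_bounds[OF R])
    also have "\<dots> \<le> ennreal (t\<^sup>2) * (\<integral>\<^sup>+y. ennreal (ext_grad_sq k y) \<partial>lborel)"
      by (intro mult_left_mono nn_integral_mono ennreal_leI trunc_grad_sq_le) auto
    also have "(\<integral>\<^sup>+y. ennreal (ext_grad_sq k y) \<partial>lborel) = ennreal (integral\<^sup>L lborel (ext_grad_sq k))"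
      by (rule nn_integral_eq_integral[OF ext_grad_sq_int]) (simp add: ext_grad_sq_nonneg)
    also have "ennreal (t\<^sup>2) * ennreal (integral\<^sup>L lborel (ext_grad_sq k)) = ennreal (t\<^sup>2 * integral\<^sup>L lborel (ext_grad_sq k))"
      by (simp add: ennreal_mult Bochner_Integration.integral_nonneg ext_grad_sq_nonneg)
    finally show ?thesis
      by (subst (asm) ennreal_le_iff) (auto intro!: mult_nonneg_nonneg Bochner_Integration.integral_nonneg ext_grad_sq_nonneg)
  qed
  have "(\<lambda>n. integral\<^sup>L ballM (?F n)) \<longlonglongrightarrow> integral\<^sup>L ballM ?L"
  proof (rule integral_dominated_convergence[OF mL mF, where w="\<lambda>y. (1 / R * 4)\<^sup>2"])
    show "AE y in ballM. (\<lambda>n. ?F n y) \<longlonglongrightarrow> ?L y"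
      by (intro AE_I2 tendsto_intros trunc_u_tendsto)
    show "AE y in ballM. norm (?F n y) \<le> (1 / R * 4)\<^sup>2" for n
      using bd trunc_u_bound by (intro AE_I2) simp
  qed (rule one_int)
  then show "integral\<^sup>L ballM ?L \<le> t\<^sup>2 * integral\<^sup>L lborel (ext_grad_sq k)"
    by (rule LIMSEQ_le_const2) (use le in auto)
qed

lemma ext_grad_sq_dilate_int: "t \<ge> 0 \<Longrightarrow> integrable lborel (\<lambda>y. ext_grad_sq k (dilate p t y))"
proof -
  assume t: "t \<ge> 0"
  have "integrable lborel (\<lambda>y. ext_grad_sq k ((- t) *\<^sub>R p + (1 + t) *\<^sub>R y))"
    by (rule lborel_integrable_affine[OF ext_grad_sq_int]) (use t in auto)
  moreover have "(- t) *\<^sub>R p + (1 + t) *\<^sub>R y = dilate p t y" for y by (simp add: algebra_simps)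
  ultimately show ?thesis by simp
qed

text \<open>The test function is a cutoff times the difference between the map and its dilation about
  \<open>p\<close>; it vanishes outside the ball because the ball is star-shaped about \<open>p\<close>. Convexity
  of the Dirichlet integrand replaces the derivative of the dilated map, which may jump across the
  boundary of the dilated ball.\<close>

lemma dilation_inequality_component:
  fixes p :: "real^3"
  assumes p: "norm p < 1" and R: "R > 0" and t: "t > 0"
  defines "H \<equiv> \<lambda>k y. dil_weight R p y * (ext_u k (dilate p t y) - ext_u k y) * lap_comp k y
      + dil_weight R p y * ((1 + t)\<^sup>2 * ext_grad_sq k (dilate p t y) - ext_grad_sq k y) / 2 + (ext_u k (dilate p t y) - ext_u k y) * (dil_weight_grad R p y \<bullet> grad_comp k y)"
  shows "integrable ballM (H k)" "0 \<le> integral\<^sup>L ballM (H k)"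
proof -
  note [measurable] = dil_weight_meas[OF R, THEN ballM_borel] ext_grad_sq_meas[THEN ballM_borel] ext_u_meas[THEN ballM_borel]
  have t0: "t \<ge> 0" using t by simp
  let ?z = "dil_weight R p"
  have [measurable]: "(\<lambda>y. ext_grad_sq k (dilate p t y)) \<in> borel_measurable ballM" "(\<lambda>y. ext_u k (dilate p t y)) \<in> borel_measurable ballM"
     "(\<lambda>y. trunc_u n k (dilate p t y)) \<in> borel_measurable ballM" "trunc_u n k \<in> borel_measurable ballM" for n
    by (rule ballM_borel, measurable)+
  have [measurable]: "odd_trunc1 (1 / real (Suc n)) \<in> borel_measurable borel" for n
    using odd_trunc_cont(2)[OF level_pos] by (rule borel_measurable_continuous_onI)
  define w where "w n y = ?z y * (trunc_u n k (dilate p t y) - trunc_u n k y)" for n y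
  define wG where "wG n y = ?z y *\<^sub>R ((1 + t) *\<^sub>R trunc_grad n k (dilate p t y) - trunc_grad n k y) + (trunc_u n k (dilate p t y) - trunc_u n k y) *\<^sub>R dil_weight_grad R p y" for n y
  have w1: "C1_on UNIV (w n) (wG n)" for n
    unfolding w_def[abs_def] wG_def[abs_def] by (intro C1_on_mult C1_dil_weight R C1_on_diff C1_on_dilate C1_trunc_u)
  have zero: "integrable ballM (\<lambda>y. w n y * lap_comp k y + wG n y \<bullet> grad_comp k y)" "integral\<^sup>L ballM (\<lambda>y. w n y * lap_comp k y + wG n y \<bullet> grad_comp k y) = 0" for n
  proof -
    let ?K0 = "{x. norm x \<le> 1 \<and> 1 / real (Suc n) \<le> \<bar>u k x\<bar>}"
    note K0 = u_level_compact[OF level_pos, of n k]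
    \<comment> \<open>The inverse dilation. It is a convex combination of its argument and
      \<open>p\<close>, hence maps the ball into itself and carries the compact support of the
      truncation to that of its dilated copy.\<close>
    define h where "h z = (1 / (1 + t)) *\<^sub>R (z + t *\<^sub>R p)" for z :: "real^3"
    have hd: "h (dilate p t y) = y" for y
    proof -
      have "dilate p t y + t *\<^sub>R p = (1 + t) *\<^sub>R y" by (simp add: algebra_simps)
      then show ?thesis unfolding h_def using t by simp
    qed
    have "compact (h ` ?K0)" unfolding h_def[abs_def]
      by (intro compact_continuous_image continuous_intros K0)
    then have K: "compact (?K0 \<union> h ` ?K0)" using K0 by (intro compact_Un) auto
    have hb: "norm (h z) < 1" if z: "norm z < 1" for z
    proof -
      have "norm (z + t *\<^sub>R p) \<le> norm z + t * norm p" using norm_triangle_ineq[of z "t *\<^sub>R p"] t by simp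
      also have "\<dots> < 1 + t * 1" using z p t by (intro add_strict_mono mult_strict_left_mono) auto
      finally show ?thesis unfolding h_def using t by (simp add: divide_less_eq)
    qed
    have sub: "?K0 \<union> h ` ?K0 \<subseteq> ball 0 1" using K0(2) hb by auto
    have v: "w n y = 0 \<or> grad_comp k y = 0" if "y \<in> ball 0 1 - (?K0 \<union> h ` ?K0)" for y
    proof -
      have "trunc_u n k y = 0" using trunc_u_support[of n k y] that by blast
      moreover have "trunc_u n k (dilate p t y) = 0"
      proof (rule ccontr)
        assume "trunc_u n k (dilate p t y) \<noteq> 0"
        then have "dilate p t y \<in> ?K0" using trunc_u_support by blast
        then have "h (dilate p t y) \<in> h ` ?K0" by (rule imageI)
        then show False using that by (simp add: hd)
      qed
      ultimately show ?thesis by (simp add: w_def)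
    qed
    note G = green_first[OF C1_on_subset[OF w1 subset_UNIV] C2_u open_ball K sub v, folded ballM_def]
    show "integrable ballM (\<lambda>y. w n y * lap_comp k y + wG n y \<bullet> grad_comp k y)" "integral\<^sup>L ballM (\<lambda>y. w n y * lap_comp k y + wG n y \<bullet> grad_comp k y) = 0"
      using G by auto
  qed
  define Hn where "Hn n y = ?z y * (trunc_u n k (dilate p t y) - trunc_u n k y) * lap_comp k y
      + ?z y * ((1 + t)\<^sup>2 * ext_grad_sq k (dilate p t y) + ext_grad_sq k y) / 2 - ?z y * odd_trunc1 (1 / real (Suc n)) (u k y) * ext_grad_sq k y
      + (trunc_u n k (dilate p t y) - trunc_u n k y) * (dil_weight_grad R p y \<bullet> grad_comp k y)" for n y
  define bw where "bw y = 1 / R * 4 * \<bar>lap_comp k y\<bar> + 1 / R * ((1 + t)\<^sup>2 * ext_grad_sq k (dilate p t y) + ext_grad_sq k y) / 2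
     + 1 / R * 1 * ext_grad_sq k y + 4 * (1 / R * (1 / R) * (1 + g y))" for y
  have gi: "integrable ballM (\<lambda>y. ext_grad_sq k (dilate p t y))" "integrable ballM (ext_grad_sq k)"
    using ext_grad_sq_dilate_int[OF t0] ext_grad_sq_int by (auto intro: ballM_of_lborel)
  have bwi: "integrable ballM bw" unfolding bw_def[abs_def] using lap_comp_int g_int one_int gi by auto
  have mHn: "Hn n \<in> borel_measurable ballM" for n unfolding Hn_def[abs_def] by measurable
  have mH: "H k \<in> borel_measurable ballM" unfolding H_def by measurable
  \<comment> \<open>Young's inequality replaces the dilated gradient by its squared norm before the
    limit, so \<open>null_gradient\<close> is later applied at \<open>y\<close> and not at its
    dilated image.\<close>
  have pw: "w n y * lap_comp k y + wG n y \<bullet> grad_comp k y \<le> Hn n y" if y: "norm y < 1" for n y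
  proof -
    let ?a = "(1 + t) *\<^sub>R trunc_grad n k (dilate p t y)"
    have "?a \<bullet> grad_comp k y \<le> ((norm ?a)\<^sup>2 + (norm (grad_comp k y))\<^sup>2) / 2"
    proof (rule order_trans[OF norm_cauchy_schwarz])
      have "a * b \<le> (a\<^sup>2 + b\<^sup>2) / 2" for a b :: real using sum_squares_bound[of a b] by simp
      then show "norm ?a * norm (grad_comp k y) \<le> ((norm ?a)\<^sup>2 + (norm (grad_comp k y))\<^sup>2) / 2" .
    qed
    also have "(norm ?a)\<^sup>2 = (1 + t)\<^sup>2 * (norm (trunc_grad n k (dilate p t y)))\<^sup>2"
      using t by (simp add: power_mult_distrib)
    also have "\<dots> \<le> (1 + t)\<^sup>2 * ext_grad_sq k (dilate p t y)" by (intro mult_left_mono trunc_grad_sq_le) auto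
    finally have 1: "?a \<bullet> grad_comp k y \<le> ((1 + t)\<^sup>2 * ext_grad_sq k (dilate p t y) + ext_grad_sq k y) / 2" using y by (simp add: ext_grad_sq_def)
    have 2: "trunc_grad n k y \<bullet> grad_comp k y = odd_trunc1 (1 / real (Suc n)) (u k y) * ext_grad_sq k y"
      using y by (simp add: trunc_grad_def ext_grad_sq_def power2_norm_eq_inner)
    have "?z y * (?a \<bullet> grad_comp k y) \<le> ?z y * (((1 + t)\<^sup>2 * ext_grad_sq k (dilate p t y) + ext_grad_sq k y) / 2)"
      using dil_weight_bounds(1)[OF R, of p y] 1 by (intro mult_left_mono) auto
    moreover have "wG n y \<bullet> grad_comp k y = ?z y * (?a \<bullet> grad_comp k y) - ?z y * (trunc_grad n k y \<bullet> grad_comp k y) + (trunc_u n k (dilate p t y) - trunc_u n k y) * (dil_weight_grad R p y \<bullet> grad_comp k y)"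
      unfolding wG_def by (simp only: inner_add_left inner_scaleR_left inner_diff_left right_diff_distrib)
    ultimately show ?thesis unfolding Hn_def w_def 2 by (simp add: mult.assoc)
  qed
  have zg: "\<bar>dil_weight_grad R p y \<bullet> grad_comp k y\<bar> \<le> 1 / R * (1 / R) * (1 + g y)" for y
  proof -
    have "\<bar>dil_weight_grad R p y \<bullet> grad_comp k y\<bar> \<le> norm (dil_weight_grad R p y) * norm (grad_comp k y)" by (rule Cauchy_Schwarz_ineq2)
    also have "\<dots> \<le> (1 / R * (1 / R)) * (1 + g y)"
    proof (rule mult_mono)
      have "dil_weight R p y * (1 / R) \<le> 1 / R * (1 / R)" using dil_weight_bounds[OF R, of p y] R by (intro mult_right_mono) auto
      then show "norm (dil_weight_grad R p y) \<le> 1 / R * (1 / R)" using dil_weight_grad_bound[OF R, of p y] by linarith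
    qed (use grad_comp_le R in auto)
    finally show ?thesis .
  qed
  have bd: "\<bar>Hn n y\<bar> \<le> bw y" for n y
  proof -
    have f4: "\<bar>trunc_u n k (dilate p t y) - trunc_u n k y\<bar> \<le> 4" using trunc_u_bound[of n k y] trunc_u_bound[of n k "dilate p t y"] by linarith
    have z: "\<bar>?z y\<bar> \<le> 1 / R" "0 \<le> ?z y" using dil_weight_bounds[OF R, of p y] by auto
    have "\<bar>?z y * (trunc_u n k (dilate p t y) - trunc_u n k y) * lap_comp k y\<bar> \<le> 1 / R * 4 * \<bar>lap_comp k y\<bar>"
      unfolding abs_mult using z f4 R by (intro mult_mono) auto
    moreover have "\<bar>?z y * ((1 + t)\<^sup>2 * ext_grad_sq k (dilate p t y) + ext_grad_sq k y) / 2\<bar> \<le> 1 / R * ((1 + t)\<^sup>2 * ext_grad_sq k (dilate p t y) + ext_grad_sq k y) / 2"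
    proof -
      have q: "0 \<le> (1 + t)\<^sup>2 * ext_grad_sq k (dilate p t y) + ext_grad_sq k y" by (simp add: ext_grad_sq_nonneg)
      have "\<bar>?z y * q / 2\<bar> \<le> 1 / R * q / 2" if "q \<ge> 0" for q
        using mult_right_mono[OF z(1) that] that by (simp add: abs_mult divide_right_mono)
      from this[OF q] show ?thesis .
    qed
    moreover have "\<bar>?z y * odd_trunc1 (1 / real (Suc n)) (u k y) * ext_grad_sq k y\<bar> \<le> 1 / R * 1 * ext_grad_sq k y"
      unfolding abs_mult using z odd_trunc1_bounds[OF level_pos, of n "u k y"] ext_grad_sq_nonneg[of k y] R by (intro mult_mono) auto
    moreover have "\<bar>(trunc_u n k (dilate p t y) - trunc_u n k y) * (dil_weight_grad R p y \<bullet> grad_comp k y)\<bar> \<le> 4 * (1 / R * (1 / R) * (1 + g y))"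
      unfolding abs_mult using f4 zg[of y] by (intro mult_mono) auto
    moreover have "\<bar>a + b - c + e\<bar> \<le> a' + b' + c' + e'"
      if "\<bar>a\<bar> \<le> a'" "\<bar>b\<bar> \<le> b'" "\<bar>c\<bar> \<le> c'" "\<bar>e\<bar> \<le> e'" for a b c e a' b' c' e' :: real
      using that by linarith
    ultimately show ?thesis unfolding Hn_def bw_def by blast
  qed
  have iHn: "integrable ballM (Hn n)" for n
    by (rule Bochner_Integration.integrable_bound[OF bwi mHn], rule AE_I2)
       (use bd order_trans[OF bd abs_ge_self] in simp)
  have pos: "0 \<le> integral\<^sup>L ballM (Hn n)" for n
    using integral_mono[OF zero(1) iHn pw] zero(2) by simp
  have lim: "AE y in ballM. (\<lambda>n. Hn n y) \<longlonglongrightarrow> H k y"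
    using null_gradient[of k] AE_space
  proof eventually_elim
    fix y assume u0: "u k y = 0 \<longrightarrow> grad_comp k y = 0" and "y \<in> space ballM"
    then have y: "norm y < 1" by simp
    have eH: "H k y = ?z y * (ext_u k (dilate p t y) - ext_u k y) * lap_comp k y
      + ?z y * ((1 + t)\<^sup>2 * ext_grad_sq k (dilate p t y) + ext_grad_sq k y) / 2 - ?z y * (if u k y = 0 then 0 else 1) * ext_grad_sq k y
      + (ext_u k (dilate p t y) - ext_u k y) * (dil_weight_grad R p y \<bullet> grad_comp k y)"
      using u0 y by (cases "u k y = 0") (auto simp: H_def ext_grad_sq_def field_simps)
    show "(\<lambda>n. Hn n y) \<longlonglongrightarrow> H k y"
      unfolding eH Hn_def by (intro tendsto_intros trunc_u_tendsto odd_trunc1_tendsto) auto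
  qed
  have bdA: "AE y in ballM. norm (Hn n y) \<le> bw y" for n using bd by simp
  show "integrable ballM (H k)"
    by (rule integrable_dominated_convergence[OF mH mHn bwi lim bdA])
  have "(\<lambda>n. integral\<^sup>L ballM (Hn n)) \<longlonglongrightarrow> integral\<^sup>L ballM (H k)"
    by (rule integral_dominated_convergence[OF mH mHn bwi lim bdA])
  then show "0 \<le> integral\<^sup>L ballM (H k)"
    by (rule LIMSEQ_le_const) (use pos in auto)
qed

lemma ext_u_diff: "norm y < 1 \<Longrightarrow> ext_u k z - ext_u k y = (ext_d z - d y) $ k"
  by (simp add: ext_u_def ext_d_def u_def)

lemma sum_ext_u_diff: "norm y < 1 \<Longrightarrow> (\<Sum>k\<in>UNIV. (ext_u k z - ext_u k y)\<^sup>2) = (norm (ext_d z - d y))\<^sup>2"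
  unfolding power2_norm_eq_inner inner_vec_def by (simp add: ext_u_diff power2_eq_square)

lemma norm_ext_d: "norm (ext_d z) = 1"
  using norm_d[of z] norm_e3 by (simp add: ext_d_def)

text \<open>If \<open>z\<close> lies outside, the segment from \<open>y\<close> to \<open>z\<close>
  crosses the sphere at a point no farther from \<open>y\<close>, where \<open>d\<close> already has
  the value \<open>e3\<close> of the extension.\<close>

lemma ext_d_holder:
  assumes hol: "\<And>x y. norm x \<le> 1 \<Longrightarrow> norm y \<le> 1 \<Longrightarrow> norm (d y - d x) \<le> K * sqrt (norm (y - x))"
    and K: "K \<ge> 0" and y: "norm y < 1"
  shows "(norm (ext_d z - d y))\<^sup>2 \<le> K\<^sup>2 * norm (z - y)"
proof -
  have "norm (ext_d z - d y) \<le> K * sqrt (norm (z - y))"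
  proof (cases "norm z < 1")
    case True then show ?thesis using hol[of y z] y by (simp add: ext_d_def)
  next
    case False
    have "closed_segment y z \<inter> frontier (ball 0 1) \<noteq> {}"
    proof (rule connected_Int_frontier)
      show "connected (closed_segment y z)" by simp
      show "closed_segment y z \<inter> ball 0 1 \<noteq> {}" using y ends_in_segment(1)[of y z] by force
      show "closed_segment y z - ball 0 1 \<noteq> {}" using False ends_in_segment(2)[of z y] by force
    qed
    then obtain z' where z': "z' \<in> closed_segment y z" "norm z' = 1" by auto
    have "norm (ext_d z - d y) = norm (d z' - d y)" using False d_sphere[OF z'(2)] by (simp add: ext_d_def)
    also have "\<dots> \<le> K * sqrt (norm (z' - y))" using hol[of y z'] y z' by simp
    also have "\<dots> \<le> K * sqrt (norm (z - y))" using segment_bound1[OF z'(1)] K by (intro mult_left_mono) auto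
    finally show ?thesis .
  qed
  then have "(norm (ext_d z - d y))\<^sup>2 \<le> (K * sqrt (norm (z - y)))\<^sup>2" by (rule power_mono) simp
  then show ?thesis by (simp add: power_mult_distrib)
qed

lemma ext_u_directional_derivative:
  assumes y: "norm y < 1" and t: "\<And>n. t n \<noteq> 0" "t \<longlonglongrightarrow> 0"
  shows "(\<lambda>n. (ext_u k (dilate p (t n) y) - ext_u k y) / t n) \<longlonglongrightarrow> grad_comp k y \<bullet> (y - p)"
proof -
  have "(ext_u k has_derivative (\<lambda>h. grad_comp k y \<bullet> h)) (at y)"
    by (rule has_derivative_transform_within_open[OF C1_on_deriv[OF C1_u] open_ball[of 0 1], of y])
       (use y in \<open>auto simp: ext_u_def\<close>)
  then have D1: "(ext_u k has_derivative (\<lambda>h. grad_comp k y \<bullet> h)) (at (dilate p 0 y))" by simp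
  have "((\<lambda>\<theta>. ext_u k (dilate p \<theta> y)) has_derivative (\<lambda>h. grad_comp k y \<bullet> (h *\<^sub>R (y - p)))) (at 0)"
    by (rule has_derivative_compose[of "\<lambda>\<theta>. dilate p \<theta> y" "\<lambda>h. h *\<^sub>R (y - p)" 0 UNIV "ext_u k" "\<lambda>h. grad_comp k y \<bullet> h"])
       (use D1 in \<open>auto intro!: derivative_eq_intros\<close>)
  then have "((\<lambda>\<theta>. ext_u k (dilate p \<theta> y)) has_real_derivative grad_comp k y \<bullet> (y - p)) (at 0)"
    by (simp add: has_field_derivative_def mult_commute_abs)
  then have "((\<lambda>h. (ext_u k (dilate p h y) - ext_u k y) / h) \<longlongrightarrow> grad_comp k y \<bullet> (y - p)) (at 0)"
    by (simp add: DERIV_def)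
  moreover have "filterlim t (at 0) sequentially"
    using t by (auto simp: filterlim_at)
  ultimately show ?thesis by (rule filterlim_compose)
qed

text \<open>Under the dilation the Jacobian \<open>(1 + t) ^ 3\<close> is matched exactly by
  \<open>(1 + t)\<^sup>2\<close> from the gradients and \<open>1 + t\<close> from the weight. The
  dilated energy is therefore at most the energy with weight of radius \<open>R * (1 + t)\<close>,
  and \<open>weight_gain\<close> compares the two weights.\<close>

lemma dilated_energy_le:
  assumes R: "R > 0" and t: "t > 0"
  shows "integrable ballM (\<lambda>y. dil_weight R p y * ((1 + t)\<^sup>2 * (\<Sum>k\<in>UNIV. ext_grad_sq k (dilate p t y)) - g y) / 2)"
    and "integral\<^sup>L ballM (\<lambda>y. dil_weight R p y * ((1 + t)\<^sup>2 * (\<Sum>k\<in>UNIV. ext_grad_sq k (dilate p t y)) - g y) / 2)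
      \<le> - (t / (1 + t)) / 2 * integral\<^sup>L ballM (\<lambda>y. R / (sdist R p y + R)\<^sup>2 * g y)"
proof -
  note [measurable] = dil_weight_meas[OF R]
  have t0: "t \<ge> 0" using t by simp
  let ?R = "R * (1 + t)"
  have R': "?R > 0" using R t by simp
  define F where "F z = dil_weight ?R p z * (\<Sum>k\<in>UNIV. ext_grad_sq k z)" for z
  have [measurable]: "dil_weight ?R p \<in> borel_measurable borel" by (rule dil_weight_meas[OF R'])
  have bi: "integrable lborel (\<lambda>y. dil_weight r p y * f y)" if r: "r > 0" and f: "integrable lborel f" for r and f :: "real^3 \<Rightarrow> real"
  proof (rule Bochner_Integration.integrable_bound[of _ "\<lambda>y. 1 / r * f y"])
    show "AE y in lborel. norm (dil_weight r p y * f y) \<le> norm (1 / r * f y)"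
    proof (rule AE_I2)
      fix y
      have "\<bar>dil_weight r p y\<bar> * \<bar>f y\<bar> \<le> 1 / r * \<bar>f y\<bar>" using dil_weight_bounds[OF r, of p y] by (intro mult_right_mono) auto
      then show "norm (dil_weight r p y * f y) \<le> norm (1 / r * f y)" using r by (simp add: abs_mult)
    qed
    show "(\<lambda>y. dil_weight r p y * f y) \<in> borel_measurable lborel"
      using dil_weight_meas[OF r, of p] borel_measurable_integrable[OF f] by simp
  qed (use f in auto)
  have gz: "integrable lborel (\<lambda>y. \<Sum>k\<in>UNIV. ext_grad_sq k (dilate p t y))" by (intro Bochner_Integration.integrable_sum ext_grad_sq_dilate_int t0)
  have gs: "integrable lborel (\<lambda>y. \<Sum>k\<in>UNIV. ext_grad_sq k y)" by (intro Bochner_Integration.integrable_sum ext_grad_sq_int)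
  have Fi: "integrable lborel F" unfolding F_def[abs_def] by (rule bi[OF R' gs])
  have zi: "integrable lborel (\<lambda>y. dil_weight R p y * (\<Sum>k\<in>UNIV. ext_grad_sq k (dilate p t y)))" by (rule bi[OF R gz])
  have e: "F ((- t) *\<^sub>R p + (1 + t) *\<^sub>R y) = dil_weight R p y * (\<Sum>k\<in>UNIV. ext_grad_sq k (dilate p t y)) / (1 + t)" for y
  proof -
    have a: "(- t) *\<^sub>R p + (1 + t) *\<^sub>R y = dilate p t y" by (simp add: algebra_simps)
    have "dil_weight ?R p (dilate p t y) = dil_weight R p y / (1 + t)"
      unfolding dil_weight_def sdist_dilate[OF R t0] using t by (simp add: field_simps)
    then show ?thesis unfolding a F_def by simp
  qed
  have "integral\<^sup>L lborel F = \<bar>1 + t\<bar> ^ DIM(real^3) * integral\<^sup>L lborel (\<lambda>y. F ((- t) *\<^sub>R p + (1 + t) *\<^sub>R y))"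
    by (rule lborel_integral_affine) (use Fi t in auto)
  also have "\<dots> = (1 + t)\<^sup>2 * integral\<^sup>L lborel (\<lambda>y. dil_weight R p y * (\<Sum>k\<in>UNIV. ext_grad_sq k (dilate p t y)))"
    unfolding e using t by (simp add: power2_eq_square power3_eq_cube)
  finally have FI: "integral\<^sup>L lborel F = (1 + t)\<^sup>2 * integral\<^sup>L lborel (\<lambda>y. dil_weight R p y * (\<Sum>k\<in>UNIV. ext_grad_sq k (dilate p t y)))" .
  have FB: "integral\<^sup>L lborel F = integral\<^sup>L ballM (\<lambda>y. dil_weight ?R p y * g y)"
    unfolding ballM_integral_eq
    by (rule Bochner_Integration.integral_cong) (auto simp: F_def indicator_def ext_grad_sq_def g_eq)
  have zg: "integrable ballM (\<lambda>y. dil_weight r p y * g y)" if "r > 0" for r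
    by (rule ballM_integrable_mult_cont[OF dil_weight_cont(1)[OF that] g_int])
  have i1: "integrable ballM (\<lambda>y. dil_weight R p y * ((1 + t)\<^sup>2 * (\<Sum>k\<in>UNIV. ext_grad_sq k (dilate p t y))))"
    using ballM_of_lborel[OF integrable_mult_right[OF zi, of "(1 + t)\<^sup>2"]] by (simp add: mult_ac)
  have eq: "dil_weight R p y * ((1 + t)\<^sup>2 * (\<Sum>k\<in>UNIV. ext_grad_sq k (dilate p t y)) - g y) / 2
     = (dil_weight R p y * ((1 + t)\<^sup>2 * (\<Sum>k\<in>UNIV. ext_grad_sq k (dilate p t y))) - dil_weight R p y * g y) / 2" for y
    by (simp add: right_diff_distrib)
  show "integrable ballM (\<lambda>y. dil_weight R p y * ((1 + t)\<^sup>2 * (\<Sum>k\<in>UNIV. ext_grad_sq k (dilate p t y)) - g y) / 2)"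
    unfolding eq by (intro integrable_divide Bochner_Integration.integrable_diff i1 zg R)
  have "integral\<^sup>L ballM (\<lambda>y. dil_weight R p y * ((1 + t)\<^sup>2 * (\<Sum>k\<in>UNIV. ext_grad_sq k (dilate p t y))))
     \<le> integral\<^sup>L lborel (\<lambda>y. (1 + t)\<^sup>2 * (dil_weight R p y * (\<Sum>k\<in>UNIV. ext_grad_sq k (dilate p t y))))"
    by (rule ballM_integral_le[OF integrable_mult_right[OF zi]])
       (use dil_weight_bounds(1)[OF R] in \<open>auto simp: mult_ac less_imp_le sum_nonneg ext_grad_sq_nonneg intro!: mult_nonneg_nonneg\<close>)
  also have "\<dots> = integral\<^sup>L ballM (\<lambda>y. dil_weight ?R p y * g y)" using FI FB by simp
  finally have le: "integral\<^sup>L ballM (\<lambda>y. dil_weight R p y * ((1 + t)\<^sup>2 * (\<Sum>k\<in>UNIV. ext_grad_sq k (dilate p t y)))) \<le> integral\<^sup>L ballM (\<lambda>y. dil_weight ?R p y * g y)" .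
  have cW: "continuous_on UNIV (\<lambda>y. R / (sdist R p y + R)\<^sup>2)"
  proof (intro continuous_intros ballI)
    fix y show "(sdist R p y + R)\<^sup>2 \<noteq> 0" using sdist_pos[OF R, of p y] R by simp
  qed
  have Wi: "integrable ballM (\<lambda>y. R / (sdist R p y + R)\<^sup>2 * g y)" by (rule ballM_integrable_mult_cont[OF cW g_int])
  have "integral\<^sup>L ballM (\<lambda>y. dil_weight R p y * ((1 + t)\<^sup>2 * (\<Sum>k\<in>UNIV. ext_grad_sq k (dilate p t y)) - g y) / 2)
     = (integral\<^sup>L ballM (\<lambda>y. dil_weight R p y * ((1 + t)\<^sup>2 * (\<Sum>k\<in>UNIV. ext_grad_sq k (dilate p t y)))) - integral\<^sup>L ballM (\<lambda>y. dil_weight R p y * g y)) / 2"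
    unfolding eq using i1 zg[OF R] by simp
  also have "\<dots> \<le> (integral\<^sup>L ballM (\<lambda>y. dil_weight ?R p y * g y) - integral\<^sup>L ballM (\<lambda>y. dil_weight R p y * g y)) / 2"
    using le by simp
  also have "\<dots> = integral\<^sup>L ballM (\<lambda>y. dil_weight ?R p y * g y - dil_weight R p y * g y) / 2"
    using zg[OF R] zg[OF R'] by simp
  also have "\<dots> \<le> integral\<^sup>L ballM (\<lambda>y. - (t / (1 + t)) * (R / (sdist R p y + R)\<^sup>2 * g y)) / 2"
  proof (intro divide_right_mono integral_mono)
    fix y
    have "(dil_weight ?R p y - dil_weight R p y) * g y \<le> - (t / (1 + t)) * (R / (sdist R p y + R)\<^sup>2) * g y"
      using weight_gain[OF R t0, of p y] g_nonneg by (intro mult_right_mono) (simp add: dil_weight_def)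
    then show "dil_weight ?R p y * g y - dil_weight R p y * g y \<le> - (t / (1 + t)) * (R / (sdist R p y + R)\<^sup>2 * g y)"
      by (simp only: left_diff_distrib mult.assoc)
    show "integrable ballM (\<lambda>y. dil_weight ?R p y * g y - dil_weight R p y * g y)" using zg[OF R] zg[OF R'] by simp
    show "integrable ballM (\<lambda>y. - (t / (1 + t)) * (R / (sdist R p y + R)\<^sup>2 * g y))" by (rule integrable_mult_right[OF Wi])
  qed simp
  also have "\<dots> = - (t / (1 + t)) / 2 * integral\<^sup>L ballM (\<lambda>y. R / (sdist R p y + R)\<^sup>2 * g y)"
    unfolding integral_mult_right_zero by simp
  finally show "integral\<^sup>L ballM (\<lambda>y. dil_weight R p y * ((1 + t)\<^sup>2 * (\<Sum>k\<in>UNIV. ext_grad_sq k (dilate p t y)) - g y) / 2)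
      \<le> - (t / (1 + t)) / 2 * integral\<^sup>L ballM (\<lambda>y. R / (sdist R p y + R)\<^sup>2 * g y)" .
qed

text \<open>Away from the boundary layer \<open>norm y \<ge> s\<close> the last term has a sign in the limit
  \<open>t \<rightarrow> 0\<close>; in the layer it is absorbed by the energy of the layer.\<close>

lemma dilation_inequality:
  fixes p :: "real^3" and s :: real
  assumes p: "norm p < 1" and R: "R > 0" and t: "t > 0"
  defines "E \<equiv> \<lambda>y. dil_weight R p y * g y * (norm (ext_d (dilate p t y) - d y))\<^sup>2 / (2 * t)"
    and "F \<equiv> \<lambda>y. if norm y < s then \<Sum>k\<in>UNIV. (ext_u k (dilate p t y) - ext_u k y) / t * (dil_weight_grad R p y \<bullet> grad_comp k y) else 0"
  assumes Ei: "integrable ballM E"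
  shows "integral\<^sup>L ballM (\<lambda>y. R / (sdist R p y + R)\<^sup>2 * g y) / (2 * (1 + t))
    \<le> 5 / 2 * \<epsilon>\<^sup>2 + integral\<^sup>L ballM E + integral\<^sup>L ballM F
       + integral\<^sup>L ballM (\<lambda>y. if norm y < s then 0 else g y) / (2 * R\<^sup>2)"
proof -
  have t0: "t \<ge> 0" using t by simp
  let ?W = "integral\<^sup>L ballM (\<lambda>y. R / (sdist R p y + R)\<^sup>2 * g y)"
  let ?H = "\<lambda>k y. dil_weight R p y * (ext_u k (dilate p t y) - ext_u k y) * lap_comp k y
      + dil_weight R p y * ((1 + t)\<^sup>2 * ext_grad_sq k (dilate p t y) - ext_grad_sq k y) / 2 + (ext_u k (dilate p t y) - ext_u k y) * (dil_weight_grad R p y \<bullet> grad_comp k y)"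
  let ?Y = "\<lambda>y. dil_weight R p y * ((1 + t)\<^sup>2 * (\<Sum>k\<in>UNIV. ext_grad_sq k (dilate p t y)) - g y) / 2"
  let ?X = "\<lambda>y. dil_weight R p y * ((ext_d (dilate p t y) - d y) \<bullet> tension_vec y + g y * (norm (ext_d (dilate p t y) - d y))\<^sup>2 / 2)
      + (\<Sum>k\<in>UNIV. (ext_u k (dilate p t y) - ext_u k y) * (dil_weight_grad R p y \<bullet> grad_comp k y))"
  let ?Q = "\<lambda>y. \<Sum>k\<in>UNIV. (dil_weight R p y * (ext_u k (dilate p t y) - ext_u k y))\<^sup>2"
  let ?G = "\<lambda>y. if norm y < s then 0 else g y"
  note Hk = dilation_inequality_component[OF p R t]
  have HXY: "(\<Sum>k\<in>UNIV. ?H k y) = ?X y + ?Y y" if y: "norm y < 1" for y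
  proof -
    have "(\<Sum>k\<in>UNIV. (ext_u k (dilate p t y) - ext_u k y) * lap_comp k y) = - (\<Sum>k\<in>UNIV. (d y $ k - ext_d (dilate p t y) $ k) * lap_comp k y)"
      unfolding ext_u_diff[OF y] sum_negf[symmetric]
      by (intro sum.cong refl) (simp add: left_diff_distrib)
    also have "\<dots> = (ext_d (dilate p t y) - d y) \<bullet> tension_vec y + g y * (norm (ext_d (dilate p t y) - d y))\<^sup>2 / 2"
      using w_dot_lap[of y "ext_d (dilate p t y)"] y norm_ext_d by (simp add: inner_diff_left norm_minus_commute)
    finally have 1: "(\<Sum>k\<in>UNIV. (ext_u k (dilate p t y) - ext_u k y) * lap_comp k y) = (ext_d (dilate p t y) - d y) \<bullet> tension_vec y + g y * (norm (ext_d (dilate p t y) - d y))\<^sup>2 / 2" .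
    have "(\<Sum>k\<in>UNIV. ?H k y) = dil_weight R p y * (\<Sum>k\<in>UNIV. (ext_u k (dilate p t y) - ext_u k y) * lap_comp k y)
       + dil_weight R p y * ((1 + t)\<^sup>2 * (\<Sum>k\<in>UNIV. ext_grad_sq k (dilate p t y)) - (\<Sum>k\<in>UNIV. ext_grad_sq k y)) / 2 + (\<Sum>k\<in>UNIV. (ext_u k (dilate p t y) - ext_u k y) * (dil_weight_grad R p y \<bullet> grad_comp k y))"
      by (simp only: sum.distrib sum_divide_distrib[symmetric] sum_distrib_left[symmetric] sum_subtractf mult.assoc)
    then show ?thesis unfolding 1 sum_ext_grad_sq[OF y] by simp
  qed
  have Hi: "integrable ballM (\<lambda>y. \<Sum>k\<in>UNIV. ?H k y)" by (intro Bochner_Integration.integrable_sum Hk(1))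
  have H0: "0 \<le> integral\<^sup>L ballM (\<lambda>y. \<Sum>k\<in>UNIV. ?H k y)"
    using Hk by (subst Bochner_Integration.integral_sum) (auto intro!: sum_nonneg)
  note Y = dilated_energy_le[OF R t, of p]
  have XYi: "integrable ballM (\<lambda>y. ?X y + ?Y y)"
    using Hi by (rule Bochner_Integration.integrable_cong[THEN iffD1, rotated 2]) (auto simp: HXY)
  have XY0: "0 \<le> integral\<^sup>L ballM (\<lambda>y. ?X y + ?Y y)"
  proof -
    have "integral\<^sup>L ballM (\<lambda>y. ?X y + ?Y y) = integral\<^sup>L ballM (\<lambda>y. \<Sum>k\<in>UNIV. ?H k y)"
      by (rule Bochner_Integration.integral_cong) (auto simp: HXY)
    then show ?thesis using H0 by simp
  qed
  have Xi: "integrable ballM ?X"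
    using Bochner_Integration.integrable_diff[OF XYi Y(1)] by simp
  have X0: "0 \<le> integral\<^sup>L ballM ?X + integral\<^sup>L ballM ?Y"
    using XY0 Bochner_Integration.integral_add[OF Xi Y(1)] by simp
  have Qi: "integrable ballM ?Q" by (intro Bochner_Integration.integrable_sum difference_L2 R t0)
  have QI: "integral\<^sup>L ballM ?Q \<le> t\<^sup>2 * (2 * \<epsilon>\<^sup>2)"
  proof -
    have "integral\<^sup>L ballM ?Q = (\<Sum>k\<in>UNIV. integral\<^sup>L ballM (\<lambda>y. (dil_weight R p y * (ext_u k (dilate p t y) - ext_u k y))\<^sup>2))"
      by (rule Bochner_Integration.integral_sum) (rule difference_L2(1)[OF R t0])
    also have "\<dots> \<le> (\<Sum>k\<in>UNIV. t\<^sup>2 * integral\<^sup>L lborel (ext_grad_sq k))" by (intro sum_mono difference_L2(2) R t0)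
    also have "\<dots> = t\<^sup>2 * integral\<^sup>L ballM g" by (simp only: sum_distrib_left[symmetric] sum_integral_ext_grad_sq)
    also have "\<dots> \<le> t\<^sup>2 * (2 * \<epsilon>\<^sup>2)" by (intro mult_left_mono g_integral) auto
    finally show ?thesis .
  qed
  have [measurable]: "(\<lambda>y::real^3. norm y) \<in> borel_measurable ballM" by (rule ballM_borel) simp
  have Gm: "?G \<in> borel_measurable ballM" by measurable
  have Gi: "integrable ballM ?G"
    by (rule Bochner_Integration.integrable_bound[OF g_int Gm]) (auto simp: g_nonneg intro!: AE_I2)
  have mF: "F \<in> borel_measurable ballM"
  proof -
    note [measurable] = dil_weight_meas[OF R, THEN ballM_borel] ext_u_meas[THEN ballM_borel]
    have [measurable]: "(\<lambda>y. ext_u k (dilate p t y)) \<in> borel_measurable ballM" for k by (rule ballM_borel) measurable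
    show ?thesis unfolding F_def by measurable
  qed
  have zg: "\<bar>dil_weight_grad R p y \<bullet> grad_comp k y\<bar> \<le> dil_weight R p y * (1 / R) * norm (grad_comp k y)" for k y
  proof -
    have "\<bar>dil_weight_grad R p y \<bullet> grad_comp k y\<bar> \<le> norm (dil_weight_grad R p y) * norm (grad_comp k y)" by (rule Cauchy_Schwarz_ineq2)
    also have "\<dots> \<le> dil_weight R p y * (1 / R) * norm (grad_comp k y)" by (intro mult_right_mono dil_weight_grad_bound R) auto
    finally show ?thesis .
  qed
  have amgm: "a * b \<le> a\<^sup>2 / (2 * t) + t * b\<^sup>2 / 2" for a b :: real
  proof -
    have "0 \<le> (a - t * b)\<^sup>2 / (2 * t)" using t by simp
    also have "\<dots> = a\<^sup>2 / (2 * t) + t * b\<^sup>2 / 2 - a * b" using t by (simp add: power2_eq_square field_simps)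
    finally show ?thesis by simp
  qed
  have cross: "\<bar>(ext_u k (dilate p t y) - ext_u k y) * (dil_weight_grad R p y \<bullet> grad_comp k y)\<bar>
     \<le> (dil_weight R p y * (ext_u k (dilate p t y) - ext_u k y))\<^sup>2 / (2 * t) + t * ((norm (grad_comp k y))\<^sup>2 / R\<^sup>2) / 2" for k y
  proof -
    have "\<bar>(ext_u k (dilate p t y) - ext_u k y) * (dil_weight_grad R p y \<bullet> grad_comp k y)\<bar> \<le> \<bar>ext_u k (dilate p t y) - ext_u k y\<bar> * (dil_weight R p y * (1 / R) * norm (grad_comp k y))"
      unfolding abs_mult by (intro mult_left_mono zg) auto
    also have "\<dots> = (dil_weight R p y * \<bar>ext_u k (dilate p t y) - ext_u k y\<bar>) * (norm (grad_comp k y) / R)" by simp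
    also have "\<dots> \<le> (dil_weight R p y * \<bar>ext_u k (dilate p t y) - ext_u k y\<bar>)\<^sup>2 / (2 * t) + t * (norm (grad_comp k y) / R)\<^sup>2 / 2" by (rule amgm)
    finally show ?thesis by (simp add: power_mult_distrib power_divide)
  qed
  have sumcross: "\<bar>\<Sum>k\<in>UNIV. (ext_u k (dilate p t y) - ext_u k y) * (dil_weight_grad R p y \<bullet> grad_comp k y)\<bar> \<le> ?Q y / (2 * t) + t * (g y / R\<^sup>2) / 2" for y
  proof -
    have "\<bar>\<Sum>k\<in>UNIV. (ext_u k (dilate p t y) - ext_u k y) * (dil_weight_grad R p y \<bullet> grad_comp k y)\<bar> \<le> (\<Sum>k\<in>UNIV. \<bar>(ext_u k (dilate p t y) - ext_u k y) * (dil_weight_grad R p y \<bullet> grad_comp k y)\<bar>)"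
      by (rule sum_abs)
    also have "\<dots> \<le> (\<Sum>k\<in>UNIV. (dil_weight R p y * (ext_u k (dilate p t y) - ext_u k y))\<^sup>2 / (2 * t) + t * ((norm (grad_comp k y))\<^sup>2 / R\<^sup>2) / 2)"
      by (intro sum_mono cross)
    also have "\<dots> = ?Q y / (2 * t) + t * (g y / R\<^sup>2) / 2"
      unfolding g_eq by (simp add: sum.distrib sum_divide_distrib sum_distrib_left)
    finally show ?thesis .
  qed
  have tF: "t * F y = (if norm y < s then \<Sum>k\<in>UNIV. (ext_u k (dilate p t y) - ext_u k y) * (dil_weight_grad R p y \<bullet> grad_comp k y) else 0)" for y
    unfolding F_def using t by (simp add: sum_distrib_left)
  have Fi: "integrable ballM F"
  proof (rule Bochner_Integration.integrable_bound[OF _ mF])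
    show "integrable ballM (\<lambda>y. (?Q y / (2 * t) + t * (g y / R\<^sup>2) / 2) / t)" using Qi g_int by simp
    show "AE y in ballM. norm (F y) \<le> norm ((?Q y / (2 * t) + t * (g y / R\<^sup>2) / 2) / t)"
    proof (rule AE_I2)
      fix y
      have "t * \<bar>F y\<bar> = \<bar>t * F y\<bar>" using t by (simp add: abs_mult)
      also have "\<dots> \<le> ?Q y / (2 * t) + t * (g y / R\<^sup>2) / 2"
        unfolding tF using sumcross[of y] order_trans[OF abs_ge_zero sumcross[of y]] by simp
      finally have "\<bar>F y\<bar> \<le> (?Q y / (2 * t) + t * (g y / R\<^sup>2) / 2) / t" using t by (simp only: le_divide_eq mult.commute) simp
      then show "norm (F y) \<le> norm ((?Q y / (2 * t) + t * (g y / R\<^sup>2) / 2) / t)" by (simp only: real_norm_def)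
    qed
  qed
  have pw: "?X y \<le> t / 2 * (tension_norm y)\<^sup>2 + 1 / t * ?Q y + t * E y + t * F y + t / (2 * R\<^sup>2) * ?G y" if y: "norm y < 1" for y
  proof -
    have Qe: "?Q y = (dil_weight R p y * norm (ext_d (dilate p t y) - d y))\<^sup>2"
      using sum_ext_u_diff[OF y, of "dilate p t y"] by (simp add: power_mult_distrib sum_distrib_left[symmetric])
    have z0: "0 \<le> dil_weight R p y" using dil_weight_bounds(1)[OF R, of p y] by simp
    have "dil_weight R p y * ((ext_d (dilate p t y) - d y) \<bullet> tension_vec y) \<le> dil_weight R p y * (norm (ext_d (dilate p t y) - d y) * tension_norm y)"
      unfolding tension_norm_def by (intro mult_left_mono norm_cauchy_schwarz z0)
    also have "\<dots> \<le> ?Q y / (2 * t) + t * (tension_norm y)\<^sup>2 / 2"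
      unfolding Qe mult.assoc[symmetric] by (rule amgm)
    finally have 1: "dil_weight R p y * ((ext_d (dilate p t y) - d y) \<bullet> tension_vec y) \<le> ?Q y / (2 * t) + t * (tension_norm y)\<^sup>2 / 2" .
    have 2: "dil_weight R p y * (g y * (norm (ext_d (dilate p t y) - d y))\<^sup>2 / 2) = t * E y"
      unfolding E_def using t by simp
    have Q0: "0 \<le> ?Q y / (2 * t)" using t by (intro divide_nonneg_nonneg sum_nonneg) auto
    have 3: "(\<Sum>k\<in>UNIV. (ext_u k (dilate p t y) - ext_u k y) * (dil_weight_grad R p y \<bullet> grad_comp k y)) \<le> t * F y + ?Q y / (2 * t) + t / (2 * R\<^sup>2) * ?G y"
    proof (cases "norm y < s")
      case True then show ?thesis unfolding tF using Q0 by simp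
    next
      case False
      have "(\<Sum>k\<in>UNIV. (ext_u k (dilate p t y) - ext_u k y) * (dil_weight_grad R p y \<bullet> grad_comp k y)) \<le> ?Q y / (2 * t) + t * (g y / R\<^sup>2) / 2"
        using sumcross[of y] by (rule order_trans[OF abs_ge_self])
      then show ?thesis unfolding tF using False by (simp add: mult.commute)
    qed
    \<comment> \<open>One half of this pays for the tension term, the other for the cross term in
      the layer. With \<open>?Q\<close> of integral at most
      \<open>2 * t\<^sup>2 * \<epsilon>\<^sup>2\<close> and the squared tension, division by
      \<open>t\<close> yields \<open>2 + 1 / 2 = 5 / 2\<close>.\<close>
    have 4: "1 / t * ?Q y = ?Q y / (2 * t) + ?Q y / (2 * t)" using t by (simp add: field_simps)
    show ?thesis unfolding 4 distrib_left 2 using 1 3 by simp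
  qed
  have tt: "integral\<^sup>L ballM ?X \<le> t / 2 * integral\<^sup>L ballM (\<lambda>y. (tension_norm y)\<^sup>2) + 1 / t * integral\<^sup>L ballM ?Q + t * integral\<^sup>L ballM E + t * integral\<^sup>L ballM F + t / (2 * R\<^sup>2) * integral\<^sup>L ballM ?G"
  proof -
    note i1 = integrable_mult_right[OF tn2_int, of "t / 2"]
    note i2 = integrable_mult_right[OF Qi, of "1 / t"]
    note i3 = integrable_mult_right[OF Ei, of t]
    note i4 = integrable_mult_right[OF Fi, of t]
    note i5 = integrable_mult_right[OF Gi, of "t / (2 * R\<^sup>2)"]
    note j2 = Bochner_Integration.integrable_add[OF i1 i2]
    note j3 = Bochner_Integration.integrable_add[OF j2 i3]
    note j4 = Bochner_Integration.integrable_add[OF j3 i4]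
    note j5 = Bochner_Integration.integrable_add[OF j4 i5]
    have "integral\<^sup>L ballM ?X \<le> integral\<^sup>L ballM (\<lambda>y. t / 2 * (tension_norm y)\<^sup>2 + 1 / t * ?Q y + t * E y + t * F y + t / (2 * R\<^sup>2) * ?G y)"
      by (rule integral_mono[OF Xi j5]) (use pw in simp)
    also have "\<dots> = t / 2 * integral\<^sup>L ballM (\<lambda>y. (tension_norm y)\<^sup>2) + 1 / t * integral\<^sup>L ballM ?Q + t * integral\<^sup>L ballM E + t * integral\<^sup>L ballM F + t / (2 * R\<^sup>2) * integral\<^sup>L ballM ?G"
      by (simp only: Bochner_Integration.integral_add[OF j4 i5] Bochner_Integration.integral_add[OF j3 i4]
          Bochner_Integration.integral_add[OF j2 i3] Bochner_Integration.integral_add[OF i1 i2] integral_mult_right_zero)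
    finally show ?thesis .
  qed
  have "t * (?W / (2 * (1 + t))) = t / (1 + t) / 2 * ?W" by simp
  also have "\<dots> \<le> integral\<^sup>L ballM ?X" using X0 Y(2) by simp
  also have "\<dots> \<le> t / 2 * \<epsilon>\<^sup>2 + 1 / t * (t\<^sup>2 * (2 * \<epsilon>\<^sup>2)) + t * integral\<^sup>L ballM E + t * integral\<^sup>L ballM F + t / (2 * R\<^sup>2) * integral\<^sup>L ballM ?G"
    by (rule order_trans[OF tt]) (use tn2_integral QI t in \<open>intro add_mono mult_left_mono; simp\<close>)
  also have "\<dots> = t * (5 / 2 * \<epsilon>\<^sup>2 + integral\<^sup>L ballM E + integral\<^sup>L ballM F + integral\<^sup>L ballM ?G / (2 * R\<^sup>2))"
    using t by (simp add: power2_eq_square field_simps)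
  finally show ?thesis using t by (simp only: mult_le_cancel_left_pos)
qed

lemma weight_int:
  assumes R: "R > 0"
  shows "integrable ballM (\<lambda>y. R / (sdist R p y + R)\<^sup>2 * g y)"
proof (rule ballM_integrable_mult_cont[OF _ g_int], intro continuous_intros ballI)
  fix y show "(sdist R p y + R)\<^sup>2 \<noteq> 0" using sdist_pos[OF R, of p y] R by simp
qed

text \<open>Let \<open>t\<close> tend to 0 with the layer fixed. The error \<open>E\<close> tends to
  zero pointwise, since squared differences are of order \<open>t\<^sup>2\<close> at each interior
  point; Holder continuity of exponent one half bounds them by a multiple of \<open>t\<close>
  uniformly, which gives the majorant \<open>K\<^sup>2 / 2 * g\<close>. The cross term inside the
  layer boundary converges to a nonpositive integral.\<close>

lemma monotonicity_layer:
  assumes p: "norm p < 1" and R: "R > 0" and K: "K \<ge> 0"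
    and hol: "\<And>x y. norm x \<le> 1 \<Longrightarrow> norm y \<le> 1 \<Longrightarrow> norm (d y - d x) \<le> K * sqrt (norm (y - x))"
    and s: "0 \<le> s" "s < 1"
  shows "integral\<^sup>L ballM (\<lambda>y. R / (sdist R p y + R)\<^sup>2 * g y)
    \<le> 5 * \<epsilon>\<^sup>2 + integral\<^sup>L ballM (\<lambda>y. if norm y < s then 0 else g y) / R\<^sup>2"
proof -
  let ?W = "integral\<^sup>L ballM (\<lambda>y. R / (sdist R p y + R)\<^sup>2 * g y)"
  let ?G = "integral\<^sup>L ballM (\<lambda>y. if norm y < s then 0 else g y)"
  \<comment> \<open>Points with \<open>norm y < s\<close> move by at most
    \<open>2 * t n \<le> (1 - s) / 2\<close>, so they stay in the closed ball of radius
    \<open>(1 + s) / 2\<close>, on which the gradients are bounded.\<close>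
  define t where "t n = (1 - s) / 4 * (1 / real (Suc n))" for n
  have tp: "t n > 0" for n using s by (simp add: t_def)
  have tl: "t \<longlonglongrightarrow> 0"
    unfolding t_def using tendsto_mult[OF tendsto_const inv_Suc_tendsto, of "(1 - s) / 4"] by simp
  have tle: "t n \<le> (1 - s) / 4" for n unfolding t_def using s by (intro mult_left_le) auto
  define q where "q n k y = (ext_u k (dilate p (t n) y) - ext_u k y) / t n" for n k y
  define E where "E n y = dil_weight R p y * g y * (norm (ext_d (dilate p (t n) y) - d y))\<^sup>2 / (2 * t n)" for n y
  define F where "F n y = (if norm y < s then \<Sum>k\<in>UNIV. (ext_u k (dilate p (t n) y) - ext_u k y) / t n * (dil_weight_grad R p y \<bullet> grad_comp k y) else 0)" for n y
  define F0 where "F0 y = (if norm y < s then \<Sum>k\<in>UNIV. (grad_comp k y \<bullet> (y - p)) * (dil_weight_grad R p y \<bullet> grad_comp k y) else 0)" for y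
  note [measurable] = dil_weight_meas[OF R, THEN ballM_borel] ext_u_meas[THEN ballM_borel]
  have [measurable]: "(\<lambda>y. ext_u k (dilate p (t n) y)) \<in> borel_measurable ballM" for k n by (rule ballM_borel) measurable
  have [measurable]: "(\<lambda>y::real^3. norm y) \<in> borel_measurable ballM" "(\<lambda>y. y - p) \<in> borel_measurable ballM" by (rule ballM_borel, simp)+
  have Eeq: "E n y = dil_weight R p y * g y * (t n / 2 * (\<Sum>k\<in>UNIV. (q n k y)\<^sup>2))" if "norm y < 1" for n y
    unfolding E_def q_def sum_ext_u_diff[OF that, symmetric] using tp[of n]
    by (simp add: power_divide sum_divide_distrib[symmetric] power2_eq_square)
  have [measurable]: "q n k \<in> borel_measurable ballM" for n k unfolding q_def[abs_def] by measurable
  have mE: "E n \<in> borel_measurable ballM" for n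
  proof -
    have "(\<lambda>y. dil_weight R p y * g y * (t n / 2 * (\<Sum>k\<in>UNIV. (q n k y)\<^sup>2))) \<in> borel_measurable ballM" by measurable
    then show ?thesis by (rule measurable_cong[THEN iffD1, rotated]) (simp add: Eeq)
  qed
  have Ebd: "AE y in ballM. norm (E n y) \<le> K\<^sup>2 / 2 * g y" for n
  proof (rule AE_I2)
    fix y assume "y \<in> space ballM"
    then have y: "norm y < 1" by simp
    have z: "0 \<le> dil_weight R p y" using dil_weight_bounds(1)[OF R, of p y] by simp
    have "(norm (ext_d (dilate p (t n) y) - d y))\<^sup>2 \<le> K\<^sup>2 * norm (dilate p (t n) y - y)" by (rule ext_d_holder[OF hol K y])
    also have "\<dots> = K\<^sup>2 * norm (y - p) * t n" using tp[of n] by simp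
    finally have "(norm (ext_d (dilate p (t n) y) - d y))\<^sup>2 / (2 * t n) \<le> K\<^sup>2 / 2 * norm (y - p)"
      using tp[of n] by (simp add: divide_le_eq)
    then have "dil_weight R p y * g y * ((norm (ext_d (dilate p (t n) y) - d y))\<^sup>2 / (2 * t n)) \<le> dil_weight R p y * g y * (K\<^sup>2 / 2 * norm (y - p))"
      using z g_nonneg by (intro mult_left_mono mult_nonneg_nonneg) auto
    also have "\<dots> = (\<bar>dil_weight R p y\<bar> * norm (y - p)) * (K\<^sup>2 / 2 * g y)" using z by simp
    also have "\<dots> \<le> 1 * (K\<^sup>2 / 2 * g y)" using dil_weight_bounds(3)[OF R] g_nonneg by (intro mult_right_mono) auto
    finally have "E n y \<le> K\<^sup>2 / 2 * g y" by (simp add: E_def)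
    moreover have "0 \<le> E n y" unfolding E_def using z g_nonneg[of y] tp[of n] by (intro divide_nonneg_nonneg mult_nonneg_nonneg) auto
    ultimately show "norm (E n y) \<le> K\<^sup>2 / 2 * g y" by simp
  qed
  have Kg: "integrable ballM (\<lambda>y. K\<^sup>2 / 2 * g y)" using g_int by (rule integrable_mult_right)
  have ql: "(\<lambda>n. q n k y) \<longlonglongrightarrow> grad_comp k y \<bullet> (y - p)" if "norm y < 1" for k y
    unfolding q_def using ext_u_directional_derivative[OF that, of t] tp tl by (simp add: less_imp_neq[THEN not_sym])
  have Elim: "AE y in ballM. (\<lambda>n. E n y) \<longlonglongrightarrow> 0"
  proof (rule AE_I2)
    fix y assume "y \<in> space ballM"
    then have y: "norm y < 1" by simp
    have "(\<lambda>n. dil_weight R p y * g y * (t n / 2 * (\<Sum>k\<in>UNIV. (q n k y)\<^sup>2))) \<longlonglongrightarrow> dil_weight R p y * g y * (0 / 2 * (\<Sum>k\<in>UNIV. (grad_comp k y \<bullet> (y - p))\<^sup>2))"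
      by (intro tendsto_intros tl ql y) simp
    then show "(\<lambda>n. E n y) \<longlonglongrightarrow> 0" unfolding Eeq[OF y] by simp
  qed
  have mono0: "(\<lambda>y. 0::real) \<in> borel_measurable ballM" by simp
  have iE: "integrable ballM (E n)" for n
    by (rule Bochner_Integration.integrable_bound[OF Kg mE]) (use Ebd[of n] in eventually_elim, use order_trans[OF _ abs_ge_self] in simp)
  have Eint: "(\<lambda>n. integral\<^sup>L ballM (E n)) \<longlonglongrightarrow> 0"
    using integral_dominated_convergence[OF mono0 mE Kg Elim Ebd] by simp
  define s' where "s' = (1 + s) / 2"
  have s': "s' < 1" "cball 0 s' \<subseteq> ball (0::real^3) 1" using s by (auto simp: s'_def)
  have "\<exists>L. L \<ge> 0 \<and> (\<forall>y\<in>cball 0 s'. norm (grad_comp k y) \<le> L)" for k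
  proof -
    have "compact (grad_comp k ` cball 0 s')"
      by (rule compact_continuous_image[OF continuous_on_subset[OF cont_grad_comp s'(2)]]) simp
    then obtain L where L: "\<And>y. y \<in> cball 0 s' \<Longrightarrow> norm (grad_comp k y) \<le> L"
      by (meson bounded_iff compact_imp_bounded image_eqI)
    then show ?thesis by (intro exI[of _ "max L 0"]) (auto simp: le_max_iff_disj)
  qed
  then obtain L where L: "\<And>k. L k \<ge> 0" "\<And>k y. y \<in> cball 0 s' \<Longrightarrow> norm (grad_comp k y) \<le> L k" by metis
  define CF where "CF = (\<Sum>k\<in>UNIV. 2 * L k * (1 / R * (1 / R) * L k))"
  have Fb: "norm (F n y) \<le> CF" if y: "norm y < 1" for n y
  proof (cases "norm y < s")
    case False
    then show ?thesis using L(1) R unfolding F_def CF_def by (auto intro!: sum_nonneg mult_nonneg_nonneg)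
  next
    case True
    have yp: "norm (y - p) \<le> 2" using norm_triangle_ineq4[of y p] y p by linarith
    have "norm (dilate p (t n) y) \<le> norm y + t n * norm (y - p)"
      using norm_triangle_ineq[of y "t n *\<^sub>R (y - p)"] tp[of n] by simp
    also have "\<dots> \<le> s + (1 - s) / 4 * 2" using True tle[of n] yp s tp[of n] by (intro add_mono mult_mono) auto
    also have "\<dots> = s'" by (simp add: s'_def field_simps)
    finally have dm: "dilate p (t n) y \<in> cball 0 s'" by simp
    have ym: "y \<in> cball 0 s'" using True s by (simp add: s'_def)
    have qb: "\<bar>q n k y\<bar> \<le> 2 * L k" for k
    proof -
      have "\<bar>u k (dilate p (t n) y) - u k y\<bar> \<le> L k * norm (dilate p (t n) y - y)"
        by (rule C1_on_lipschitz[OF C1_on_subset[OF C1_u s'(2)]]) (use L dm ym in auto)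
      also have "\<dots> \<le> L k * (t n * 2)" using yp L(1)[of k] tp[of n] by (intro mult_left_mono) auto
      finally have "\<bar>u k (dilate p (t n) y) - u k y\<bar> \<le> 2 * L k * t n" by simp
      moreover have "ext_u k (dilate p (t n) y) = u k (dilate p (t n) y)" "ext_u k y = u k y"
        using dm ym s' by (auto simp: ext_u_def)
      ultimately show ?thesis using tp[of n] by (simp add: q_def abs_divide divide_le_eq)
    qed
    have zb: "\<bar>dil_weight_grad R p y \<bullet> grad_comp k y\<bar> \<le> 1 / R * (1 / R) * L k" for k
    proof -
      have "\<bar>dil_weight_grad R p y \<bullet> grad_comp k y\<bar> \<le> norm (dil_weight_grad R p y) * norm (grad_comp k y)" by (rule Cauchy_Schwarz_ineq2)
      also have "\<dots> \<le> (1 / R * (1 / R)) * L k"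
      proof (rule mult_mono)
        have "dil_weight R p y * (1 / R) \<le> 1 / R * (1 / R)" using dil_weight_bounds[OF R, of p y] R by (intro mult_right_mono) auto
        then show "norm (dil_weight_grad R p y) \<le> 1 / R * (1 / R)" using dil_weight_grad_bound[OF R, of p y] by linarith
      qed (use L(2)[OF ym] R in auto)
      finally show ?thesis .
    qed
    have "norm (F n y) \<le> (\<Sum>k\<in>UNIV. \<bar>q n k y * (dil_weight_grad R p y \<bullet> grad_comp k y)\<bar>)"
      unfolding F_def q_def using True by (simp only: if_True real_norm_def) (rule sum_abs)
    also have "\<dots> \<le> CF" unfolding CF_def abs_mult using qb zb L(1) by (intro sum_mono mult_mono) auto
    finally show ?thesis .
  qed
  have Flim: "AE y in ballM. (\<lambda>n. F n y) \<longlonglongrightarrow> F0 y"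
  proof (rule AE_I2)
    fix y assume "y \<in> space ballM"
    then have y: "norm y < 1" by simp
    show "(\<lambda>n. F n y) \<longlonglongrightarrow> F0 y"
    proof (cases "norm y < s")
      case True
      have "(\<lambda>n. \<Sum>k\<in>UNIV. q n k y * (dil_weight_grad R p y \<bullet> grad_comp k y)) \<longlonglongrightarrow> (\<Sum>k\<in>UNIV. (grad_comp k y \<bullet> (y - p)) * (dil_weight_grad R p y \<bullet> grad_comp k y))"
        by (intro tendsto_intros ql y)
      then show ?thesis using True by (simp add: F_def F0_def q_def)
    qed (simp add: F_def F0_def)
  qed
  have mF: "F n \<in> borel_measurable ballM" for n unfolding F_def[abs_def] by measurable
  have mF0: "F0 \<in> borel_measurable ballM" unfolding F0_def[abs_def] by measurable
  have Fbd: "AE y in ballM. norm (F n y) \<le> CF" for n using Fb by (intro AE_I2) simp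
  have Fint: "(\<lambda>n. integral\<^sup>L ballM (F n)) \<longlonglongrightarrow> integral\<^sup>L ballM F0"
    by (rule integral_dominated_convergence[OF mF0 mF one_int Flim Fbd])
  have F0neg: "integral\<^sup>L ballM F0 \<le> 0"
  proof -
    \<comment> \<open>The gradient of the weight is a negative multiple of \<open>y - p\<close>, so
      each summand is minus a weighted square of the radial derivative about
      \<open>p\<close>.\<close>
    have "F0 y \<le> 0" for y
    proof -
      have "(grad_comp k y \<bullet> (y - p)) * (dil_weight_grad R p y \<bullet> grad_comp k y) \<le> 0" for k
      proof -
        have "0 \<le> 1 / (sdist R p y * (sdist R p y + R)\<^sup>2) * (grad_comp k y \<bullet> (y - p))\<^sup>2" using sdist_pos[OF R, of p y] by simp
        then show ?thesis unfolding dil_weight_grad_dot[OF R] by (simp add: inner_commute power2_eq_square)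
      qed
      then show ?thesis by (auto simp: F0_def intro!: sum_nonpos)
    qed
    then have "0 \<le> integral\<^sup>L ballM (\<lambda>y. - F0 y)" by (intro Bochner_Integration.integral_nonneg) simp
    then show ?thesis by simp
  qed
  have ineq: "?W / (2 * (1 + t n)) \<le> 5 / 2 * \<epsilon>\<^sup>2 + integral\<^sup>L ballM (E n) + integral\<^sup>L ballM (F n) + ?G / (2 * R\<^sup>2)" for n
    unfolding E_def[abs_def] F_def[abs_def]
    by (rule dilation_inequality[OF p R tp]) (use iE[of n] in \<open>simp add: E_def[abs_def]\<close>)
  have l1: "(\<lambda>n. ?W / (2 * (1 + t n))) \<longlonglongrightarrow> ?W / (2 * (1 + 0))" by (intro tendsto_intros tl) simp
  have l2: "(\<lambda>n. 5 / 2 * \<epsilon>\<^sup>2 + integral\<^sup>L ballM (E n) + integral\<^sup>L ballM (F n) + ?G / (2 * R\<^sup>2))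
     \<longlonglongrightarrow> 5 / 2 * \<epsilon>\<^sup>2 + 0 + integral\<^sup>L ballM F0 + ?G / (2 * R\<^sup>2)"
    by (intro tendsto_intros Eint Fint)
  have "?W / (2 * (1 + 0)) \<le> 5 / 2 * \<epsilon>\<^sup>2 + 0 + integral\<^sup>L ballM F0 + ?G / (2 * R\<^sup>2)"
    by (rule LIMSEQ_le[OF l1 l2]) (use ineq in auto)
  then have "?W \<le> 5 * \<epsilon>\<^sup>2 + 2 * (?G / (2 * R\<^sup>2))" using F0neg by simp
  then show ?thesis by simp
qed

text \<open>For fixed \<open>R\<close> the energy of the boundary layer vanishes as the layer
  shrinks, by integrability of \<open>g\<close>. Neither \<open>K\<close> nor any modulus of
  continuity survives in the bound.\<close>

lemma monotonicity:
  assumes p: "norm p < 1" and R: "R > 0" and K: "K \<ge> 0"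
    and hol: "\<And>x y. norm x \<le> 1 \<Longrightarrow> norm y \<le> 1 \<Longrightarrow> norm (d y - d x) \<le> K * sqrt (norm (y - x))"
  shows "integral\<^sup>L ballM (\<lambda>y. R / (sdist R p y + R)\<^sup>2 * g y) \<le> 5 * \<epsilon>\<^sup>2"
proof -
  let ?W = "integral\<^sup>L ballM (\<lambda>y. R / (sdist R p y + R)\<^sup>2 * g y)"
  define s where "s n = 1 - 1 / real (Suc n)" for n
  have s: "0 \<le> s n" "s n < 1" for n by (auto simp: s_def)
  have sl: "s \<longlonglongrightarrow> 1" unfolding s_def using tendsto_diff[OF tendsto_const inv_Suc_tendsto, of 1] by simp
  let ?G = "\<lambda>n y. if norm y < s n then 0 else g y"
  have [measurable]: "(\<lambda>y::real^3. norm y) \<in> borel_measurable ballM" by (rule ballM_borel) simp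
  have "(\<lambda>n. integral\<^sup>L ballM (?G n)) \<longlonglongrightarrow> integral\<^sup>L ballM (\<lambda>y. 0)"
  proof (rule integral_dominated_convergence[OF _ _ g_int])
    show "AE y in ballM. (\<lambda>n. ?G n y) \<longlonglongrightarrow> 0"
    proof (rule AE_I2)
      fix y assume "y \<in> space ballM"
      then have y: "norm y < 1" by simp
      have "\<forall>\<^sub>F n in sequentially. norm y < s n" by (rule order_tendstoD(1)[OF sl y])
      then have "\<forall>\<^sub>F n in sequentially. ?G n y = 0" by eventually_elim simp
      then show "(\<lambda>n. ?G n y) \<longlonglongrightarrow> 0" by (rule tendsto_eventually)
    qed
  qed (auto simp: g_nonneg)
  then have "(\<lambda>n. 5 * \<epsilon>\<^sup>2 + integral\<^sup>L ballM (?G n) / R\<^sup>2) \<longlonglongrightarrow> 5 * \<epsilon>\<^sup>2 + 0 / R\<^sup>2"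
    using R by (intro tendsto_intros) auto
  then have "?W \<le> 5 * \<epsilon>\<^sup>2 + 0 / R\<^sup>2"
    by (rule LIMSEQ_le_const) (use monotonicity_layer[OF p R K hol s] in auto)
  then show ?thesis by simp
qed

section \<open>Propagation of small oscillation to the unit scale\<close>

text \<open>Within \<open>R / 4\<close> of \<open>p\<close> the local energy estimate applies;
  farther out the kernel is dominated by the monotonicity density; the tension is treated
  separately, with radius 3 covering the ball because \<open>norm (y - p) \<le> 2\<close> and
  \<open>\<kappa> \<le> 1\<close>. The coefficients add up to
  \<open>141 + 18 * 5 + 42 = 273\<close>.\<close>

lemma potential_le_scale:
  assumes p: "norm p < 1" and R: "0 < R" "R \<le> 1" and k: "0 < \<kappa>" "\<kappa> \<le> 1" and r: "0 < \<rho>" "\<rho> \<le> R"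
    and osc: "\<And>x y. norm x \<le> 1 \<Longrightarrow> norm y \<le> 1 \<Longrightarrow> norm (y - x) \<le> R \<Longrightarrow> norm (d y - d x) \<le> 1 / 10 ^ 7"
  shows "potential \<kappa> p \<rho> \<le> 1280 * (1 / 10 ^ 7)\<^sup>2 + 273 * \<epsilon>"
proof -
  let ?n = "\<lambda>y. if sdist \<kappa> p y \<le> R / 4 then (g y + tension_norm y) / sdist \<kappa> p y else 0"
  let ?t = "\<lambda>y. if sdist \<kappa> p y \<le> 3 then tension_norm y / sdist \<kappa> p y else 0"
  let ?w = "\<lambda>y. R / (sdist R p y + R)\<^sup>2 * g y"
  have K0: "2 * holder_const R \<ge> 0" by (simp add: holder_const_def)
  have W: "integral\<^sup>L ballM ?w \<le> 5 * \<epsilon>\<^sup>2"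
    by (rule monotonicity[OF p R(1) K0 holder_estimate[OF R osc]])
  note T = tension_near[OF k(1), of 3 p]
  have "potential \<kappa> p \<rho> \<le> integral\<^sup>L ballM (\<lambda>y. ?n y + 18 * ?w y + ?t y)"
    unfolding potential_def
  proof (rule integral_mono[OF potential_int[OF k(1) r(1)]])
    show "integrable ballM (\<lambda>y. ?n y + 18 * ?w y + ?t y)"
      by (intro Bochner_Integration.integrable_add near_potential_int k integrable_mult_right weight_int R T(2)) simp
    fix y assume "y \<in> space ballM"
    then have y: "norm y < 1" by simp
    let ?s = "sdist \<kappa> p y"
    have s: "?s > 0" by (rule sdist_pos[OF k(1)])
    have w0: "0 \<le> ?w y" using g_nonneg[of y] R sdist_pos[OF R(1), of p y] by simp
    have n0: "0 \<le> ?n y" and t0: "0 \<le> ?t y" using s g_nonneg[of y] tension_norm_nonneg[of y] by auto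
    have k1: "\<rho> / (?s * (?s + \<rho>)) \<le> 1 / ?s" by (rule kernel_le[OF s r(1)])
    have "\<rho> / (?s * (?s + \<rho>)) * tension_norm y \<le> 1 / ?s * tension_norm y" using k1 tension_norm_nonneg by (rule mult_right_mono)
    moreover have "?s \<le> 3"
    proof -
      have "norm (y - p) \<le> 2" using norm_triangle_ineq4[of y p] y p by linarith
      then show ?thesis using sdist_le[of \<kappa> p y] k by simp
    qed
    ultimately have tt: "\<rho> / (?s * (?s + \<rho>)) * tension_norm y \<le> ?t y" by simp
    show "\<rho> / (?s * (?s + \<rho>)) * (g y + tension_norm y) \<le> ?n y + 18 * ?w y + ?t y"
    proof (cases "?s \<le> R / 4")
      case True
      have "\<rho> / (?s * (?s + \<rho>)) * (g y + tension_norm y) \<le> 1 / ?s * (g y + tension_norm y)"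
        using k1 g_nonneg[of y] tension_norm_nonneg[of y] by (intro mult_right_mono) auto
      then show ?thesis using True w0 t0 by simp
    next
      case False
      have s1: "sdist R p y \<le> ?s + R" using sdist_le[of R p y] sdist_ge(1)[of \<kappa> y p] R k by linarith
      \<comment> \<open>Since \<open>R < 4 * ?s\<close> here, one factor is at most
        \<open>?s + 2 * R \<le> 9 * ?s\<close>, the other at most \<open>2 * (?s + R)\<close>; this
        is the origin of 18.\<close>
      have "(sdist R p y + R)\<^sup>2 \<le> (9 * ?s) * (2 * (?s + R))"
        unfolding power2_eq_square using s1 False s R sdist_pos[OF R(1), of p y] by (intro mult_mono) auto
      then have A: "(sdist R p y + R)\<^sup>2 \<le> 18 * (?s * (?s + R))" by (simp add: algebra_simps)
      have "\<rho> / (?s * (?s + \<rho>)) \<le> R / (?s * (?s + R))"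
      proof -
        have "\<rho> / (?s + \<rho>) \<le> R / (?s + R)" using r s R by (simp add: divide_simps mult_right_mono) (simp add: algebra_simps mult_left_mono)
        then have "1 / ?s * (\<rho> / (?s + \<rho>)) \<le> 1 / ?s * (R / (?s + R))" using s by (intro mult_left_mono) auto
        then show ?thesis by simp
      qed
      also have "\<dots> = 18 * (R / (18 * (?s * (?s + R))))" by simp
      also have "\<dots> \<le> 18 * (R / (sdist R p y + R)\<^sup>2)"
        using A R s sdist_pos[OF R(1), of p y] by (intro mult_left_mono divide_left_mono mult_pos_pos) auto
      finally have "\<rho> / (?s * (?s + \<rho>)) * g y \<le> 18 * (R / (sdist R p y + R)\<^sup>2) * g y" using g_nonneg by (rule mult_right_mono)
      then have "\<rho> / (?s * (?s + \<rho>)) * g y \<le> 18 * ?w y" by (simp only: mult.assoc)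
      then show ?thesis using tt n0 unfolding distrib_left[of "\<rho> / (?s * (?s + \<rho>))"] by linarith
    qed
  qed
  also have "\<dots> = near_potential \<kappa> p (R / 4) + 18 * integral\<^sup>L ballM ?w + integral\<^sup>L ballM ?t"
    unfolding near_potential_def
    by (simp only: Bochner_Integration.integral_add[OF Bochner_Integration.integrable_add[OF near_potential_int[OF k(1)] integrable_mult_right[OF weight_int[OF R(1)]]] T(2)[OF zero_less_numeral]]
        Bochner_Integration.integral_add[OF near_potential_int[OF k(1)] integrable_mult_right[OF weight_int[OF R(1)]]] integral_mult_right_zero)
  also have "\<dots> \<le> (1280 * (1 / 10 ^ 7)\<^sup>2 + 141 * \<epsilon> * 1) + 18 * (5 * \<epsilon>) + 21 * \<epsilon> * 2"
  proof (intro add_mono mult_left_mono)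
    have "near_potential \<kappa> p (R / 2 / 2) \<le> 1280 * (1 / 10 ^ 7)\<^sup>2 + 141 * \<epsilon> * sqrt (R / 2)"
      by (rule near_potential_le) (use k R p osc[of p] in auto)
    moreover have "141 * \<epsilon> * sqrt (R / 2) \<le> 141 * \<epsilon> * 1" using R eps by (intro mult_left_mono) auto
    ultimately show "near_potential \<kappa> p (R / 4) \<le> 1280 * (1 / 10 ^ 7)\<^sup>2 + 141 * \<epsilon> * 1" by simp
    have "\<epsilon>\<^sup>2 \<le> \<epsilon>" using eps by (simp add: power2_eq_square mult_left_le)
    then show "integral\<^sup>L ballM ?w \<le> 5 * \<epsilon>" using W by linarith
    have "sqrt 3 \<le> 2" by (rule real_le_lsqrt) auto
    then have "21 * \<epsilon> * sqrt 3 \<le> 21 * \<epsilon> * 2" using eps by (intro mult_left_mono) auto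
    then show "integral\<^sup>L ballM ?t \<le> 21 * \<epsilon> * 2" using T(1) by simp
  qed auto
  finally show ?thesis by simp
qed

text \<open>With \<open>\<epsilon> \<le> 1 / 10 ^ 12\<close> the bound
  \<open>36 * (1280 / 10 ^ 14 + 273 * \<epsilon>)\<close> is below half the threshold at distance
  \<open>R\<close>. Inserting the midpoint, which lies in the ball by convexity, doubles the
  distance and restores the full threshold.\<close>

lemma oscillation_doubling:
  assumes eps12: "\<epsilon> \<le> 1 / 10 ^ 12" and R: "0 < R" "R \<le> 1"
    and osc: "\<And>x y. norm x \<le> 1 \<Longrightarrow> norm y \<le> 1 \<Longrightarrow> norm (y - x) \<le> R \<Longrightarrow> norm (d y - d x) \<le> 1 / 10 ^ 7"
    and x: "norm x \<le> 1" "norm y \<le> 1" "norm (y - x) \<le> 2 * R"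
  shows "norm (d y - d x) \<le> 1 / 10 ^ 7"
proof -
  have ball: "norm (d b - d a) \<le> 1 / 10 ^ 7 / 2" if ab: "norm a < 1" "norm b < 1" "norm (b - a) \<le> R" for a b
  proof (cases "b = a")
    case False
    let ?Z = "1280 * (1 / 10 ^ 7)\<^sup>2 + 273 * \<epsilon>"
    have "norm (d b - d a) \<le> 36 * ?Z"
      by (rule oscillation_by_potential[OF _ _ refl]) (use ab False potential_le_scale[OF _ R _ _ _ _ osc] in auto)
    also have "\<dots> \<le> 1 / 10 ^ 7 / 2" using eps12 by (simp add: power2_eq_square)
    finally show ?thesis .
  qed simp
  have half: "norm (d b - d a) \<le> 1 / 10 ^ 7 / 2" if "norm a \<le> 1" "norm b \<le> 1" "norm (b - a) \<le> R" for a b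
    by (rule oscillation_closure[OF ball that])
  define m where "m = midpoint x y"
  have m: "norm m \<le> 1"
    using convexD_alt[OF convex_cball[of 0 1], of x y "1/2"] x by (simp add: m_def midpoint_def algebra_simps)
  have "dist x m = dist x y / 2" "dist m y = dist x y / 2" unfolding m_def by (auto simp: dist_midpoint)
  then have "norm (m - x) \<le> R" "norm (y - m) \<le> R" using x by (auto simp: dist_norm norm_minus_commute)
  then have "norm (d m - d x) \<le> 1 / 10 ^ 7 / 2" "norm (d y - d m) \<le> 1 / 10 ^ 7 / 2" using half m x by auto
  then show ?thesis using norm_triangle_ineq[of "d y - d m" "d m - d x"] by simp
qed

text \<open>Uniform continuity provides some initial scale, however small, and finitely many
  doublings reach the unit scale. The scale is capped at 1 because doubling starts from radii
  \<open>R \<le> 1\<close>.\<close>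

lemma small_oscillation:
  assumes eps12: "\<epsilon> \<le> 1 / 10 ^ 12" and x: "norm x \<le> 1" "norm y \<le> 1" "norm (y - x) \<le> 1"
  shows "norm (d y - d x) \<le> 1 / 10 ^ 7"
proof -
  have "uniformly_continuous_on (cball 0 1) d"
    by (rule compact_uniformly_continuous[OF cont_d]) simp
  then obtain r where r: "r > 0" "\<And>x y. x \<in> cball 0 1 \<Longrightarrow> y \<in> cball 0 1 \<Longrightarrow> dist y x < r \<Longrightarrow> dist (d y) (d x) < 1 / 10 ^ 7"
    unfolding uniformly_continuous_on_def by (metis zero_less_divide_1_iff zero_less_numeral zero_less_power)
  define r0 where "r0 = r / 2"
  have r0: "r0 > 0" using r by (simp add: r0_def)
  have O: "norm (d y - d x) \<le> 1 / 10 ^ 7" if "norm x \<le> 1" "norm y \<le> 1" "norm (y - x) \<le> min 1 (r0 * 2 ^ n)" for n x y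
    using that
  proof (induction n arbitrary: x y)
    case 0
    then have "dist y x < r" using r by (simp add: r0_def dist_norm)
    then show ?case using r(2)[of x y] 0 by (simp add: dist_norm)
  next
    case (Suc n)
    show ?case
    proof (rule oscillation_doubling[OF eps12, of "min 1 (r0 * 2 ^ n)"])
      show "norm (y - x) \<le> 2 * min 1 (r0 * 2 ^ n)" using Suc.prems(3) by (auto simp: min_def split: if_splits)
    qed (use Suc r0 in auto)
  qed
  obtain n where "1 / r0 < 2 ^ n" using real_arch_pow[of 2 "1 / r0"] by auto
  then have "1 \<le> r0 * 2 ^ n" using r0 by (simp add: divide_less_eq mult.commute)
  then show ?thesis using O[of x y n] x by simp
qed

end

theorem theorem6p2:
  shows "\<exists>\<epsilon>>0. \<exists>C>0. \<forall>d\<in>C_inf_e.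
           energy d \<le> ennreal (\<epsilon>\<^sup>2) \<and> tension_sq d \<le> ennreal (\<epsilon>\<^sup>2) \<longrightarrow>
           (\<forall>x\<in>ball 0 1. \<forall>y\<in>ball 0 1.
              dist (d x) (d y) \<le> C * sqrt \<epsilon> * dist x y powr (1/2))"
proof -
  define \<epsilon> :: real where "\<epsilon> = 1 / 10 ^ 12"
  \<comment> \<open>This is \<open>2 * holder_const 1\<close> written out; it depends neither on the
    map nor on \<open>\<epsilon>\<close>, so \<open>C = K / sqrt \<epsilon>\<close> can be fixed
    before \<open>d\<close>.\<close>
  define K where "K = 2 * (36 * (5076 + 11624 / (1::real)\<^sup>2))"
  have e: "\<epsilon> > 0" "\<epsilon> \<le> 1" by (auto simp: \<epsilon>_def)
  have main: "dist (d x) (d y) \<le> K / sqrt \<epsilon> * sqrt \<epsilon> * dist x y powr (1/2)"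
    if d: "d \<in> C_inf_e" "energy d \<le> ennreal (\<epsilon>\<^sup>2)" "tension_sq d \<le> ennreal (\<epsilon>\<^sup>2)"
      and x: "x \<in> ball 0 1" "y \<in> ball 0 1" for d x y
  proof -
    interpret sphere_map d \<epsilon> using d e by unfold_locales
    have "norm (d x - d y) \<le> 2 * holder_const 1 * sqrt (norm (x - y))"
      by (rule holder_estimate[OF _ _ small_oscillation]) (use x in \<open>auto simp: \<epsilon>_def\<close>)
    then show ?thesis using e by (simp add: dist_norm powr_half_sqrt K_def holder_const_def)
  qed
  have "K / sqrt \<epsilon> > 0" using e by (simp add: K_def)
  then show ?thesis using main e by blast
qed

end
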